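(* Let $(N,\langle\,,\,\rangle)$ be a pseudo-$H$-type Lie group. Then \begin{enumerate} \item $\mathrm{Iso}^{aut}(N)=\mathrm{Iso}^{spl}(N)=\mathrm{Iso}(N)$; \item the scalar curvature of $(N,\langle\,,\,\rangle)$ is negative. \end{enumerate}
   Context: Let $N$ be a simply connected $2$-step nilpotent (in particular non-abelian) Lie group with Lie algebra $\mathfrak{n}$, equipped with a left-invariant pseudo-Riemannian metric, which induces a non-degenerate symmetric bilinear form $\langle\,,\,\rangle$ on $\mathfrak{n}$. Suppose the restriction of $\langle\,,\,\rangle$ to the center $\mathfrak{z}$ of $\mathfrak{n}$ is non-degenerate, and set $\mathfrak{v}=\mathfrak{z}^\perp$, so $\mathfrak{n}=\mathfrak{v}\oplus\mathfrak{z}$. For $w\in\mathfrak{z}$ the linear map $j(w):\mathfrak{v}\to\mathfrak{v}$ is defined by $\langle j(w)u,u'\rangle=\langle w,[u,u']\rangle$ for all $u,u'\in\mathfrak{v}$. The group $(N,\langle\,,\,\rangle)$ is of pseudo-$H$-type if $j(u)^2=-\langle u,u\rangle I$ for all $u\in\mathfrak{z}$. $\mathrm{Iso}(N)$ is the full isometry group. Left-translating $\mathfrak{v},\mathfrak{z}$ gives left-invariant distributions with $TN=\mathfrak{v}N\oplus\mathfrak{z}N$; $\mathrm{Iso}^{spl}(N)$ is the group of isometries whose differential preserves both $\mathfrak{v}N$ and $\mathfrak{z}N$. $H^{aut_N}=\mathrm{Aut}(N)\cap\mathrm{Iso}(N)$, and $\mathrm{Iso}^{aut}(N)=N\cdot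 H^{aut_N}$ is the group of isometries of the form $L_n\circ\varphi$ with $L_n$ the left-translation by $n\in N$ and $\varphi\in H^{aut_N}$. The curvature is $R(u,w)=[\nabla_u,\nabla_w]-\nabla_{[u,w]}$ with $\nabla$ the Levi-Civita connection; the Ricci tensor is $\mathrm{Ric}(u,w)=\mathrm{trace}(\xi\mapsto R(\xi,u)w)$; the Ricci operator $\mathrm{Rc}$ is given by $\langle \mathrm{Rc}\,u,w\rangle=\mathrm{Ric}(u,w)$; the scalar curvature is the trace of $\mathrm{Rc}$. *)

theory Defs
  imports "HOL-Analysis.Analysis" "HOL-Algebra.Group"
begin

section \<open>Smooth functions and smooth atlases\<close>

text \<open>The set \<open>S\<close> is meant to be open. Second and higher derivatives are taken of the
  directional derivatives \<open>\<lambda>x. f' x v\<close>, so that the type does not change.\<close>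

primrec Ck_on :: "nat \<Rightarrow> 'a set \<Rightarrow> ('a::real_normed_vector \<Rightarrow> 'b::real_normed_vector) \<Rightarrow> bool" where
  "Ck_on 0 S f \<longleftrightarrow> continuous_on S f"
| "Ck_on (Suc k) S f \<longleftrightarrow>
     (\<exists>f'. (\<forall>x\<in>S. (f has_derivative f' x) (at x)) \<and> (\<forall>v. Ck_on k S (\<lambda>x. f' x v)))"

definition Cinf_on :: "'a set \<Rightarrow> ('a::real_normed_vector \<Rightarrow> 'b::real_normed_vector) \<Rightarrow> bool" where
  "Cinf_on S f \<longleftrightarrow> (\<forall>k. Ck_on k S f)"

text \<open>A chart is a pair of its domain and its coordinate map; an atlas is not required to be maximal.\<close>

type_synonym ('m, 'e) chart = "'m set \<times> ('m \<Rightarrow> 'e)"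

definition is_chart :: "('m::topological_space, 'e::euclidean_space) chart \<Rightarrow> bool" where
  "is_chart = (\<lambda>(U, c). open U \<and> open (c ` U) \<and> homeomorphism U (c ` U) c (the_inv_into U c)
     \<and> inj_on c U)"

definition smooth_atlas :: "('m::topological_space, 'e::euclidean_space) chart set \<Rightarrow> bool" where
  "smooth_atlas A \<longleftrightarrow>
     (\<forall>C\<in>A. is_chart C) \<and> (\<Union>(U, c)\<in>A. U) = UNIV \<and>
     (\<forall>(U, c)\<in>A. \<forall>(V, d)\<in>A. Cinf_on (c ` (U \<inter> V)) (d \<circ> the_inv_into U c))"

definition smooth_fun_on ::
  "('m::topological_space, 'e::euclidean_space) chart set \<Rightarrow> 'm set \<Rightarrow>
   ('m \<Rightarrow> 'b::real_normed_vector) \<Rightarrow> bool" where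
  "smooth_fun_on A W f \<longleftrightarrow> (\<forall>(U, c)\<in>A. Cinf_on (c ` (U \<inter> W)) (f \<circ> the_inv_into U c))"

definition smooth_map ::
  "('m::topological_space, 'e::euclidean_space) chart set \<Rightarrow>
   ('n::topological_space, 'f::euclidean_space) chart set \<Rightarrow> ('m \<Rightarrow> 'n) \<Rightarrow> bool" where
  "smooth_map A B F \<longleftrightarrow> continuous_on UNIV F \<and>
     (\<forall>(U, c)\<in>A. \<forall>(V, d)\<in>B. Cinf_on (c ` (U \<inter> F -` V)) (d \<circ> F \<circ> the_inv_into U c))"

definition prod_atlas ::
  "('m, 'e) chart set \<Rightarrow> ('n, 'f) chart set \<Rightarrow> ('m \<times> 'n, 'e \<times> 'f) chart set" where
  "prod_atlas A B = {(U \<times> V, map_prod c d) |U c V d. (U, c) \<in> A \<and> (V, d) \<in> B}"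

definition diffeomorphism ::
  "('m::topological_space, 'e::euclidean_space) chart set \<Rightarrow> ('m \<Rightarrow> 'm) \<Rightarrow> bool" where
  "diffeomorphism A F \<longleftrightarrow> bij F \<and> smooth_map A A F \<and> smooth_map A A (inv_into UNIV F)"


section \<open>Lie groups and their tangent bundle\<close>

text \<open>
  The underlying manifold is a whole type, with its topology. The record carries, besides the group
  and the atlas, one chart \<open>\<kappa>\<close> around the unit, used to identify the tangent space at the unit,
  that is, the Lie algebra, with the model space \<open>'e\<close>. Nothing is assumed about this chart except
  that it belongs to the atlas. The inner product of \<open>'e\<close> plays no role (other than through its
  topology and in the basis-independent trace).
\<close>

record ('m, 'e) lie_data = "'m monoid" +
  atlas :: "('m, 'e) chart set"
  unit_chart :: "('m, 'e) chart"

definition lie_group ::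
  "('m::{t2_space, second_countable_topology}, 'e::euclidean_space) lie_data \<Rightarrow> bool" where
  "lie_group N \<longleftrightarrow>
     group N \<and> carrier N = UNIV \<and> smooth_atlas (atlas N) \<and>
     smooth_map (prod_atlas (atlas N) (atlas N)) (atlas N) (\<lambda>(x, y). x \<otimes>\<^bsub>N\<^esub> y) \<and>
     smooth_map (atlas N) (atlas N) (m_inv N) \<and>
     unit_chart N \<in> atlas N \<and> \<one>\<^bsub>N\<^esub> \<in> fst (unit_chart N)"

definition coord :: "('m, 'e) lie_data \<Rightarrow> 'm \<Rightarrow> 'e" where
  "coord N = snd (unit_chart N)"

definition uncoord :: "('m, 'e) lie_data \<Rightarrow> 'e \<Rightarrow> 'm" where
  "uncoord N = the_inv_into (fst (unit_chart N)) (coord N)"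

text \<open>
  The tangent bundle is trivialized by left translations: a vector \<open>u :: 'e\<close> at the point \<open>p\<close> stands
  for the tangent vector \<open>dL\<^sub>p (d\<kappa>\<^sup>-\<^sup>1 u)\<close> at \<open>p\<close>, the velocity at \<open>t = 0\<close> of
  the curve \<open>p \<otimes> \<kappa>\<^sup>-\<^sup>1 (\<kappa> \<one> + t u)\<close>. A vector field is thus a function from the group to \<open>'e\<close>,
  and the left-invariant vector fields are the constant functions \<open>\<lambda>_. u\<close>.

  \<open>dir_deriv N f p u\<close> is the derivative of the function \<open>f\<close> along this tangent vector,
  and \<open>differential N F p\<close> is the differential of \<open>F\<close> at \<open>p\<close>, written in the trivializations at
  \<open>p\<close> and at \<open>F p\<close>.
\<close>

definition dir_deriv ::
  "('m, 'e::euclidean_space) lie_data \<Rightarrow> ('m \<Rightarrow> 'b::real_normed_vector) \<Rightarrow> 'm \<Rightarrow> 'e \<Rightarrow> 'b" where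
  "dir_deriv N f p =
     frechet_derivative (\<lambda>x. f (p \<otimes>\<^bsub>N\<^esub> uncoord N x)) (at (coord N \<one>\<^bsub>N\<^esub>))"

definition differential ::
  "('m, 'e::euclidean_space) lie_data \<Rightarrow> ('m \<Rightarrow> 'm) \<Rightarrow> 'm \<Rightarrow> 'e \<Rightarrow> 'e" where
  "differential N F p =
     frechet_derivative (\<lambda>x. coord N (m_inv N (F p) \<otimes>\<^bsub>N\<^esub> F (p \<otimes>\<^bsub>N\<^esub> uncoord N x)))
       (at (coord N \<one>\<^bsub>N\<^esub>))"

definition vf_apply ::
  "('m, 'e::euclidean_space) lie_data \<Rightarrow> ('m \<Rightarrow> 'e) \<Rightarrow> ('m \<Rightarrow> real) \<Rightarrow> 'm \<Rightarrow> real" where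
  "vf_apply N X f = (\<lambda>p. dir_deriv N f p (X p))"

text \<open>The commutator of smooth vector fields, by its action on locally defined smooth functions.\<close>

definition vf_bracket ::
  "('m::topological_space, 'e::euclidean_space) lie_data \<Rightarrow>
   ('m \<Rightarrow> 'e) \<Rightarrow> ('m \<Rightarrow> 'e) \<Rightarrow> 'm \<Rightarrow> 'e" where
  "vf_bracket N X Y p =
     (THE w. \<forall>W f. open W \<and> p \<in> W \<and> smooth_fun_on (atlas N) W f \<longrightarrow>
        dir_deriv N f p w = vf_apply N X (vf_apply N Y f) p - vf_apply N Y (vf_apply N X f) p)"

definition lie_bracket ::
  "('m::topological_space, 'e::euclidean_space) lie_data \<Rightarrow> 'e \<Rightarrow> 'e \<Rightarrow> 'e" where
  "lie_bracket N u v = vf_bracket N (\<lambda>_. u) (\<lambda>_. v) \<one>\<^bsub>N\<^esub>"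

definition two_step_nilpotent ::
  "('m::topological_space, 'e::euclidean_space) lie_data \<Rightarrow> bool" where
  "two_step_nilpotent N \<longleftrightarrow>
     (\<forall>u v w. lie_bracket N u (lie_bracket N v w) = 0) \<and> (\<exists>u v. lie_bracket N u v \<noteq> 0)"


section \<open>Pseudo-Riemannian metrics, isometries and curvature\<close>

text \<open>A metric is given in the trivialization: \<open>g p u v\<close> is the product at \<open>p\<close> of the tangent
  vectors represented by \<open>u\<close> and \<open>v\<close>. The signature is arbitrary.\<close>

definition pseudo_riemannian ::
  "('m::topological_space, 'e::euclidean_space) lie_data \<Rightarrow> ('m \<Rightarrow> 'e \<Rightarrow> 'e \<Rightarrow> real) \<Rightarrow> bool" where
  "pseudo_riemannian N g \<longleftrightarrow>
     (\<forall>p. bilinear (g p) \<and> (\<forall>u v. g p u v = g p v u) \<and> (\<forall>u. (\<forall>v. g p u v = 0) \<longrightarrow> u = 0)) \<and>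
     (\<forall>u v. smooth_fun_on (atlas N) UNIV (\<lambda>p. g p u v))"

definition Isom ::
  "('m::topological_space, 'e::euclidean_space) lie_data \<Rightarrow> ('m \<Rightarrow> 'e \<Rightarrow> 'e \<Rightarrow> real) \<Rightarrow>
   ('m \<Rightarrow> 'm) set" where
  "Isom N g = {F. diffeomorphism (atlas N) F \<and>
     (\<forall>p u v. g (F p) (differential N F p u) (differential N F p v) = g p u v)}"

definition left_invariant ::
  "('m::topological_space, 'e::euclidean_space) lie_data \<Rightarrow> ('m \<Rightarrow> 'e \<Rightarrow> 'e \<Rightarrow> real) \<Rightarrow> bool" where
  "left_invariant N g \<longleftrightarrow> (\<forall>a. (\<lambda>x. a \<otimes>\<^bsub>N\<^esub> x) \<in> Isom N g)"

definition affine_connection ::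
  "('m::topological_space, 'e::euclidean_space) lie_data \<Rightarrow>
   (('m \<Rightarrow> 'e) \<Rightarrow> ('m \<Rightarrow> 'e) \<Rightarrow> 'm \<Rightarrow> 'e) \<Rightarrow> bool" where
  "affine_connection N D \<longleftrightarrow>
     (let vf = {X :: 'm \<Rightarrow> 'e. smooth_fun_on (atlas N) UNIV X};
          fn = {f :: 'm \<Rightarrow> real. smooth_fun_on (atlas N) UNIV f} in
      (\<forall>X\<in>vf. \<forall>Y\<in>vf. D X Y \<in> vf) \<and>
      (\<forall>X\<in>vf. \<forall>X'\<in>vf. \<forall>Y\<in>vf. D (\<lambda>p. X p + X' p) Y = (\<lambda>p. D X Y p + D X' Y p)) \<and>
      (\<forall>X\<in>vf. \<forall>Y\<in>vf. \<forall>Y'\<in>vf. D X (\<lambda>p. Y p + Y' p) = (\<lambda>p. D X Y p + D X Y' p)) \<and>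
      (\<forall>f\<in>fn. \<forall>X\<in>vf. \<forall>Y\<in>vf. D (\<lambda>p. f p *\<^sub>R X p) Y = (\<lambda>p. f p *\<^sub>R D X Y p)) \<and>
      (\<forall>f\<in>fn. \<forall>X\<in>vf. \<forall>Y\<in>vf.
         D X (\<lambda>p. f p *\<^sub>R Y p) = (\<lambda>p. vf_apply N X f p *\<^sub>R Y p + f p *\<^sub>R D X Y p)))"

text \<open>The last condition only fixes the irrelevant values of \<open>D\<close> at non-smooth vector fields,
  so that the Levi-Civita connection is unique as a function.\<close>

definition is_levi_civita ::
  "('m::topological_space, 'e::euclidean_space) lie_data \<Rightarrow> ('m \<Rightarrow> 'e \<Rightarrow> 'e \<Rightarrow> real) \<Rightarrow>
   (('m \<Rightarrow> 'e) \<Rightarrow> ('m \<Rightarrow> 'e) \<Rightarrow> 'm \<Rightarrow> 'e) \<Rightarrow> bool" where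
  "is_levi_civita N g D \<longleftrightarrow> affine_connection N D \<and>
     (let vf = {X :: 'm \<Rightarrow> 'e. smooth_fun_on (atlas N) UNIV X} in
      (\<forall>X\<in>vf. \<forall>Y\<in>vf. (\<lambda>p. D X Y p - D Y X p) = vf_bracket N X Y) \<and>
      (\<forall>X\<in>vf. \<forall>Y\<in>vf. \<forall>Z\<in>vf.
         vf_apply N X (\<lambda>p. g p (Y p) (Z p)) = (\<lambda>p. g p (D X Y p) (Z p) + g p (Y p) (D X Z p))) \<and>
      (\<forall>X Y. X \<notin> vf \<or> Y \<notin> vf \<longrightarrow> D X Y = (\<lambda>_. 0)))"

definition levi_civita ::
  "('m::topological_space, 'e::euclidean_space) lie_data \<Rightarrow> ('m \<Rightarrow> 'e \<Rightarrow> 'e \<Rightarrow> real) \<Rightarrow>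
   ('m \<Rightarrow> 'e) \<Rightarrow> ('m \<Rightarrow> 'e) \<Rightarrow> 'm \<Rightarrow> 'e" where
  "levi_civita N g = (THE D. is_levi_civita N g D)"

text \<open>\<open>curvature_vf N g X Y Z\<close> is \<open>R(X, Y) Z\<close>. It is tensorial, so its value at a point may be computed
  by extending tangent vectors to left-invariant (that is, constant) fields, as \<open>curvature\<close> does.\<close>

definition curvature_vf ::
  "('m::topological_space, 'e::euclidean_space) lie_data \<Rightarrow> ('m \<Rightarrow> 'e \<Rightarrow> 'e \<Rightarrow> real) \<Rightarrow>
   ('m \<Rightarrow> 'e) \<Rightarrow> ('m \<Rightarrow> 'e) \<Rightarrow> ('m \<Rightarrow> 'e) \<Rightarrow> 'm \<Rightarrow> 'e" where
  "curvature_vf N g X Y Z = (let D = levi_civita N g in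
     (\<lambda>p. D X (D Y Z) p - D Y (D X Z) p - D (vf_bracket N X Y) Z p))"

definition curvature ::
  "('m::topological_space, 'e::euclidean_space) lie_data \<Rightarrow> ('m \<Rightarrow> 'e \<Rightarrow> 'e \<Rightarrow> real) \<Rightarrow>
   'm \<Rightarrow> 'e \<Rightarrow> 'e \<Rightarrow> 'e \<Rightarrow> 'e" where
  "curvature N g p u v w = curvature_vf N g (\<lambda>_. u) (\<lambda>_. v) (\<lambda>_. w) p"

text \<open>Trace of a linear endomorphism; the choice of the standard basis is immaterial.\<close>

definition trace_lin :: "('e::euclidean_space \<Rightarrow> 'e) \<Rightarrow> real" where
  "trace_lin L = (\<Sum>b\<in>Basis. L b \<bullet> b)"

definition ricci ::
  "('m::topological_space, 'e::euclidean_space) lie_data \<Rightarrow> ('m \<Rightarrow> 'e \<Rightarrow> 'e \<Rightarrow> real) \<Rightarrow>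
   'm \<Rightarrow> 'e \<Rightarrow> 'e \<Rightarrow> real" where
  "ricci N g p u w = trace_lin (\<lambda>\<xi>. curvature N g p \<xi> u w)"

definition ricci_op ::
  "('m::topological_space, 'e::euclidean_space) lie_data \<Rightarrow> ('m \<Rightarrow> 'e \<Rightarrow> 'e \<Rightarrow> real) \<Rightarrow>
   'm \<Rightarrow> 'e \<Rightarrow> 'e" where
  "ricci_op N g p u = (THE x. \<forall>w. g p x w = ricci N g p u w)"

definition scalar_curvature ::
  "('m::topological_space, 'e::euclidean_space) lie_data \<Rightarrow> ('m \<Rightarrow> 'e \<Rightarrow> 'e \<Rightarrow> real) \<Rightarrow>
   'm \<Rightarrow> real" where
  "scalar_curvature N g p = trace_lin (ricci_op N g p)"


section \<open>Pseudo-H-type groups and their isometry groups\<close>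

text \<open>For a left-invariant metric \<open>g\<close>, the form induced on the Lie algebra is \<open>g \<one>\<close>.\<close>

definition center_alg ::
  "('m::topological_space, 'e::euclidean_space) lie_data \<Rightarrow> 'e set" where
  "center_alg N = {z. \<forall>u. lie_bracket N z u = 0}"

definition center_perp ::
  "('m::topological_space, 'e::euclidean_space) lie_data \<Rightarrow> ('m \<Rightarrow> 'e \<Rightarrow> 'e \<Rightarrow> real) \<Rightarrow> 'e set" where
  "center_perp N g = {v. \<forall>z\<in>center_alg N. g \<one>\<^bsub>N\<^esub> v z = 0}"

definition nondegenerate_center ::
  "('m::topological_space, 'e::euclidean_space) lie_data \<Rightarrow> ('m \<Rightarrow> 'e \<Rightarrow> 'e \<Rightarrow> real) \<Rightarrow> bool" where
  "nondegenerate_center N g \<longleftrightarrow>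
     (\<forall>z\<in>center_alg N. (\<forall>w\<in>center_alg N. g \<one>\<^bsub>N\<^esub> z w = 0) \<longrightarrow> z = 0)"

definition jmap ::
  "('m::topological_space, 'e::euclidean_space) lie_data \<Rightarrow> ('m \<Rightarrow> 'e \<Rightarrow> 'e \<Rightarrow> real) \<Rightarrow>
   'e \<Rightarrow> 'e \<Rightarrow> 'e" where
  "jmap N g w u = (THE x. x \<in> center_perp N g \<and>
     (\<forall>u'\<in>center_perp N g. g \<one>\<^bsub>N\<^esub> x u' = g \<one>\<^bsub>N\<^esub> w (lie_bracket N u u')))"

definition pseudo_H_type ::
  "('m::{t2_space, second_countable_topology}, 'e::euclidean_space) lie_data \<Rightarrow>
   ('m \<Rightarrow> 'e \<Rightarrow> 'e \<Rightarrow> real) \<Rightarrow> bool" where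
  "pseudo_H_type N g \<longleftrightarrow>
     lie_group N \<and> simply_connected (UNIV :: 'm set) \<and> two_step_nilpotent N \<and>
     pseudo_riemannian N g \<and> left_invariant N g \<and> nondegenerate_center N g \<and>
     (\<forall>z\<in>center_alg N. \<forall>v\<in>center_perp N g.
        jmap N g z (jmap N g z v) = - g \<one>\<^bsub>N\<^esub> z z *\<^sub>R v)"

text \<open>In the trivialization, the left-invariant distributions obtained by left-translating
  \<open>center_perp N g\<close> and \<open>center_alg N\<close> are these same subspaces at every point.\<close>

definition Isom_spl ::
  "('m::topological_space, 'e::euclidean_space) lie_data \<Rightarrow> ('m \<Rightarrow> 'e \<Rightarrow> 'e \<Rightarrow> real) \<Rightarrow>
   ('m \<Rightarrow> 'm) set" where
  "Isom_spl N g = {F \<in> Isom N g. \<forall>p.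
     differential N F p ` center_perp N g = center_perp N g \<and>
     differential N F p ` center_alg N = center_alg N}"

definition Lie_Aut :: "('m::topological_space, 'e::euclidean_space) lie_data \<Rightarrow> ('m \<Rightarrow> 'm) set" where
  "Lie_Aut N = {F \<in> iso N N. diffeomorphism (atlas N) F}"

definition Isom_aut ::
  "('m::topological_space, 'e::euclidean_space) lie_data \<Rightarrow> ('m \<Rightarrow> 'e \<Rightarrow> 'e \<Rightarrow> real) \<Rightarrow>
   ('m \<Rightarrow> 'm) set" where
  "Isom_aut N g = {(\<lambda>x. n \<otimes>\<^bsub>N\<^esub> F x) |n F. F \<in> Lie_Aut N \<inter> Isom N g}"

end

theory Submission
  imports Defs
begin

text \<open>
  In the left trivialization, the differential of an isometry \<open>F\<close> is a function \<open>a\<close> from \<open>N\<close> to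
  the linear automorphisms of the Lie algebra. The pulled back Maurer--Cartan equation and the
  invariance of the metric give, by the Koszul argument, \<open>D\<^sub>u a = a \<Gamma>\<^sub>u - \<Gamma>\<^bsub>a u\<^esub> a\<close>, where
  \<open>\<Gamma>\<close> is the Levi-Civita connection on left-invariant fields. Commuting two such derivatives shows
  that \<open>a\<close> preserves the curvature, hence the Ricci tensor, whose operator is \<open>- (dim \<zz> / 2)\<close> on
  \<open>\<vv>\<close> and \<open>dim \<vv> / 4\<close> on \<open>\<zz>\<close>. This gives the sign of the scalar curvature, and \<open>a\<close> preserves both
  eigenspaces. Then so does \<open>D\<^sub>u a\<close>, whereas \<open>\<Gamma>\<close> maps \<open>\<vv> \<times> \<zz>\<close> to \<open>\<vv>\<close> and \<open>\<vv> \<times> \<vv>\<close> to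
  \<open>\<zz>\<close>; comparing components, \<open>D\<^sub>u a = 0\<close>, so \<open>a\<close> is constant. If moreover \<open>F\<close> fixes the unit,
  then \<open>F\<close> and \<open>x \<mapsto> F(b)\<^sup>-\<^sup>1 F(b x)\<close> have the same constant differential and agree at the unit,
  hence coincide, and \<open>F\<close> is a homomorphism.
\<close>


section \<open>Calculus of smooth functions on Euclidean spaces\<close>

text \<open>The H-type condition enters through its polarization, a Clifford relation, which makes
  every surviving trace in the Ricci tensor a multiple of the metric on \<vv> or on \<zz>. Both
  dimensions are positive since the group is non-abelian, so the two eigenvalues differ and each
  summand is determined by the metric and the Ricci tensor alone. The formula for
  \<open>D\<^sub>u a\<close> says that \<open>F\<close> preserves the Levi-Civita connection: its
  defect, pulled back by \<open>a\<close>, is symmetric in two arguments by vanishing torsion and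
  skew in two by invariance of the metric, hence zero. Invariance of the curvature is the
  integrability condition of that formula. Connectedness enters twice: to pass from
  \<open>D\<^sub>u a = 0\<close> to a constant \<open>a\<close>, and from equal differentials to
  equal maps.\<close>

lemma Ck_on_0I: "Ck_on k S f \<Longrightarrow> continuous_on S f"
  by (cases k) (auto intro!: continuous_at_imp_continuous_on dest: has_derivative_continuous)

lemma Ck_on_SucE:
  assumes "Ck_on (Suc k) S f"
  obtains f' where "\<And>x. x \<in> S \<Longrightarrow> (f has_derivative f' x) (at x)" "\<And>v. Ck_on k S (\<lambda>x. f' x v)"
  using assms by auto

text \<open>A derivative at a point depends on nearby values, hence the open set. Coordinate
  expressions are later simplified by this lemma on images of charts, where
  \<open>the_inv_into\<close> is a genuine inverse.\<close>

lemma Ck_on_cong_open: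
  assumes "open S" "\<And>x. x \<in> S \<Longrightarrow> f x = h x" "Ck_on k S f"
  shows "Ck_on k S h"
  using assms(2,3)
proof (cases k)
  case 0
  then show ?thesis using assms by (auto cong: continuous_on_cong)
next
  case (Suc m)
  then obtain f' where f': "\<And>x. x\<in>S \<Longrightarrow> (f has_derivative f' x) (at x)" "\<And>v. Ck_on m S (\<lambda>x. f' x v)"
    using assms(3) by auto
  have "(h has_derivative f' x) (at x)" if "x \<in> S" for x
    using has_derivative_transform_within_open[OF f'(1)[OF that] assms(1) that assms(2)] by auto
  then show ?thesis using f'(2) Suc by auto
qed

lemma Ck_on_subset: "Ck_on k S f \<Longrightarrow> T \<subseteq> S \<Longrightarrow> Ck_on k T f"
  by (induction k arbitrary: f) (auto intro: continuous_on_subset, blast)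

lemma Ck_on_SucD: "Ck_on (Suc k) S f \<Longrightarrow> Ck_on k S f"
proof (induction k arbitrary: f)
  case 0
  then show ?case using Ck_on_0I by (metis Ck_on.simps(1))
next
  case (Suc k)
  obtain f' where f': "\<And>x. x\<in>S \<Longrightarrow> (f has_derivative f' x) (at x)" "\<And>v. Ck_on (Suc k) S (\<lambda>x. f' x v)"
    using Suc.prems by (rule Ck_on_SucE) blast
  then have "\<And>v. Ck_on k S (\<lambda>x. f' x v)" using Suc.IH by blast
  then show ?case using f'(1) by auto
qed

lemma Ck_on_Suc_frechet:
  assumes "open S"
  shows "Ck_on (Suc k) S f \<longleftrightarrow>
     (\<forall>x\<in>S. f differentiable (at x)) \<and> (\<forall>v. Ck_on k S (\<lambda>x. frechet_derivative f (at x) v))"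
    (is "?l = ?r")
proof
  assume ?l
  then obtain f' where f': "\<And>x. x\<in>S \<Longrightarrow> (f has_derivative f' x) (at x)" "\<And>v. Ck_on k S (\<lambda>x. f' x v)"
    by auto
  have "f' x = frechet_derivative f (at x)" if "x \<in> S" for x
    using frechet_derivative_at[OF f'(1)[OF that]] .
  then show ?r
    using f' Ck_on_cong_open[OF assms _ f'(2)] by (auto simp: differentiable_def)
next
  assume ?r
  then show ?l by (auto simp: frechet_derivative_works)
qed

text \<open>Different pieces \<open>T\<close> come with different witnesses for the derivative;
  \<open>frechet_derivative\<close> is determined by the values of \<open>f\<close> near the point
  and is therefore common to all of them.\<close>

lemma Ck_on_local:
  assumes "\<And>x. x \<in> S \<Longrightarrow> \<exists>T. open T \<and> x \<in> T \<and> Ck_on k T f"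
  shows "Ck_on k S f"
  using assms
proof (induction k arbitrary: f)
  case 0
  then have "continuous (at x) f" if "x \<in> S" for x
    using that by (force simp: continuous_on_eq_continuous_at)
  then show ?case by (auto intro: continuous_at_imp_continuous_on)
next
  case (Suc k)
  have "f differentiable (at x)" if "x \<in> S" for x
    using Suc.prems[OF that] Ck_on_Suc_frechet by blast
  moreover have "Ck_on k S (\<lambda>x. frechet_derivative f (at x) v)" for v
  proof (rule Suc.IH)
    fix x assume "x \<in> S"
    then obtain T where "open T" "x \<in> T" "Ck_on (Suc k) T f" using Suc.prems by blast
    then show "\<exists>T. open T \<and> x \<in> T \<and> Ck_on k T (\<lambda>x. frechet_derivative f (at x) v)"
      using Ck_on_Suc_frechet by blast
  qed
  ultimately show ?case unfolding Ck_on.simps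
    by (intro exI[of _ "\<lambda>x. frechet_derivative f (at x)"]) (auto simp: frechet_derivative_works)
qed

lemma Ck_on_const: "Ck_on k S (\<lambda>x. c)"
proof (induction k arbitrary: c)
  case (Suc k)
  show ?case unfolding Ck_on.simps
    by (intro exI[of _ "\<lambda>_ _. 0"] conjI ballI allI Suc has_derivative_const)
qed simp

lemma Ck_on_bounded_linear: "bounded_linear f \<Longrightarrow> Ck_on k S f"
proof (cases k)
  case (Suc m)
  assume "bounded_linear f"
  then show ?thesis 
    using Suc by (auto intro!: exI[of _ "\<lambda>_. f"] Ck_on_const bounded_linear_imp_has_derivative)
qed (simp add: linear_continuous_on)

lemma Ck_on_add: "Ck_on k S f \<Longrightarrow> Ck_on k S h \<Longrightarrow> Ck_on k S (\<lambda>x. f x + h x)"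
proof (induction k arbitrary: f h)
  case 0 then show ?case by (auto intro: continuous_intros)
next
  case (Suc k)
  obtain f' where f': "\<And>x. x\<in>S \<Longrightarrow> (f has_derivative f' x) (at x)" "\<And>v. Ck_on k S (\<lambda>x. f' x v)"
    using Suc.prems(1) by (rule Ck_on_SucE) blast
  obtain h' where h': "\<And>x. x\<in>S \<Longrightarrow> (h has_derivative h' x) (at x)" "\<And>v. Ck_on k S (\<lambda>x. h' x v)"
    using Suc.prems(2) by (rule Ck_on_SucE) blast
  from f' h' show ?case
    by (auto intro!: exI[of _ "\<lambda>x v. f' x v + h' x v"] has_derivative_add Suc.IH)
qed

lemma Ck_on_sum: "(\<And>i. i \<in> I \<Longrightarrow> Ck_on k S (f i)) \<Longrightarrow> Ck_on k S (\<lambda>x. \<Sum>i\<in>I. f i x)"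
  by (induction I rule: infinite_finite_induct) (auto intro: Ck_on_const Ck_on_add)

lemma Ck_on_linear_comp:
  assumes "bounded_linear l" shows "Ck_on k S f \<Longrightarrow> Ck_on k S (\<lambda>x. l (f x))"
proof (induction k arbitrary: f)
  case 0 then show ?case by (auto intro: bounded_linear.continuous_on[OF assms])
next
  case (Suc k)
  from Suc.prems obtain f' where
    "\<And>x. x\<in>S \<Longrightarrow> (f has_derivative f' x) (at x)" "\<And>v. Ck_on k S (\<lambda>x. f' x v)" by auto
  then show ?case
    by (auto intro!: exI[of _ "\<lambda>x v. l (f' x v)"] bounded_linear.has_derivative[OF assms] Suc.IH)
qed

lemma Ck_on_bilinear:
  assumes "bounded_bilinear B"
  shows "Ck_on k S f \<Longrightarrow> Ck_on k S h \<Longrightarrow> Ck_on k S (\<lambda>x. B (f x) (h x))"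
proof (induction k arbitrary: f h)
  case 0 then show ?case by (auto intro: bounded_bilinear.continuous_on[OF assms])
next
  case (Suc k)
  obtain f' where f': "\<And>x. x\<in>S \<Longrightarrow> (f has_derivative f' x) (at x)" "\<And>v. Ck_on k S (\<lambda>x. f' x v)"
    using Suc.prems(1) by (rule Ck_on_SucE) blast
  obtain h' where h': "\<And>x. x\<in>S \<Longrightarrow> (h has_derivative h' x) (at x)" "\<And>v. Ck_on k S (\<lambda>x. h' x v)"
    using Suc.prems(2) by (rule Ck_on_SucE) blast
  have "Ck_on k S f" "Ck_on k S h" using Suc.prems Ck_on_SucD by blast+
  with f' h' show ?case
    by (auto intro!: exI[of _ "\<lambda>x v. B (f x) (h' x v) + B (f' x v) (h x)"] 
        bounded_bilinear.FDERIV[OF assms] Suc.IH Ck_on_add)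
qed

text \<open>In the derivative \<open>h' (f x) (f' x v)\<close> both the base point and the direction
  vary with \<open>x\<close>, while \<open>Ck_on\<close> controls \<open>h'\<close> for fixed
  directions only. Expanding the direction in \<open>Basis\<close> of the Euclidean middle space
  gives a sum of products to which the induction hypothesis applies.\<close>

lemma Ck_on_compose:
  fixes h :: "'b::euclidean_space \<Rightarrow> 'c::real_normed_vector"
  assumes "Ck_on k T h" "Ck_on k S f" "f ` S \<subseteq> T"
  shows "Ck_on k S (\<lambda>x. h (f x))"
  using assms(1,2)
proof (induction k arbitrary: h)
  case 0 
  then show ?case using assms(3) by (auto intro: continuous_on_compose2)
next
  case (Suc k)
  obtain f' where f': "\<And>x. x\<in>S \<Longrightarrow> (f has_derivative f' x) (at x)" "\<And>v. Ck_on k S (\<lambda>x. f' x v)"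
    using Suc.prems(2) by (rule Ck_on_SucE) blast
  obtain h' where h': "\<And>x. x\<in>T \<Longrightarrow> (h has_derivative h' x) (at x)" "\<And>v. Ck_on k T (\<lambda>x. h' x v)"
    using Suc.prems(1) by (rule Ck_on_SucE) blast
  let ?d = "\<lambda>x v. \<Sum>b\<in>Basis. (f' x v \<bullet> b) *\<^sub>R h' (f x) b"
  have "((\<lambda>x. h (f x)) has_derivative ?d x) (at x)" if "x \<in> S" for x
  proof -
    have hd: "(h has_derivative h' (f x)) (at (f x))" using h'(1) that assms(3) by auto
    have lin: "linear (h' (f x))" using hd has_derivative_linear by blast
    have "((\<lambda>x. h (f x)) has_derivative (\<lambda>v. h' (f x) (f' x v))) (at x)"
      using has_derivative_compose[OF f'(1)[OF that] hd] .
    moreover have "h' (f x) (f' x v) = ?d x v" for v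
    proof -
      have "h' (f x) (\<Sum>b\<in>Basis. (f' x v \<bullet> b) *\<^sub>R b) = ?d x v"
        by (simp add: linear_sum[OF lin] linear_scale[OF lin])
      then show ?thesis by (simp add: euclidean_representation)
    qed
    ultimately show ?thesis by (simp only:)
  qed
  moreover have "Ck_on k S (\<lambda>x. ?d x v)" for v
    by (intro Ck_on_sum Ck_on_bilinear[OF bounded_bilinear_scaleR] Suc.IH h'(2) 
        Ck_on_linear_comp[OF bounded_linear_inner_left] f'(2) Ck_on_SucD[OF Suc.prems(2)])
  ultimately show ?case unfolding Ck_on.simps by (intro exI[of _ ?d] conjI ballI allI)
qed

lemma Ck_on_Pair: "Ck_on k S f \<Longrightarrow> Ck_on k S h \<Longrightarrow> Ck_on k S (\<lambda>x. (f x, h x))"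
proof -
  assume a: "Ck_on k S f" "Ck_on k S h"
  have "bounded_linear (\<lambda>x. (x, 0))" "bounded_linear (\<lambda>x. (0, x))"
    by (auto intro: bounded_linear_Pair bounded_linear_ident bounded_linear_zero)
  then have "Ck_on k S (\<lambda>x. (f x, 0) + (0, h x))"
    by (intro Ck_on_add Ck_on_linear_comp[where l="\<lambda>x. (x, 0)"] Ck_on_linear_comp[where l="\<lambda>x. (0, x)"] a)
  then show ?thesis by simp
qed

section \<open>Closure properties of smooth functions, order by order\<close>

lemma Cinf_on_cong_open: "open S \<Longrightarrow> (\<And>x. x \<in> S \<Longrightarrow> f x = h x) \<Longrightarrow> Cinf_on S f \<Longrightarrow> Cinf_on S h"
  unfolding Cinf_on_def using Ck_on_cong_open by blast

lemma Cinf_on_subset: "Cinf_on S f \<Longrightarrow> T \<subseteq> S \<Longrightarrow> Cinf_on T f"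
  unfolding Cinf_on_def using Ck_on_subset by blast

lemma Cinf_on_local: "(\<And>x. x \<in> S \<Longrightarrow> \<exists>T. open T \<and> x \<in> T \<and> Cinf_on T f) \<Longrightarrow> Cinf_on S f"
  unfolding Cinf_on_def using Ck_on_local by metis

lemma Cinf_on_const: "Cinf_on S (\<lambda>x. c)"
  unfolding Cinf_on_def using Ck_on_const by blast

lemma Cinf_on_bounded_linear: "bounded_linear f \<Longrightarrow> Cinf_on S f"
  unfolding Cinf_on_def using Ck_on_bounded_linear by blast

lemma Cinf_on_linear_comp: "bounded_linear l \<Longrightarrow> Cinf_on S f \<Longrightarrow> Cinf_on S (\<lambda>x. l (f x))"
  unfolding Cinf_on_def using Ck_on_linear_comp by blast

lemma Cinf_on_add: "Cinf_on S f \<Longrightarrow> Cinf_on S h \<Longrightarrow> Cinf_on S (\<lambda>x. f x + h x)"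
  unfolding Cinf_on_def using Ck_on_add by blast

lemma Cinf_on_bilinear:
  "bounded_bilinear B \<Longrightarrow> Cinf_on S f \<Longrightarrow> Cinf_on S h \<Longrightarrow> Cinf_on S (\<lambda>x. B (f x) (h x))"
  unfolding Cinf_on_def using Ck_on_bilinear by blast

lemma Cinf_on_compose:
  fixes h :: "'b::euclidean_space \<Rightarrow> 'c::real_normed_vector"
  shows "Cinf_on T h \<Longrightarrow> Cinf_on S f \<Longrightarrow> f ` S \<subseteq> T \<Longrightarrow> Cinf_on S (\<lambda>x. h (f x))"
  unfolding Cinf_on_def using Ck_on_compose by blast

lemma Cinf_on_Pair: "Cinf_on S f \<Longrightarrow> Cinf_on S h \<Longrightarrow> Cinf_on S (\<lambda>x. (f x, h x))"
  unfolding Cinf_on_def using Ck_on_Pair by blast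

lemma Cinf_on_continuous: "Cinf_on S f \<Longrightarrow> continuous_on S f"
  unfolding Cinf_on_def using Ck_on_0I by blast

lemma Cinf_on_differentiable: "Cinf_on S f \<Longrightarrow> x \<in> S \<Longrightarrow> f differentiable (at x)"
proof -
  assume "Cinf_on S f" "x \<in> S"
  then have "Ck_on (Suc 0) S f" "x \<in> S" unfolding Cinf_on_def by blast+
  then show ?thesis by (auto simp: differentiable_def)
qed

lemma Cinf_on_has_derivative:
  "Cinf_on S f \<Longrightarrow> x \<in> S \<Longrightarrow> (f has_derivative frechet_derivative f (at x)) (at x)"
  using Cinf_on_differentiable frechet_derivative_works by blast

lemma Cinf_on_frechet:
  "open S \<Longrightarrow> Cinf_on S f \<Longrightarrow> Cinf_on S (\<lambda>x. frechet_derivative f (at x) v)"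
  unfolding Cinf_on_def using Ck_on_Suc_frechet by blast


section \<open>Traces and non-degenerate symmetric forms\<close>

lemma trace_lin_add: "trace_lin (\<lambda>x. f x + h x) = trace_lin f + trace_lin h"
  by (simp add: trace_lin_def inner_add_left sum.distrib)

lemma trace_lin_diff: "trace_lin (\<lambda>x. f x - h x) = trace_lin f - trace_lin h"
  by (simp add: trace_lin_def inner_diff_left sum_subtractf)

lemma trace_lin_scale: "trace_lin (\<lambda>x. c *\<^sub>R f x) = c * trace_lin f"
  by (simp add: trace_lin_def sum_distrib_left)

lemma trace_lin_minus: "trace_lin (\<lambda>x. - f x) = - trace_lin f"
  by (simp add: trace_lin_def sum_negf)

lemma trace_lin_commute:
  fixes l m :: "'e::euclidean_space \<Rightarrow> 'e"
  assumes "linear l" "linear m"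
  shows "trace_lin (\<lambda>x. l (m x)) = trace_lin (\<lambda>x. m (l x))"
proof -
  have expand: "l (m b) \<bullet> b = (\<Sum>c\<in>Basis. (m b \<bullet> c) * (l c \<bullet> b))"
    if "linear l" "linear m" for l m :: "'e \<Rightarrow> 'e" and b
  proof -
    have "l (\<Sum>c\<in>Basis. (m b \<bullet> c) *\<^sub>R c) \<bullet> b = (\<Sum>c\<in>Basis. (m b \<bullet> c) * (l c \<bullet> b))"
      by (simp add: linear_sum[OF that(1)] linear_scale[OF that(1)] inner_sum_left)
    then show ?thesis by (simp add: euclidean_representation)
  qed
  show ?thesis
    unfolding trace_lin_def expand[OF assms] expand[OF assms(2,1)]
    by (subst sum.swap) (simp add: mult.commute)
qed

lemma trace_lin_conj:
  fixes l a :: "'e::euclidean_space \<Rightarrow> 'e"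
  assumes "linear l" "linear m" "linear a" "bij a" "\<And>x. m (a x) = a (l x)"
  shows "trace_lin m = trace_lin l"
proof -
  have lin: "linear (inv_into UNIV a)" using assms(3,4) by (simp add: bij_is_inj bij_is_surj linear_inj_imp_surj inj_linear_imp_inv_linear)
  have "m = (\<lambda>x. a (l (inv_into UNIV a x)))"
    using assms(4,5) by (metis bij_inv_eq_iff)
  then have "trace_lin m = trace_lin (\<lambda>x. a (l (inv_into UNIV a x)))" by simp
  also have "\<dots> = trace_lin (\<lambda>x. l (inv_into UNIV a (a x)))"
    using trace_lin_commute[OF assms(3) linear_compose[OF lin assms(1)]] by (simp add: o_def)
  also have "\<dots> = trace_lin l" using assms(4) by (simp add: bij_is_inj)
  finally show ?thesis .
qed

text \<open>Orthogonality refers to the inner product of the model space, not to the metric: the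
  projection is an auxiliary device for computing traces and for solving linear equations on
  \<open>Z\<close>.\<close>

lemma orthogonal_projection_exists:
  fixes Z :: "'e::euclidean_space set"
  assumes "subspace Z"
  obtains Pr where "linear Pr" "\<And>x. Pr x \<in> Z" "\<And>z. z \<in> Z \<Longrightarrow> Pr z = z"
    "\<And>x z. z \<in> Z \<Longrightarrow> Pr x \<bullet> z = x \<bullet> z" "trace_lin Pr = real (dim Z)"
proof -
  obtain B where B: "B \<subseteq> Z" "pairwise orthogonal B" "\<And>x. x \<in> B \<Longrightarrow> norm x = 1"
    "independent B" "card B = dim Z" "span B = Z"
    using orthonormal_basis_subspace[OF assms] by metis
  have fin: "finite B" using B(4) independent_imp_finite by blast
  define Pr where "Pr x = (\<Sum>b\<in>B. (x \<bullet> b) *\<^sub>R b)" for x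
  have lin: "linear Pr"
    unfolding Pr_def by (intro linearI) (simp_all add: inner_add_left scaleR_add_left sum.distrib scaleR_sum_right)
  have mem: "Pr x \<in> Z" for x
    unfolding Pr_def using B(1) by (intro subspace_sum[OF assms] subspace_scale[OF assms]) auto
  have on: "(b' \<bullet> b) = (if b' = b then 1 else 0)" if "b \<in> B" "b' \<in> B" for b b'
    using B(2,3) that by (auto simp: pairwise_def orthogonal_def norm_eq_1)
  have id: "Pr z = z" if "z \<in> Z" for z
  proof -
    have "z \<in> span B" using that B(6) by simp
    then show ?thesis
    proof (induction rule: span_induct_alt)
      case base
      then show ?case by (simp add: Pr_def)
    next
      case (step c b y)
      have "Pr b = (\<Sum>b'\<in>B. if b = b' then b' else 0)"
        unfolding Pr_def using on step(1) by (intro sum.cong) auto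
      then show ?case using step fin by (simp add: linear_add[OF lin] linear_scale[OF lin])
    qed
  qed
  have "Pr x \<bullet> z = x \<bullet> z" if "z \<in> Z" for x z
  proof -
    have "Pr x \<bullet> z = x \<bullet> Pr z"
      unfolding Pr_def by (simp add: inner_sum_left inner_sum_right inner_commute mult.commute)
    then show ?thesis using id[OF that] by simp
  qed
  moreover have "trace_lin Pr = real (dim Z)"
  proof -
    have "trace_lin Pr = (\<Sum>b\<in>B. \<Sum>c\<in>Basis. (b \<bullet> c) * (b \<bullet> c))"
      unfolding trace_lin_def Pr_def
      by (subst sum.swap, simp add: inner_sum_left, simp add: inner_commute)
    also have "\<dots> = (\<Sum>b\<in>B. b \<bullet> b)"
      by (intro sum.cong refl euclidean_inner[symmetric])
    also have "\<dots> = (\<Sum>b\<in>B. 1)" using B(3) by (intro sum.cong) (auto simp: norm_eq_1)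
    finally show ?thesis using B(5) by simp
  qed
  ultimately show ?thesis using that lin mem id by blast
qed

text \<open>\<open>P\<close> and the Euclidean orthogonal projection \<open>Pr\<close> onto its
  range satisfy \<open>P Pr = Pr\<close> and \<open>Pr P = P\<close>, so exchanging the factors
  under the trace identifies the two traces.\<close>

lemma trace_lin_projection:
  fixes P :: "'e::euclidean_space \<Rightarrow> 'e"
  assumes "linear P" "\<And>x. P (P x) = P x"
  shows "trace_lin P = real (dim (range P))"
proof -
  have sub: "subspace (range P)" using assms(1) linear_subspace_image subspace_UNIV by blast
  obtain Pr where Pr: "linear Pr" "\<And>x. Pr x \<in> range P" "\<And>z. z \<in> range P \<Longrightarrow> Pr z = z"
     "trace_lin Pr = real (dim (range P))"
    using orthogonal_projection_exists[OF sub] by metis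
  have "P (Pr x) = Pr x" for x using Pr(2)[of x] assms(2) by (metis imageE)
  moreover have "Pr (P x) = P x" for x using Pr(3) by blast
  ultimately show ?thesis using trace_lin_commute[OF assms(1) Pr(1)] Pr(4) by simp
qed

section \<open>Linear algebra of a possibly indefinite scalar product\<close>

locale scalar_product =
  fixes s :: "'e::euclidean_space \<Rightarrow> 'e \<Rightarrow> real"
  assumes bilin: "bilinear s"
    and sym: "s u v = s v u"
    and nondeg: "(\<And>v. s u v = 0) \<Longrightarrow> u = 0"
begin

lemmas s_simps = bilinear_ladd[OF bilin] bilinear_radd[OF bilin] bilinear_lsub[OF bilin] 
  bilinear_rsub[OF bilin] bilinear_lmul[OF bilin] bilinear_rmul[OF bilin] bilinear_lneg[OF bilin] 
  bilinear_rneg[OF bilin] bilinear_lzero[OF bilin] bilinear_rzero[OF bilin]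

lemma eqI: "(\<And>v. s u v = s u' v) \<Longrightarrow> u = u'"
  using nondeg[of "u - u'"] by (simp add: s_simps)

text \<open>The musical isomorphism from vectors to covectors, the latter being identified with
  vectors by the Euclidean inner product; see \<open>flat_inner\<close>.\<close>

definition flat :: "'e \<Rightarrow> 'e" where
  "flat u = (\<Sum>b\<in>Basis. s u b *\<^sub>R b)"

lemma flat_inner: "flat u \<bullet> v = s u v"
proof -
  have "s u (\<Sum>b\<in>Basis. (v \<bullet> b) *\<^sub>R b) = (\<Sum>b\<in>Basis. s u b * (v \<bullet> b))"
    using bilin by (simp add: bilinear_def linear_sum linear_scale mult.commute)
  then show ?thesis
    by (simp add: flat_def inner_sum_left euclidean_representation) (simp add: inner_commute)
qed

lemma flat_linear: "linear flat"
  unfolding flat_def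
  by (intro linearI) (simp_all add: s_simps scaleR_add_left sum.distrib scaleR_sum_right)

lemma flat_bij: "bij flat"
proof -
  have "inj flat"
    unfolding linear_injective_0[OF flat_linear] using nondeg flat_inner by (metis inner_zero_left)
  then show ?thesis
    using linear_injective_imp_surjective[OF flat_linear] by (simp add: bij_def)
qed

lemma riesz:
  assumes "linear f"
  shows "\<exists>!x. \<forall>v. s x v = f v"
proof -
  obtain x where "flat x = (\<Sum>b\<in>Basis. f b *\<^sub>R b)"
    using flat_bij by (metis bij_pointE)
  then have "s x v = f v" for v
  proof -
    have "f (\<Sum>b\<in>Basis. (v \<bullet> b) *\<^sub>R b) = (\<Sum>b\<in>Basis. (v \<bullet> b) * f b)"
      using assms by (simp add: linear_sum linear_scale)
    then have "f v = (\<Sum>b\<in>Basis. f b *\<^sub>R b) \<bullet> v"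
      by (simp add: inner_sum_left euclidean_representation) (simp add: inner_commute mult.commute)
    then show ?thesis using flat_inner[of x v] \<open>flat x = _\<close> by simp
  qed
  then show ?thesis using eqI by metis
qed

text \<open>\<open>flat\<close> conjugates \<open>l\<close> into the Euclidean adjoint of
  \<open>m\<close>, whose matrix is the transpose of that of \<open>m\<close>.\<close>

lemma trace_adjoint:
  assumes "linear l" "linear m" "\<And>x y. s (l x) y = s x (m y)"
  shows "trace_lin l = trace_lin m"
proof -
  have adj: "linear (adjoint m)" using adjoint_linear[OF assms(2)] .
  have "adjoint m (flat x) = flat (l x)" for x
  proof (rule vector_eq_rdot[THEN iffD1], rule allI)
    fix y
    show "adjoint m (flat x) \<bullet> y = flat (l x) \<bullet> y"
      using adjoint_works[OF assms(2), of y "flat x"] assms(3) 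
      by (simp add: flat_inner inner_commute) (metis flat_inner inner_commute)
  qed
  then have "trace_lin (adjoint m) = trace_lin l"
    by (intro trace_lin_conj[OF assms(1) adj flat_linear flat_bij]) auto
  moreover have "trace_lin (adjoint m) = trace_lin m"
    unfolding trace_lin_def using adjoint_works[OF assms(2)] by (simp add: inner_commute)
  ultimately show ?thesis by simp
qed

lemma trace_skew:
  assumes "linear l" "\<And>x y. s (l x) y = - s x (l y)"
  shows "trace_lin l = 0"
proof -
  have "trace_lin l = trace_lin (\<lambda>x. - l x)"
    by (rule trace_adjoint) (use assms in \<open>auto simp: s_simps linear_compose_neg\<close>)
  then show ?thesis by (simp add: trace_lin_minus)
qed

text \<open>\<open>Q\<close> is the projection onto \<open>Z\<close> along its
  \<open>s\<close>-orthogonal complement. As \<open>s\<close> may be indefinite, it is not found by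
  minimizing a distance but by inverting the restriction of \<open>s\<close> to
  \<open>Z\<close>.\<close>

lemma nondegenerate_splitting:
  assumes "subspace Z" "\<And>z. z \<in> Z \<Longrightarrow> (\<And>w. w \<in> Z \<Longrightarrow> s z w = 0) \<Longrightarrow> z = 0"
  obtains Q where "linear Q" "\<And>x. Q x \<in> Z" "\<And>x z. z \<in> Z \<Longrightarrow> s (x - Q x) z = 0"
    "\<And>z. z \<in> Z \<Longrightarrow> Q z = z"
proof -
  have ex: "\<exists>q\<in>Z. \<forall>z\<in>Z. s (x - q) z = 0" for x
  proof -
    obtain Pr where linO: "linear Pr" and OZ: "\<And>x. Pr x \<in> Z" and OO: "\<And>z. z \<in> Z \<Longrightarrow> Pr z = z"
      and O_inner: "\<And>x z. z \<in> Z \<Longrightarrow> Pr x \<bullet> z = x \<bullet> z"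
      using orthogonal_projection_exists[OF assms(1)] by metis
    \<comment> \<open>\<open>Pr (flat (Pr y))\<close> represents the restriction of \<open>s\<close>
      to \<open>Z\<close>. Adding the identity on the Euclidean complement makes \<open>T\<close> an
      endomorphism of the whole space, where injectivity implies surjectivity; solving
      \<open>T y = Pr (flat x)\<close> then yields the projection \<open>Pr y\<close> of
      \<open>x\<close>.\<close>
    define T where "T y = Pr (flat (Pr y)) + (y - Pr y)" for y
    have linT: "linear T" unfolding T_def
      using linear_compose_add[OF linear_compose[OF linear_compose[OF linO flat_linear] linO] 
         linear_compose_sub[OF linear_id linO]] by (simp add: o_def id_def)
    have O_zero: "Pr (y - Pr y) = 0" for y using OO OZ by (simp add: linear_diff[OF linO])
    have "inj T" unfolding linear_injective_0[OF linT]
    proof (intro allI impI)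
      fix y assume T0: "T y = 0"
      have "Pr (T y) = Pr (Pr (flat (Pr y)))" by (simp add: T_def linear_add[OF linO] O_zero)
      then have "Pr (flat (Pr y)) = 0" using T0 linear_0[OF linO] OO OZ by simp
      then have "y = Pr y" using T0 by (simp add: T_def)
      have "s (Pr y) z = 0" if "z \<in> Z" for z
        using O_inner[OF that, of "flat (Pr y)"] \<open>Pr (flat (Pr y)) = 0\<close> by (simp add: flat_inner)
      then have "Pr y = 0" using assms(2) OZ by blast
      then show "y = 0" using \<open>y = Pr y\<close> by simp
    qed
    then have "surj T" using linear_injective_imp_surjective[OF linT] by blast
    then obtain y where y: "T y = Pr (flat x)" by (metis surjD)
    have "Pr (T y) = Pr (flat (Pr y))" by (simp add: T_def linear_add[OF linO] O_zero OO[OF OZ])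
    then have *: "Pr (flat (Pr y)) = Pr (flat x)" using y OO[OF OZ] by simp
    have "s (x - Pr y) z = 0" if "z \<in> Z" for z
    proof -
      have "s x z = Pr (flat x) \<bullet> z" "s (Pr y) z = Pr (flat (Pr y)) \<bullet> z" 
        using O_inner[OF that] by (auto simp: flat_inner)
      then show ?thesis using * by (simp add: s_simps)
    qed
    then show ?thesis using OZ by blast
  qed
  have unique: "q = q'" if "q \<in> Z" "q' \<in> Z" "\<forall>z\<in>Z. s (x - q) z = 0" "\<forall>z\<in>Z. s (x - q') z = 0" for x q q'
  proof -
    have "s (q - q') z = 0" if "z \<in> Z" for z
      using \<open>\<forall>z\<in>Z. s (x - q) z = 0\<close> \<open>\<forall>z\<in>Z. s (x - q') z = 0\<close> that by (simp add: s_simps)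
    then have "q - q' = 0" using assms(2) subspace_diff[OF assms(1) that(1,2)] by blast
    then show ?thesis by simp
  qed
  \<comment> \<open>The values are chosen point by point; linearity comes from their
    uniqueness.\<close>
  define Q where "Q x = (SOME q. q \<in> Z \<and> (\<forall>z\<in>Z. s (x - q) z = 0))" for x
  have Q: "Q x \<in> Z" "\<And>z. z \<in> Z \<Longrightarrow> s (x - Q x) z = 0" for x
    using someI_ex[of "\<lambda>q. q \<in> Z \<and> (\<forall>z\<in>Z. s (x - q) z = 0)"] ex[of x] unfolding Q_def by blast+
  have linQ: "linear Q"
  proof (rule linearI)
    fix x y
    show "Q (x + y) = Q x + Q y"
    proof (rule unique[of _ _ "x + y"])
      show "\<forall>z\<in>Z. s (x + y - (Q x + Q y)) z = 0"
      proof
        fix z assume "z \<in> Z"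
        then have "s (x - Q x) z = 0" "s (y - Q y) z = 0" using Q by blast+
        then show "s (x + y - (Q x + Q y)) z = 0" by (simp add: s_simps)
      qed
    qed (use Q subspace_add[OF assms(1)] in auto)
  next
    fix c x
    show "Q (c *\<^sub>R x) = c *\<^sub>R Q x"
    proof (rule unique[of _ _ "c *\<^sub>R x"])
      show "\<forall>z\<in>Z. s (c *\<^sub>R x - c *\<^sub>R Q x) z = 0"
      proof
        fix z assume "z \<in> Z"
        then have "c * s (x - Q x) z = 0" using Q by simp
        then show "s (c *\<^sub>R x - c *\<^sub>R Q x) z = 0" by (simp add: s_simps algebra_simps)
      qed
    qed (use Q subspace_scale[OF assms(1)] in auto)
  qed
  have Q_id: "Q z = z" if "z \<in> Z" for z
  proof (rule unique[of _ _ z])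
    show "\<forall>w\<in>Z. s (z - Q z) w = 0" using Q by blast
    show "\<forall>w\<in>Z. s (z - z) w = 0" by (simp add: s_simps)
  qed (use that Q in auto)
  show thesis by (rule that[OF linQ Q Q_id])
qed

end


section \<open>Ricci curvature of a pseudo-H-type algebra\<close>

text \<open>Since \<open>l = m l\<close>, cyclicity turns the trace into that of
  \<open>l m = 0\<close>. Intended for maps with image in one summand of a splitting that vanish on
  this summand, \<open>m\<close> being the projection onto it.\<close>

lemma trace_lin_eq_0:
  fixes l m :: "'e::euclidean_space \<Rightarrow> 'e"
  assumes "linear l" "linear m" "\<And>x. m (l x) = l x" "\<And>x. l (m x) = 0"
  shows "trace_lin l = 0"
  using trace_lin_commute[OF assms(2,1)] assms(3,4) by (simp add: trace_lin_def)

section \<open>Connection and curvature of a Lie algebra with a scalar product\<close>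

locale metric_algebra = scalar_product s for s :: "'e::euclidean_space \<Rightarrow> 'e \<Rightarrow> real" +
  fixes br :: "'e \<Rightarrow> 'e \<Rightarrow> 'e"
  assumes br_bilin: "bilinear br"
    and br_anti: "br u v = - br v u"
begin

lemmas br_simps = bilinear_ladd[OF br_bilin] bilinear_radd[OF br_bilin] bilinear_lsub[OF br_bilin] 
  bilinear_rsub[OF br_bilin] bilinear_lmul[OF br_bilin] bilinear_rmul[OF br_bilin] 
  bilinear_lneg[OF br_bilin] bilinear_rneg[OF br_bilin] bilinear_lzero[OF br_bilin] 
  bilinear_rzero[OF br_bilin]

text \<open>This is the \<open>s\<close>-adjoint of \<open>ad u\<close> applied to \<open>z\<close>.
  Taken on the whole algebra, it is available before any splitting; for \<open>u\<close> in
  \<open>V\<close> it agrees with the map of the pseudo-H-type condition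
  (\<open>jmap_eq\<close>).\<close>

definition J :: "'e \<Rightarrow> 'e \<Rightarrow> 'e" where
  "J z u = (THE x. \<forall>v. s x v = s z (br u v))"

lemma s_J: "s (J z u) v = s z (br u v)"
proof -
  have "linear (\<lambda>v. s z (br u v))"
    by (intro linearI) (simp_all add: s_simps br_simps)
  from theI'[OF riesz[OF this]] show ?thesis unfolding J_def by blast
qed

lemma J_bilin: "bilinear J"
  unfolding bilinear_def
  by (intro conjI allI linearI; rule eqI) (simp_all add: s_J s_simps br_simps)

lemmas J_simps = bilinear_ladd[OF J_bilin] bilinear_radd[OF J_bilin] bilinear_lsub[OF J_bilin] 
  bilinear_rsub[OF J_bilin] bilinear_lmul[OF J_bilin] bilinear_rmul[OF J_bilin] 
  bilinear_lneg[OF J_bilin] bilinear_rneg[OF J_bilin] bilinear_lzero[OF J_bilin] 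
  bilinear_rzero[OF J_bilin]

lemma J_skew: "s (J z u) v = - s u (J z v)"
proof -
  have "s (J z u) v = s z (br u v)" by (rule s_J)
  also have "\<dots> = - s z (br v u)" by (subst br_anti) (simp add: s_simps)
  finally show ?thesis by (simp add: s_J[symmetric] sym)
qed

text \<open>The Koszul formula for left-invariant fields: their products are constant functions, so
  only the three bracket terms survive.\<close>

definition Gam :: "'e \<Rightarrow> 'e \<Rightarrow> 'e" where
  "Gam u w = (1/2) *\<^sub>R (br u w - J w u - J u w)"

lemma Gam_bilin: "bilinear Gam"
  unfolding bilinear_def Gam_def
  by (intro conjI allI linearI) (simp_all add: J_simps br_simps algebra_simps)

lemmas Gam_simps = bilinear_ladd[OF Gam_bilin] bilinear_radd[OF Gam_bilin] bilinear_lsub[OF Gam_bilin] 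
  bilinear_rsub[OF Gam_bilin] bilinear_lmul[OF Gam_bilin] bilinear_rmul[OF Gam_bilin] 
  bilinear_lneg[OF Gam_bilin] bilinear_rneg[OF Gam_bilin] bilinear_lzero[OF Gam_bilin] 
  bilinear_rzero[OF Gam_bilin]

lemma Gam_torsion: "Gam u w - Gam w u = br u w"
proof -
  have "br u w - br w u = 2 *\<^sub>R br u w" by (subst (2) br_anti) (simp add: scaleR_2)
  moreover have "Gam u w - Gam w u = (1/2) *\<^sub>R (br u w - br w u)"
    unfolding Gam_def by (simp add: algebra_simps)
  ultimately show ?thesis by simp
qed

lemma Gam_metric: "s (Gam u v) w + s v (Gam u w) = 0"
proof -
  have "s (br u v) w = s (J w u) v" "s v (br u w) = s (J v u) w"
    by (simp_all only: s_J sym[of "br u v"])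
  moreover have "s v (J w u) = s (J w u) v" by (rule sym)
  moreover have "s v (J u w) = - s (J u v) w" by (simp add: J_skew)
  ultimately show ?thesis by (simp add: Gam_def s_simps algebra_simps)
qed

text \<open>The cyclic argument behind the uniqueness of the Levi-Civita connection: alternating the
  two symmetries returns to \<open>T u v\<close> after three skew moves, hence with the opposite
  sign.\<close>

lemma symmetric_skew_eq_0:
  fixes T :: "'e \<Rightarrow> 'e \<Rightarrow> 'e"
  assumes "\<And>u v. T u v = T v u" "\<And>u v w. s (T u v) w = - s v (T u w)"
  shows "T u v = 0"
proof (rule nondeg)
  fix w
  have "s (T u v) w = - s (T u w) v" by (metis assms(2) sym)
  also have "\<dots> = - s (T w u) v" by (simp add: assms(1))
  also have "\<dots> = s (T w v) u" by (metis add.inverse_inverse assms(2) sym)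
  also have "\<dots> = s (T v w) u" by (simp add: assms(1))
  also have "\<dots> = - s (T v u) w" by (metis assms(2) sym)
  also have "\<dots> = - s (T u v) w" by (simp add: assms(1))
  finally show "s (T u v) w = 0" by simp
qed

definition Riem :: "'e \<Rightarrow> 'e \<Rightarrow> 'e \<Rightarrow> 'e" where
  "Riem u v w = Gam u (Gam v w) - Gam v (Gam u w) - Gam (br u v) w"

definition Ric :: "'e \<Rightarrow> 'e \<Rightarrow> real" where
  "Ric u w = trace_lin (\<lambda>\<xi>. Riem \<xi> u w)"

lemma Riem_linear1: "linear (\<lambda>\<xi>. Riem \<xi> u w)"
  unfolding Riem_def by (intro linearI) (simp_all add: Gam_simps br_simps algebra_simps)

lemma Ric_invariant:
  assumes "linear a" "bij a" "\<And>u v w. a (Riem u v w) = Riem (a u) (a v) (a w)"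
  shows "Ric (a u) (a w) = Ric u w"
  unfolding Ric_def
  by (rule trace_lin_conj[OF Riem_linear1 Riem_linear1 assms(1,2)]) (simp add: assms(3))

end

section \<open>Two-step nilpotency, the center and its orthogonal complement\<close>

locale two_step_algebra = metric_algebra s br for s :: "'e::euclidean_space \<Rightarrow> 'e \<Rightarrow> real" and br +
  assumes br_nil: "br u (br v w) = 0"
    and br_nonzero: "\<exists>u v. br u v \<noteq> 0"
begin

lemma br_nil': "br (br v w) u = 0"
  using br_nil br_anti by (metis neg_equal_0_iff_equal)

lemma J_br: "J z (br u v) = 0"
  by (rule nondeg) (simp add: s_J br_nil' s_simps)

lemma J_J_left: "J (J z u) v = 0"
  by (rule nondeg) (simp add: s_J br_nil s_simps)

text \<open>Two-step nilpotency removes every term with a nested bracket, with \<open>J\<close>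
  acting on a bracket, or with a value of \<open>J\<close> as first argument of
  \<open>J\<close>.\<close>

lemma Gam_Gam: "Gam a (Gam b c) = (1/4) *\<^sub>R
   (J a (J c b) + J a (J b c) - br a (J c b) - br a (J b c) - J (br b c) a)"
proof -
  have "Gam a (Gam b c) = (1/4) *\<^sub>R (br a (br b c - J c b - J b c) - J (br b c - J c b - J b c) a
     - J a (br b c - J c b - J b c))"
    by (simp add: Gam_def J_simps br_simps algebra_simps)
  then show ?thesis by (simp add: J_simps br_simps br_nil J_br J_J_left algebra_simps)
qed

lemma Gam_br: "Gam (br a b) c = - (1/2) *\<^sub>R J (br a b) c"
  by (simp add: Gam_def br_nil' J_br)

definition Z :: "'e set" where "Z = {z. \<forall>u. br z u = 0}"

definition V :: "'e set" where "V = {v. \<forall>z\<in>Z. s v z = 0}"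

lemma br_in_Z: "br u v \<in> Z"
  by (simp add: Z_def br_nil')

lemma br_Z: "z \<in> Z \<Longrightarrow> br z u = 0" "z \<in> Z \<Longrightarrow> br u z = 0"
  using br_anti[of u z] by (auto simp: Z_def)

lemma subspace_Z: "subspace Z"
  by (simp add: Z_def subspace_def br_simps)

lemma subspace_V: "subspace V"
  by (simp add: V_def subspace_def s_simps)

lemma J_in_V: "J z u \<in> V"
  by (simp add: V_def s_J br_Z s_simps)

lemma J_Z: "z \<in> Z \<Longrightarrow> J w z = 0"
  by (rule nondeg) (simp add: s_J br_Z s_simps)

lemma J_V: "v \<in> V \<Longrightarrow> J v u = 0"
  by (rule nondeg) (use br_in_Z in \<open>auto simp: s_J V_def\<close>)

end

section \<open>The Clifford relation and the Ricci operator\<close>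

locale H_type_algebra = two_step_algebra s br for s :: "'e::euclidean_space \<Rightarrow> 'e \<Rightarrow> real" and br +
  assumes nondeg_Z: "z \<in> Z \<Longrightarrow> (\<And>w. w \<in> Z \<Longrightarrow> s z w = 0) \<Longrightarrow> z = 0"
    and J_square: "z \<in> Z \<Longrightarrow> v \<in> V \<Longrightarrow> J z (J z v) = - s z z *\<^sub>R v"
begin

definition Q :: "'e \<Rightarrow> 'e" where
  "Q = (SOME Q. linear Q \<and> (\<forall>x. Q x \<in> Z) \<and> (\<forall>x. \<forall>z\<in>Z. s (x - Q x) z = 0) \<and> (\<forall>z\<in>Z. Q z = z))"

definition P :: "'e \<Rightarrow> 'e" where "P x = x - Q x"

lemma Q_props: "linear Q" "Q x \<in> Z" "z \<in> Z \<Longrightarrow> s (P x) z = 0" "z \<in> Z \<Longrightarrow> Q z = z"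
proof -
  have "\<exists>Q. linear Q \<and> (\<forall>x. Q x \<in> Z) \<and> (\<forall>x. \<forall>z\<in>Z. s (x - Q x) z = 0) \<and> (\<forall>z\<in>Z. Q z = z)"
    by (rule nondegenerate_splitting[OF subspace_Z nondeg_Z]) auto
  from someI_ex[OF this] show "linear Q" "Q x \<in> Z" "z \<in> Z \<Longrightarrow> s (P x) z = 0" "z \<in> Z \<Longrightarrow> Q z = z"
    unfolding Q_def[symmetric] P_def by blast+
qed

lemma linear_P: "linear P"
  unfolding P_def using linear_compose_sub[OF linear_ident Q_props(1)] .

lemma P_in_V: "P x \<in> V"
  using Q_props(3) by (simp add: V_def)

lemma P_plus_Q: "P x + Q x = x"
  by (simp add: P_def)

lemma V_Int_Z: "x \<in> V \<Longrightarrow> x \<in> Z \<Longrightarrow> x = 0"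
  using nondeg_Z by (auto simp: V_def)

lemma Q_V: "v \<in> V \<Longrightarrow> Q v = 0"
proof (rule V_Int_Z)
  assume "v \<in> V"
  then have "v - P v \<in> V" using subspace_diff[OF subspace_V _ P_in_V] by blast
  then show "Q v \<in> V" by (simp add: P_def)
qed (rule Q_props)

lemma P_V: "v \<in> V \<Longrightarrow> P v = v"
  by (simp add: P_def Q_V)

lemma P_Z: "z \<in> Z \<Longrightarrow> P z = 0"
  by (simp add: P_def Q_props(4))

lemma s_Q: "s (Q x) y = s (Q x) (Q y)" "s y (Q x) = s (Q y) (Q x)"
  and s_P: "s (P x) y = s (P x) (P y)" "s y (P x) = s (P y) (P x)"
proof -
  have 0: "s (P a) (Q b) = 0" "s (Q b) (P a) = 0" for a b
    using Q_props(2,3) sym by metis+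
  have split: "y = P y + Q y" by (simp add: P_def)
  show "s (Q x) y = s (Q x) (Q y)" by (subst (1) split) (simp add: s_simps 0)
  then show "s y (Q x) = s (Q y) (Q x)" by (simp add: sym)
  show "s (P x) y = s (P x) (P y)" by (subst (1) split) (simp add: s_simps 0)
  then show "s y (P x) = s (P y) (P x)" by (simp add: sym)
qed

text \<open>\<open>J\<close> vanishes when its first argument lies in \<open>V\<close> or its second
  in \<open>Z\<close>. This carries identities known on \<open>Z\<close> and \<open>V\<close> over
  to arbitrary arguments.\<close>

lemma J_Q_P: "J z u = J (Q z) (P u)"
proof -
  have "J z u = J (P z + Q z) (P u + Q u)" by (simp add: P_plus_Q)
  then show ?thesis by (simp only: J_simps J_Z[OF Q_props(2)] J_V[OF P_in_V] add_0_left add_0_right)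
qed

text \<open>The Clifford relation, by polarization of \<open>J_square\<close>.\<close>

lemma J_polar:
  assumes "z \<in> Z" "z' \<in> Z" "v \<in> V"
  shows "J z (J z' v) + J z' (J z v) = - (2 * s z z') *\<^sub>R v"
proof -
  have "J (z + z') (J (z + z') v) = - s (z + z') (z + z') *\<^sub>R v"
    using J_square subspace_add[OF subspace_Z assms(1,2)] assms(3) by blast
  then have "J z (J z v) + J z' (J z' v) + (J z (J z' v) + J z' (J z v)) 
     = - (s z z + s z' z' + 2 * s z z') *\<^sub>R v"
    by (simp add: J_simps s_simps sym algebra_simps)
  then show ?thesis unfolding J_square[OF assms(1,3)] J_square[OF assms(2,3)]
    by (simp add: algebra_simps eq_neg_iff_add_eq_0)
qed

text \<open>The Clifford relation transported by duality: pairing with \<open>v\<close> turns each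
  bracket into a product of two maps \<open>J\<close>.\<close>

lemma br_J_polar: "br u (J \<xi> w) + br w (J \<xi> u) = (2 * s (P u) (P w)) *\<^sub>R Q \<xi>"
proof (rule eqI)
  fix v
  \<comment> \<open>\<open>1\<close> and \<open>2\<close> move the factors \<open>J\<close> to
    different sides by skewness, and so produce the products in the two orders that
    \<open>J_polar\<close> adds up.\<close>
  have 1: "s (br a (J \<xi> b)) v = - s (P a) (J (Q v) (J (Q \<xi>) (P b)))" for a b
  proof -
    have "s (br a (J \<xi> b)) v = s (J v a) (J \<xi> b)" by (simp only: s_J sym[of _ v])
    also have "\<dots> = s (J (Q v) (P a)) (J (Q \<xi>) (P b))" by (simp only: J_Q_P[of v a] J_Q_P[of \<xi> b])
    finally show ?thesis by (simp add: J_skew)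
  qed
  have 2: "s (br a (J \<xi> b)) v = - s (P b) (J (Q \<xi>) (J (Q v) (P a)))" for a b
  proof -
    have "s (br a (J \<xi> b)) v = s (J \<xi> b) (J v a)" by (simp only: sym[of "J \<xi> b"] s_J[of v] sym[of _ v])
    also have "\<dots> = s (J (Q \<xi>) (P b)) (J (Q v) (P a))" by (simp only: J_Q_P[of v a] J_Q_P[of \<xi> b])
    finally show ?thesis by (simp add: J_skew)
  qed
  have "s (br u (J \<xi> w) + br w (J \<xi> u)) v = 
      - s (P u) (J (Q v) (J (Q \<xi>) (P w)) + J (Q \<xi>) (J (Q v) (P w)))"
    unfolding bilinear_ladd[OF bilin] 1[of u w] 2[of w u] by (simp add: s_simps)
  also have "\<dots> = 2 * s (Q v) (Q \<xi>) * s (P u) (P w)"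
    unfolding J_polar[OF Q_props(2) Q_props(2) P_in_V] by (simp add: s_simps)
  also have "s (Q v) (Q \<xi>) = s (Q \<xi>) v" using s_Q sym by metis
  finally show "s (br u (J \<xi> w) + br w (J \<xi> u)) v = s ((2 * s (P u) (P w)) *\<^sub>R Q \<xi>) v"
    by (simp add: s_simps)
qed

text \<open>As traces of projections these are the dimensions of the center and of \<open>V\<close>;
  traces are the form in which they arise in the Ricci tensor.\<close>

abbreviation dimZ :: real where "dimZ \<equiv> trace_lin Q"
abbreviation dimV :: real where "dimV \<equiv> trace_lin P"

lemma dimZ_pos: "dimZ > 0"
proof -
  obtain u v where "br u v \<noteq> 0" using br_nonzero by blast
  then have "Q (br u v) \<noteq> 0" using Q_props(4) br_in_Z by simp
  then have "dim (range Q) > 0" by (metis dim_eq_0 gr0I rangeI singletonD subsetD)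
  then show ?thesis
    using trace_lin_projection[OF Q_props(1) Q_props(4)[OF Q_props(2)]] by simp
qed

lemma dimV_pos: "dimV > 0"
proof -
  obtain u v where "br u v \<noteq> 0" using br_nonzero by blast
  moreover have "br u v = br (P u) v" using br_Z(1)[OF Q_props(2)] by (simp add: P_def br_simps)
  ultimately have "P u \<noteq> 0" by (auto simp: br_simps)
  then have "dim (range P) > 0" by (metis dim_eq_0 gr0I rangeI singletonD subsetD)
  then show ?thesis
    using trace_lin_projection[OF linear_P P_V[OF P_in_V]] by simp
qed

lemma trace_br_J: "trace_lin (\<lambda>\<xi>. br u (J \<xi> w)) + trace_lin (\<lambda>\<xi>. br w (J \<xi> u)) = 2 * dimZ * s (P u) (P w)"
  unfolding trace_lin_add[symmetric] br_J_polar trace_lin_scale by simp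

text \<open>The order of the two factors does not affect the trace, which is therefore half the
  trace of the anticommutator given by the Clifford relation.\<close>

lemma trace_J_J: "trace_lin (\<lambda>\<xi>. J u (J w \<xi>)) = - dimV * s (Q u) (Q w)"
proof -
  have lin: "linear (J a)" for a using J_bilin by (simp add: bilinear_def)
  have "trace_lin (\<lambda>\<xi>. J u (J w \<xi>)) = trace_lin (\<lambda>\<xi>. J w (J u \<xi>))"
    by (rule trace_lin_commute) (rule lin)+
  then have "2 * trace_lin (\<lambda>\<xi>. J u (J w \<xi>)) = trace_lin (\<lambda>\<xi>. J u (J w \<xi>) + J w (J u \<xi>))"
    by (simp add: trace_lin_add)
  also have "(\<lambda>\<xi>. J u (J w \<xi>) + J w (J u \<xi>)) = (\<lambda>\<xi>. - (2 * s (Q u) (Q w)) *\<^sub>R P \<xi>)"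
  proof
    fix \<xi>
    have JJ: "J a (J b \<xi>) = J (Q a) (J (Q b) (P \<xi>))" for a b
      by (subst J_Q_P[of a], subst J_Q_P[of b]) (simp add: P_V[OF J_in_V])
    show "J u (J w \<xi>) + J w (J u \<xi>) = - (2 * s (Q u) (Q w)) *\<^sub>R P \<xi>"
      unfolding JJ using J_polar[OF Q_props(2) Q_props(2) P_in_V] by simp
  qed
  finally show ?thesis unfolding trace_lin_scale by simp
qed

lemma Ric_eq: "Ric u w = - (dimZ / 2) * s (P u) (P w) + (dimV / 4) * s (Q u) (Q w)"
proof -
  \<comment> \<open>The maps in \<open>t1\<close> and \<open>t4\<close> take values in
    \<open>Z\<close> and vanish on \<open>Z\<close>; those in \<open>t2\<close> and
    \<open>t5\<close> behave in the same way with \<open>V\<close>.\<close>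
  have t1: "trace_lin (\<lambda>\<xi>. br \<xi> y) = 0" for y
    by (rule trace_lin_eq_0[OF _ Q_props(1)])
      (auto intro!: linearI simp: br_simps Q_props(4) br_in_Z br_Z Q_props(2))
  have t2: "trace_lin (\<lambda>\<xi>. J \<xi> y) = 0" for y
    by (rule trace_lin_eq_0[OF _ linear_P])
      (auto intro!: linearI simp: J_simps P_V J_in_V J_V P_in_V)
  have t3: "trace_lin (J z) = 0" for z
    by (rule trace_skew) (auto intro!: linearI simp: J_simps J_skew)
  have t4: "trace_lin (\<lambda>\<xi>. br u (J w \<xi>)) = 0"
    by (rule trace_lin_eq_0[OF _ Q_props(1)])
      (auto intro!: linearI simp: br_simps J_simps Q_props(4) br_in_Z J_Z Q_props(2))
  have t5: "trace_lin (\<lambda>\<xi>. J u (J \<xi> w)) = 0"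
    by (rule trace_lin_eq_0[OF _ linear_P])
      (auto intro!: linearI simp: J_simps P_V J_in_V J_V P_in_V)
  have t6: "trace_lin (\<lambda>\<xi>. J (br \<xi> b) a) = - trace_lin (\<lambda>\<xi>. br b (J \<xi> a))" for a b
  proof -
    have "trace_lin (\<lambda>\<xi>. J (br \<xi> b) a) = trace_lin (\<lambda>\<xi>. br (J \<xi> a) b)"
      by (rule trace_lin_commute) (auto intro!: linearI simp: J_simps br_simps)
    also have "\<dots> = trace_lin (\<lambda>\<xi>. - br b (J \<xi> a))" by (subst br_anti) simp
    finally show ?thesis by (simp add: trace_lin_minus)
  qed
  have "Riem \<xi> u w = (1/4) *\<^sub>R
    (J \<xi> (J w u) + J \<xi> (J u w) - br \<xi> (J w u) - br \<xi> (J u w) - J (br u w) \<xi>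
     - (J u (J w \<xi>) + J u (J \<xi> w) - br u (J w \<xi>) - br u (J \<xi> w) - J (br \<xi> w) u)
     + 2 *\<^sub>R J (br \<xi> u) w)" for \<xi>
    unfolding Riem_def Gam_Gam Gam_br by (simp add: algebra_simps)
  then have "Ric u w = (1/4) * 
     (- (- dimV * s (Q u) (Q w) - trace_lin (\<lambda>\<xi>. br u (J \<xi> w)) + trace_lin (\<lambda>\<xi>. br w (J \<xi> u)))
      - 2 * trace_lin (\<lambda>\<xi>. br u (J \<xi> w)))"
    unfolding Ric_def
    by (simp add: trace_lin_scale trace_lin_add trace_lin_diff t1 t2 t3 t4 t5 t6 trace_J_J)
  \<comment> \<open>The bracket terms that are left combine to minus the symmetric sum evaluated by
    \<open>trace_br_J\<close>.\<close>
  also have "\<dots> = (1/4) * (dimV * s (Q u) (Q w) - 2 * dimZ * s (P u) (P w))"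
    unfolding trace_br_J[symmetric] by simp
  finally show ?thesis by simp
qed

definition Rc :: "'e \<Rightarrow> 'e" where
  "Rc u = (THE x. \<forall>w. s x w = Ric u w)"

lemma Rc_eq: "Rc u = - (dimZ / 2) *\<^sub>R P u + (dimV / 4) *\<^sub>R Q u"
  unfolding Rc_def
proof (rule the_equality)
  show *: "\<forall>w. s (- (dimZ / 2) *\<^sub>R P u + (dimV / 4) *\<^sub>R Q u) w = Ric u w"
  proof
    fix w
    show "s (- (dimZ / 2) *\<^sub>R P u + (dimV / 4) *\<^sub>R Q u) w = Ric u w"
      using s_P(1)[of u w] s_Q(1)[of u w] by (simp add: Ric_eq s_simps)
  qed
  then show "x = - (dimZ / 2) *\<^sub>R P u + (dimV / 4) *\<^sub>R Q u" if "\<forall>w. s x w = Ric u w" for x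
    using that by (intro eqI) simp
qed

text \<open>The center contributes half as much as \<open>V\<close>, with the opposite sign:
  \<open>- dimZ * dimV / 2 + dimV * dimZ / 4\<close>.\<close>

lemma trace_Rc: "trace_lin Rc = - (dimZ * dimV / 4)"
  unfolding Rc_eq[abs_def] trace_lin_add trace_lin_scale by simp

lemma trace_Rc_neg: "trace_lin Rc < 0"
  using dimZ_pos dimV_pos trace_Rc by simp

text \<open>An eigenvalue equation phrased by \<open>s\<close> and \<open>Ric\<close> only, so that
  any bijection preserving both preserves membership in \<open>Z\<close>. The two eigenvalues are
  separated by \<open>dimZ / 2 + dimV / 4 > 0\<close>.\<close>

lemma Z_iff_Ric: "u \<in> Z \<longleftrightarrow> (\<forall>w. Ric u w = (dimV / 4) * s u w)"
proof
  assume "u \<in> Z"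
  then show "\<forall>w. Ric u w = (dimV / 4) * s u w"
    using s_Q(1)[of u] by (simp add: Ric_eq P_Z Q_props(4) s_simps)
next
  assume *: "\<forall>w. Ric u w = (dimV / 4) * s u w"
  have "P u = 0"
  proof (rule nondeg)
    fix w
    have "Ric u (P w) = (dimV / 4) * s u (P w)" using * by blast
    then have "(dimZ / 2 + dimV / 4) * s (P u) (P w) = 0"
      using s_P(2)[of u w] by (simp add: Ric_eq P_V[OF P_in_V] Q_V[OF P_in_V] s_simps algebra_simps)
    moreover have "dimZ / 2 + dimV / 4 \<noteq> 0" using dimZ_pos dimV_pos by simp
    ultimately show "s (P u) w = 0" using s_P(1) by simp
  qed
  then show "u \<in> Z" using P_plus_Q[of u] Q_props(2)[of u] by simp
qed

lemma V_iff_Ric: "u \<in> V \<longleftrightarrow> (\<forall>w. Ric u w = - (dimZ / 2) * s u w)"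
proof
  assume "u \<in> V"
  then show "\<forall>w. Ric u w = - (dimZ / 2) * s u w"
    using s_P(1)[of u] by (simp add: Ric_eq P_V Q_V s_simps)
next
  assume *: "\<forall>w. Ric u w = - (dimZ / 2) * s u w"
  have "Q u = 0"
  proof (rule nondeg)
    fix w
    have "Ric u (Q w) = - (dimZ / 2) * s u (Q w)" using * by blast
    then have "(dimZ / 2 + dimV / 4) * s (Q u) (Q w) = 0"
      using s_Q(2)[of u w] by (simp add: Ric_eq Q_props(4)[OF Q_props(2)] P_Z[OF Q_props(2)] s_simps algebra_simps)
    moreover have "dimZ / 2 + dimV / 4 \<noteq> 0" using dimZ_pos dimV_pos by simp
    ultimately show "s (Q u) w = 0" using s_Q(1) by simp
  qed
  then show "u \<in> V" using P_plus_Q[of u] P_in_V[of u] by simp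
qed

lemma Ric_isometry_splits:
  assumes "bij a" "\<And>u w. s (a u) (a w) = s u w" "\<And>u w. Ric (a u) (a w) = Ric u w"
  shows "a ` Z = Z" "a ` V = V"
proof -
  have all: "(\<forall>w. R w) \<longleftrightarrow> (\<forall>w. R (a w))" for R using assms(1) by (metis bij_pointE)
  have "a u \<in> Z \<longleftrightarrow> u \<in> Z" for u
    unfolding Z_iff_Ric by (subst all) (simp add: assms)
  then show "a ` Z = Z" using assms(1) by (auto simp: image_iff) (metis bij_pointE)
  have "a u \<in> V \<longleftrightarrow> u \<in> V" for u
    unfolding V_iff_Ric by (subst all) (simp add: assms)
  then show "a ` V = V" using assms(1) by (auto simp: image_iff) (metis bij_pointE)
qed

text \<open>Applied to the derivative \<open>d u\<close>, in the direction \<open>u\<close>, of the differential \<open>a\<close> of an isometry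
  preserving the splitting.\<close>

lemma splitting_rigid:
  assumes a: "linear a" "a ` Z \<subseteq> Z" "a ` V \<subseteq> V"
    and d: "\<And>u w. d u w = a (Gam u w) - Gam (a u) (a w)"
    and dZ: "\<And>u w. w \<in> Z \<Longrightarrow> d u w \<in> Z" and dV: "\<And>u w. w \<in> V \<Longrightarrow> d u w \<in> V"
  shows "d u w = 0"
proof -
  note a_simps = linear_0[OF a(1)] linear_add[OF a(1)] linear_diff[OF a(1)] linear_scale[OF a(1)] linear_neg[OF a(1)]
  have aZ: "a z \<in> Z" if "z \<in> Z" for z using a(2) that by blast
  have aV: "a v \<in> V" if "v \<in> V" for v using a(3) that by blast
  have GVZ: "Gam v z = - (1/2) *\<^sub>R J z v" if "v \<in> V" "z \<in> Z" for v z
    using that by (simp add: Gam_def br_Z J_Z J_V)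
  have GZV: "Gam z v = - (1/2) *\<^sub>R J z v" if "v \<in> V" "z \<in> Z" for v z
    using that by (simp add: Gam_def br_Z J_Z J_V)
  have GVV: "Gam v v' = (1/2) *\<^sub>R br v v'" if "v \<in> V" "v' \<in> V" for v v'
    using that by (simp add: Gam_def J_V)
  have GZZ: "Gam z z' = 0" if "z \<in> Z" "z' \<in> Z" for z z'
    using that by (simp add: Gam_def J_Z br_Z)
  have VZ: "d v z = 0" if "v \<in> V" "z \<in> Z" for v z
  proof (rule V_Int_Z)
    show "d v z \<in> V" unfolding d GVZ[OF that] GVZ[OF aV[OF that(1)] aZ[OF that(2)]] a_simps
      by (intro subspace_diff[OF subspace_V] subspace_scale[OF subspace_V] aV J_in_V)
  qed (rule dZ[OF that(2)])
  \<comment> \<open>The two mixed values of \<open>Gam\<close> coincide, so this is the previous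
    case with the arguments exchanged.\<close>
  have ZV: "d z v = 0" if "v \<in> V" "z \<in> Z" for v z
    using VZ[OF that] unfolding d GVZ[OF that] GZV[OF that] 
      GVZ[OF aV[OF that(1)] aZ[OF that(2)]] GZV[OF aV[OF that(1)] aZ[OF that(2)]] .
  have VV: "d v v' = 0" if "v \<in> V" "v' \<in> V" for v v'
  proof (rule V_Int_Z)
    show "d v v' \<in> Z" unfolding d GVV[OF that] GVV[OF aV[OF that(1)] aV[OF that(2)]] a_simps
      by (intro subspace_diff[OF subspace_Z] subspace_scale[OF subspace_Z] aZ br_in_Z)
  qed (rule dV[OF that(2)])
  have ZZ: "d z z' = 0" if "z \<in> Z" "z' \<in> Z" for z z'
    unfolding d GZZ[OF that] GZZ[OF aZ[OF that(1)] aZ[OF that(2)]] by (simp add: a_simps)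
  have "d u w = d (P u + Q u) (P w + Q w)" by (simp add: P_plus_Q)
  also have "\<dots> = d (P u) (P w) + d (P u) (Q w) + d (Q u) (P w) + d (Q u) (Q w)"
    unfolding d Gam_simps a_simps by simp
  finally show ?thesis by (simp add: VV VZ ZV ZZ P_in_V Q_props(2))
qed

end


section \<open>Smooth maps between manifolds\<close>

lemma smooth_atlasD:
  assumes "smooth_atlas A" "(U, c) \<in> A"
  shows "open U" "inj_on c U" "continuous_on U c" "p \<in> U \<Longrightarrow> the_inv_into U c (c p) = p"
    "open W \<Longrightarrow> open (c ` (U \<inter> W))" "smooth_fun_on A U c"
proof -
  have ch: "is_chart (U, c)" using assms by (auto simp: smooth_atlas_def)
  then show U: "open U" and inj: "inj_on c U" and cont: "continuous_on U c"
    by (auto simp: is_chart_def homeomorphism_def)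
  then show "p \<in> U \<Longrightarrow> the_inv_into U c (c p) = p" by (simp add: the_inv_into_f_f)
  have hom: "homeomorphism U (c ` U) c (the_inv_into U c)" and oc: "open (c ` U)"
    using ch by (auto simp: is_chart_def)
  show "open (c ` (U \<inter> W))" if "open W"
  proof -
    have "openin (top_of_set (c ` U)) (c ` (U \<inter> W))"
      using homeomorphism_imp_open_map[OF hom] that openin_open_Int by blast
    then show ?thesis using oc openin_open_trans by blast
  qed
  have "Cinf_on (d ` (V \<inter> U)) (c \<circ> the_inv_into V d)" if "(V, d) \<in> A" for V d
    using assms that unfolding smooth_atlas_def by blast
  then show "smooth_fun_on A U c" by (auto simp: smooth_fun_on_def)
qed

lemma smooth_atlas_cover:
  assumes "smooth_atlas A" obtains U c where "(U, c) \<in> A" "p \<in> U"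
proof -
  have "p \<in> (\<Union>(U, c)\<in>A. U)" using assms by (simp add: smooth_atlas_def)
  then show ?thesis using that by auto
qed

lemma smooth_fun_onD:
  "smooth_fun_on A W f \<Longrightarrow> (U, c) \<in> A \<Longrightarrow> Cinf_on (c ` (U \<inter> W)) (\<lambda>x. f (the_inv_into U c x))"
  by (auto simp: smooth_fun_on_def o_def)

lemma smooth_fun_onI:
  "(\<And>U c. (U, c) \<in> A \<Longrightarrow> Cinf_on (c ` (U \<inter> W)) (\<lambda>x. f (the_inv_into U c x))) \<Longrightarrow> smooth_fun_on A W f"
  by (auto simp: smooth_fun_on_def o_def)

lemma smooth_fun_on_subset: "smooth_fun_on A W f \<Longrightarrow> W' \<subseteq> W \<Longrightarrow> smooth_fun_on A W' f"
  by (rule smooth_fun_onI, erule Cinf_on_subset[OF smooth_fun_onD]) auto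

lemma smooth_fun_on_cong:
  assumes "smooth_atlas A" "open W" "smooth_fun_on A W f" "\<And>p. p \<in> W \<Longrightarrow> f p = h p"
  shows "smooth_fun_on A W h"
proof (rule smooth_fun_onI)
  fix U c assume Uc: "(U, c) \<in> A"
  note D = smooth_atlasD[OF assms(1) Uc]
  show "Cinf_on (c ` (U \<inter> W)) (\<lambda>x. h (the_inv_into U c x))"
    by (rule Cinf_on_cong_open[OF D(5)[OF assms(2)] _ smooth_fun_onD[OF assms(3) Uc]])
       (use D(4) assms(4) in auto)
qed

lemma smooth_fun_on_const: "smooth_fun_on A W (\<lambda>p. k)"
  by (intro smooth_fun_onI Cinf_on_const)

lemma smooth_fun_on_add:
  "smooth_fun_on A W f \<Longrightarrow> smooth_fun_on A W h \<Longrightarrow> smooth_fun_on A W (\<lambda>p. f p + h p)"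
  by (intro smooth_fun_onI Cinf_on_add; erule smooth_fun_onD)

lemma smooth_fun_on_linear:
  "bounded_linear l \<Longrightarrow> smooth_fun_on A W f \<Longrightarrow> smooth_fun_on A W (\<lambda>p. l (f p))"
  by (rule smooth_fun_onI, erule Cinf_on_linear_comp, erule smooth_fun_onD)

lemma smooth_fun_on_bilinear:
  "bounded_bilinear B \<Longrightarrow> smooth_fun_on A W f \<Longrightarrow> smooth_fun_on A W h \<Longrightarrow> smooth_fun_on A W (\<lambda>p. B (f p) (h p))"
  by (rule smooth_fun_onI, erule Cinf_on_bilinear; erule smooth_fun_onD)

lemma smooth_fun_on_sum:
  "(\<And>i. i \<in> I \<Longrightarrow> smooth_fun_on A W (f i)) \<Longrightarrow> smooth_fun_on A W (\<lambda>p. \<Sum>i\<in>I. f i p)"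
  by (induction I rule: infinite_finite_induct) (auto intro: smooth_fun_on_const smooth_fun_on_add)

lemma smooth_fun_on_Pair:
  "smooth_fun_on A W f \<Longrightarrow> smooth_fun_on A W h \<Longrightarrow> smooth_fun_on A W (\<lambda>p. (f p, h p))"
  by (intro smooth_fun_onI Cinf_on_Pair; erule smooth_fun_onD)

lemma smooth_map_iff:
  "smooth_map A B F \<longleftrightarrow> continuous_on UNIV F \<and> (\<forall>(V, d)\<in>B. smooth_fun_on A (F -` V) (\<lambda>p. d (F p)))"
  unfolding smooth_map_def smooth_fun_on_def by (auto simp: o_def)

lemma smooth_map_continuous: "smooth_map A B F \<Longrightarrow> continuous_on UNIV F"
  by (simp add: smooth_map_iff)

text \<open>The image of a chart domain need not lie in a single chart of the target, so smoothness
  is checked near each point. There the map is \<open>f\<close> in a chart around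
  \<open>F p\<close>, composed with \<open>F\<close> in coordinates.\<close>

lemma smooth_fun_on_comp:
  assumes A: "smooth_atlas A" and B: "smooth_atlas B"
    and F: "smooth_map A B F" and f: "smooth_fun_on B W f" and W: "open W"
  shows "smooth_fun_on A (F -` W) (\<lambda>p. f (F p))"
proof (rule smooth_fun_onI)
  fix U c assume Uc: "(U, c) \<in> A"
  note D = smooth_atlasD[OF A Uc]
  show "Cinf_on (c ` (U \<inter> F -` W)) (\<lambda>x. f (F (the_inv_into U c x)))"
  proof (rule Cinf_on_local)
    fix x assume "x \<in> c ` (U \<inter> F -` W)"
    then obtain p where p: "p \<in> U" "F p \<in> W" "x = c p" by auto
    obtain V d where Vd: "(V, d) \<in> B" "F p \<in> V" using smooth_atlas_cover[OF B] by metis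
    note E = smooth_atlasD[OF B Vd(1)]
    let ?T = "c ` (U \<inter> F -` (V \<inter> W))"
    have oT: "open ?T"
      using D(5) open_vimage[OF open_Int[OF E(1) W] smooth_map_continuous[OF F]] by blast
    have "smooth_fun_on A (F -` V) (\<lambda>p. d (F p))" using F Vd(1) by (auto simp: smooth_map_iff)
    then have 1: "Cinf_on ?T (\<lambda>x. d (F (the_inv_into U c x)))"
      by (rule Cinf_on_subset[OF smooth_fun_onD[OF _ Uc]]) auto
    have 2: "Cinf_on ?T (\<lambda>x. f (the_inv_into V d (d (F (the_inv_into U c x)))))"
      by (rule Cinf_on_compose[OF smooth_fun_onD[OF f Vd(1)] 1]) (auto simp: D(4))
    have "Cinf_on ?T (\<lambda>x. f (F (the_inv_into U c x)))"
      by (rule Cinf_on_cong_open[OF oT _ 2]) (auto simp: D(4) E(4))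
    moreover have "x \<in> ?T" using p Vd by auto
    ultimately show "\<exists>T. open T \<and> x \<in> T \<and> Cinf_on T (\<lambda>x. f (F (the_inv_into U c x)))"
      using oT by blast
  qed
qed

lemma smooth_map_comp:
  assumes A: "smooth_atlas A" and B: "smooth_atlas B" and C: "smooth_atlas C"
    and F: "smooth_map A B F" and G: "smooth_map B C G"
  shows "smooth_map A C (\<lambda>p. G (F p))"
  unfolding smooth_map_iff
proof (intro conjI ballI, goal_cases)
  case 1
  then show ?case using smooth_map_continuous[OF F] smooth_map_continuous[OF G] 
    by (rule_tac continuous_on_compose2) auto
next
  case (2 Vd)
  obtain V d where Vd: "Vd = (V, d)" "(V, d) \<in> C" using 2 by (cases Vd) auto
  have "smooth_fun_on B (G -` V) (\<lambda>p. d (G p))" using G Vd(2) by (auto simp: smooth_map_iff)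
  moreover have "open (G -` V)"
    using open_vimage[OF smooth_atlasD(1)[OF C Vd(2)] smooth_map_continuous[OF G]] .
  ultimately have "smooth_fun_on A (F -` (G -` V)) (\<lambda>p. d (G (F p)))"
    by (rule smooth_fun_on_comp[OF A B F])
  then show ?case using Vd by (simp add: vimage_def)
qed

lemma smooth_map_id: "smooth_atlas A \<Longrightarrow> smooth_map A A (\<lambda>p. p)"
  by (auto simp: smooth_map_iff vimage_def intro: smooth_atlasD)

lemma smooth_map_const: "smooth_map A B (\<lambda>p. k)"
  by (auto simp: smooth_map_iff intro: smooth_fun_on_const)

section \<open>Product manifolds and derivatives in one factor\<close>

lemma the_inv_into_map_prod:
  assumes "inj_on c U" "inj_on d V" "p \<in> U" "q \<in> V"
  shows "the_inv_into (U \<times> V) (map_prod c d) (c p, d q) = (p, q)"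
  using the_inv_into_f_f[OF map_prod_inj_on[OF assms(1,2)], of "(p, q)"] assms(3,4) by simp

lemma prod_atlas_chart:
  assumes A: "smooth_atlas A" and B: "smooth_atlas B" and Uc: "(U, c) \<in> A" and Vd: "(V, d) \<in> B"
  shows "is_chart (U \<times> V, map_prod c d)"
proof -
  note D = smooth_atlasD[OF A Uc] and E = smooth_atlasD[OF B Vd]
  have hc: "homeomorphism U (c ` U) c (the_inv_into U c)" "homeomorphism V (d ` V) d (the_inv_into V d)"
    using A B Uc Vd by (auto simp: smooth_atlas_def is_chart_def)
  have im: "map_prod c d ` (U \<times> V) = c ` U \<times> d ` V" by (rule map_prod_surj_on) auto
  have op: "open (c ` U \<times> d ` V)" using D(5)[of UNIV] E(5)[of UNIV] by (auto intro: open_Times)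
  have c1: "continuous_on (U \<times> V) (map_prod c d)"
  proof -
    have "continuous_on (U \<times> V) (\<lambda>x. (c (fst x), d (snd x)))"
      by (intro continuous_on_Pair continuous_on_compose2[OF D(3) continuous_on_fst[OF continuous_on_id]]
           continuous_on_compose2[OF E(3) continuous_on_snd[OF continuous_on_id]]) auto
    then show ?thesis by (simp add: map_prod_def case_prod_beta')
  qed
  have c2: "continuous_on (c ` U \<times> d ` V) (the_inv_into (U \<times> V) (map_prod c d))"
  proof -
    have "continuous_on (c ` U \<times> d ` V) (\<lambda>x. (the_inv_into U c (fst x), the_inv_into V d (snd x)))"
      by (intro continuous_on_Pair 
          continuous_on_compose2[OF homeomorphism_cont2[OF hc(1)] continuous_on_fst[OF continuous_on_id]]
          continuous_on_compose2[OF homeomorphism_cont2[OF hc(2)] continuous_on_snd[OF continuous_on_id]]) auto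
    then show ?thesis
      by (rule continuous_on_eq) (auto simp: the_inv_into_map_prod D(2,4) E(2,4))
  qed
  have "homeomorphism (U \<times> V) (c ` U \<times> d ` V) (map_prod c d) (the_inv_into (U \<times> V) (map_prod c d))"
    by (rule homeomorphismI[OF c1 c2]) (auto simp: the_inv_into_map_prod D(2) E(2))
  moreover have "inj_on (map_prod c d) (U \<times> V)" using D(2) E(2) by (intro map_prod_inj_on)
  ultimately show ?thesis
    using op D(1) E(1) by (auto simp: is_chart_def im intro: open_Times)
qed

text \<open>The inverse of a product chart is known to be the pair of inverses only on the image of
  the chart; the passage between the two is made here once and for all.\<close>

lemma smooth_fun_on_prodI:
  assumes A: "smooth_atlas A" and B: "smooth_atlas B" and "open W"
    and "\<And>U c V d. (U, c) \<in> A \<Longrightarrow> (V, d) \<in> B \<Longrightarrow>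
       Cinf_on (map_prod c d ` ((U \<times> V) \<inter> W)) (\<lambda>(x, y). f (the_inv_into U c x, the_inv_into V d y))"
  shows "smooth_fun_on (prod_atlas A B) W f"
proof (rule smooth_fun_onI)
  fix UV e assume "(UV, e) \<in> prod_atlas A B"
  then obtain U c V d where *: "(U, c) \<in> A" "(V, d) \<in> B" "UV = U \<times> V" "e = map_prod c d"
    by (auto simp: prod_atlas_def)
  note D = smooth_atlasD[OF A *(1)] and E = smooth_atlasD[OF B *(2)]
  have ch: "is_chart (U \<times> V, map_prod c d)" by (rule prod_atlas_chart[OF A B *(1,2)])
  then have hom: "homeomorphism (U \<times> V) (e ` UV) e (the_inv_into UV e)" and oc: "open (e ` UV)"
    using * by (auto simp: is_chart_def)
  have "openin (top_of_set (e ` UV)) (e ` (UV \<inter> W))"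
    using homeomorphism_imp_open_map[OF hom] \<open>open W\<close> openin_open_Int *(3) by blast
  then have op: "open (e ` (UV \<inter> W))" using oc openin_open_trans by blast
  show "Cinf_on (e ` (UV \<inter> W)) (\<lambda>x. f (the_inv_into UV e x))"
    by (rule Cinf_on_cong_open[OF op _ assms(4)[OF *(1,2), folded *(3,4)]])
      (auto simp: *(3,4) the_inv_into_map_prod D(2,4) E(2,4))
qed

lemma smooth_fun_on_fst:
  assumes A: "smooth_atlas A" and B: "smooth_atlas B" and W: "open W" and f: "smooth_fun_on A W f"
  shows "smooth_fun_on (prod_atlas A B) (fst -` W) (\<lambda>p. f (fst p))"
proof (rule smooth_fun_on_prodI[OF A B])
  show "open (fst -` W :: ('a \<times> 'c) set)" using W by (intro open_vimage_fst)
  fix U c V d assume *: "(U, c) \<in> A" "(V, d) \<in> B"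
  have "Cinf_on (map_prod c d ` ((U \<times> V) \<inter> fst -` W)) (\<lambda>z. f (the_inv_into U c (fst z)))"
    by (rule Cinf_on_compose[OF smooth_fun_onD[OF f *(1)] Cinf_on_bounded_linear[OF bounded_linear_fst]]) auto
  then show "Cinf_on (map_prod c d ` ((U \<times> V) \<inter> fst -` W)) (\<lambda>(x, y). f (fst (the_inv_into U c x, the_inv_into V d y)))"
    by (simp add: case_prod_beta')
qed

lemma smooth_fun_on_snd:
  assumes A: "smooth_atlas A" and B: "smooth_atlas B" and W: "open W" and f: "smooth_fun_on B W f"
  shows "smooth_fun_on (prod_atlas A B) (snd -` W) (\<lambda>p. f (snd p))"
proof (rule smooth_fun_on_prodI[OF A B])
  show "open (snd -` W :: ('a \<times> 'c) set)" using W by (intro open_vimage_snd)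
  fix U c V d assume *: "(U, c) \<in> A" "(V, d) \<in> B"
  have "Cinf_on (map_prod c d ` ((U \<times> V) \<inter> snd -` W)) (\<lambda>z. f (the_inv_into V d (snd z)))"
    by (rule Cinf_on_compose[OF smooth_fun_onD[OF f *(2)] Cinf_on_bounded_linear[OF bounded_linear_snd]]) auto
  then show "Cinf_on (map_prod c d ` ((U \<times> V) \<inter> snd -` W)) (\<lambda>(x, y). f (snd (the_inv_into U c x, the_inv_into V d y)))"
    by (simp add: case_prod_beta')
qed

lemma smooth_atlas_prod:
  assumes A: "smooth_atlas A" and B: "smooth_atlas B"
  shows "smooth_atlas (prod_atlas A B)"
  unfolding smooth_atlas_def
proof (intro conjI ballI, goal_cases)
  case (1 C)
  then show ?case using prod_atlas_chart[OF A B] by (auto simp: prod_atlas_def)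
next
  case 2
  have "\<exists>C\<in>prod_atlas A B. z \<in> fst C" for z
  proof -
    obtain U c where "(U, c) \<in> A" "fst z \<in> U" using smooth_atlas_cover[OF A] by metis
    moreover obtain V d where "(V, d) \<in> B" "snd z \<in> V" using smooth_atlas_cover[OF B] by metis
    ultimately show ?thesis
      by (intro bexI[of _ "(U \<times> V, map_prod c d)"]) (auto simp: prod_atlas_def mem_Times_iff)
  qed
  then show ?case by (force simp: case_prod_beta')
next
  case (3 C)
  have "Cinf_on (snd C ` (fst C \<inter> fst E)) (snd E \<circ> the_inv_into (fst C) (snd C))"
    if E: "E \<in> prod_atlas A B" for E
  proof -
    obtain U c V d where E': "E = (U \<times> V, map_prod c d)" "(U, c) \<in> A" "(V, d) \<in> B"
      using E by (auto simp: prod_atlas_def)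
    note D = smooth_atlasD[OF A E'(2)] and F = smooth_atlasD[OF B E'(3)]
    have "smooth_fun_on (prod_atlas A B) (U \<times> V) (\<lambda>p. c (fst p))"
      by (rule smooth_fun_on_subset[OF smooth_fun_on_fst[OF A B D(1,6)]]) auto
    moreover have "smooth_fun_on (prod_atlas A B) (U \<times> V) (\<lambda>p. d (snd p))"
      by (rule smooth_fun_on_subset[OF smooth_fun_on_snd[OF A B F(1,6)]]) auto
    ultimately have "smooth_fun_on (prod_atlas A B) (U \<times> V) (map_prod c d)"
      using smooth_fun_on_Pair by (fastforce simp: map_prod_def case_prod_beta')
    then show ?thesis using 3 E' by (cases C) (auto simp: smooth_fun_on_def)
  qed
  then show ?case by (auto simp: case_prod_beta')
qed

lemma smooth_map_fst: "smooth_atlas A \<Longrightarrow> smooth_atlas B \<Longrightarrow> smooth_map (prod_atlas A B) A fst"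
  using smooth_fun_on_fst[OF _ _ smooth_atlasD(1) smooth_atlasD(6)]
  by (fastforce simp: smooth_map_iff intro: continuous_on_fst continuous_on_id)

lemma smooth_map_snd: "smooth_atlas A \<Longrightarrow> smooth_atlas B \<Longrightarrow> smooth_map (prod_atlas A B) B snd"
  using smooth_fun_on_snd[OF _ _ smooth_atlasD(1) smooth_atlasD(6)]
  by (fastforce simp: smooth_map_iff intro: continuous_on_snd continuous_on_id)

lemma smooth_map_Pair:
  assumes "smooth_map A B F" "smooth_map A C G"
  shows "smooth_map A (prod_atlas B C) (\<lambda>p. (F p, G p))"
  unfolding smooth_map_iff
proof (intro conjI ballI, goal_cases)
  case 1
  then show ?case using assms by (auto intro: continuous_on_Pair smooth_map_continuous)
next
  case (2 E)
  then obtain U c V d where E: "E = (U \<times> V, map_prod c d)" "(U, c) \<in> B" "(V, d) \<in> C"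
    by (auto simp: prod_atlas_def)
  have "smooth_fun_on A (F -` U) (\<lambda>p. c (F p))" "smooth_fun_on A (G -` V) (\<lambda>p. d (G p))"
    using assms E by (auto simp: smooth_map_iff)
  then have "smooth_fun_on A (F -` U \<inter> G -` V) (\<lambda>p. (c (F p), d (G p)))"
    by (intro smooth_fun_on_Pair) (auto elim: smooth_fun_on_subset)
  moreover have "F -` U \<inter> G -` V = (\<lambda>p. (F p, G p)) -` (U \<times> V)" by auto
  ultimately show ?case using E by simp
qed

text \<open>In product coordinates this is the derivative of a smooth function in the direction
  \<open>(0, v)\<close>, restricted to a slice. Applied to \<open>f (p \<otimes> x)\<close> and to
  \<open>inv (F p) \<otimes> F (p \<otimes> x)\<close>, it yields the smoothness in \<open>p\<close>
  of directional derivatives and of differentials.\<close>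

lemma smooth_partial_derivative:
  assumes A: "smooth_atlas A" and B: "smooth_atlas B" and W: "open W"
    and f: "smooth_fun_on (prod_atlas A B) W f" and Vd: "(V, d) \<in> B" "q \<in> V"
  shows "(p, q) \<in> W \<Longrightarrow> (\<lambda>x. f (p, the_inv_into V d x)) differentiable (at (d q))"
    and "smooth_fun_on A {p. (p, q) \<in> W} (\<lambda>p. frechet_derivative (\<lambda>x. f (p, the_inv_into V d x)) (at (d q)) v)"
proof -
  have *: "(\<forall>p. p \<in> U \<longrightarrow> (p, q) \<in> W \<longrightarrow> (\<lambda>x. f (p, the_inv_into V d x)) differentiable (at (d q))) \<and>
      Cinf_on (c ` (U \<inter> {p. (p, q) \<in> W})) (\<lambda>y. frechet_derivative (\<lambda>x. f (the_inv_into U c y, the_inv_into V d x)) (at (d q)) v)"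
    if Uc: "(U, c) \<in> A" for U c
  proof -
    note D = smooth_atlasD[OF A Uc] and E = smooth_atlasD[OF B Vd(1)]
    have UV: "(U \<times> V, map_prod c d) \<in> prod_atlas A B" using Uc Vd by (auto simp: prod_atlas_def)
    let ?S = "map_prod c d ` (U \<times> V \<inter> W)"
    define h where "h z = f (the_inv_into U c (fst z), the_inv_into V d (snd z))" for z
    have oS: "open ?S" using smooth_atlasD(5)[OF smooth_atlas_prod[OF A B] UV W] .
    have h: "Cinf_on ?S h"
      by (rule Cinf_on_cong_open[OF oS _ smooth_fun_onD[OF f UV]])
        (auto simp: h_def the_inv_into_map_prod D(2,4) E(2,4))
    have der: "((\<lambda>x. f (the_inv_into U c y, the_inv_into V d x)) has_derivative 
        (\<lambda>v. frechet_derivative h (at (y, d q)) (0, v))) (at (d q))" if "(y, d q) \<in> ?S" for y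
    proof -
      have "((\<lambda>x. (y, x)) has_derivative (\<lambda>v. (0, v))) (at (d q))"
        by (auto intro!: derivative_eq_intros)
      from has_derivative_compose[OF this Cinf_on_has_derivative[OF h that]] show ?thesis
        by (simp add: h_def)
    qed
    have mem: "(c p, d q) \<in> ?S" if "p \<in> U" "(p, q) \<in> W" for p
      using that Vd by (intro image_eqI[of _ _ "(p, q)"]) auto
    have "(\<lambda>x. f (p, the_inv_into V d x)) differentiable (at (d q))" if "p \<in> U" "(p, q) \<in> W" for p
      using der[OF mem[OF that]] that D(4) by (auto simp: differentiable_def)
    moreover have "Cinf_on (c ` (U \<inter> {p. (p, q) \<in> W}))
      (\<lambda>y. frechet_derivative (\<lambda>x. f (the_inv_into U c y, the_inv_into V d x)) (at (d q)) v)"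
    proof -
      have "Cinf_on (c ` (U \<inter> {p. (p, q) \<in> W})) (\<lambda>y. (y, 0) + (0, d q))"
        by (intro Cinf_on_add Cinf_on_const Cinf_on_bounded_linear bounded_linear_Pair bounded_linear_ident bounded_linear_zero)
      then have 1: "Cinf_on (c ` (U \<inter> {p. (p, q) \<in> W})) (\<lambda>y. (y, d q))" by simp
      have 2: "Cinf_on (c ` (U \<inter> {p. (p, q) \<in> W})) (\<lambda>y. frechet_derivative h (at (y, d q)) (0, v))"
        by (rule Cinf_on_compose[OF Cinf_on_frechet[OF oS h] 1]) (use mem in auto)
      have op: "open (c ` (U \<inter> {p. (p, q) \<in> W}))"
      proof (rule D(5))
        have "open ((\<lambda>p. (p, q)) -` W)" using W by (rule open_vimage) (intro continuous_intros)
        then show "open {p. (p, q) \<in> W}" by (simp add: vimage_def)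
      qed
      show ?thesis
      proof (rule Cinf_on_cong_open[OF op _ 2])
        fix y assume "y \<in> c ` (U \<inter> {p. (p, q) \<in> W})"
        then have "(y, d q) \<in> ?S" using mem by auto
        from fun_cong[OF frechet_derivative_at[OF der[OF this]], of v]
        show "frechet_derivative h (at (y, d q)) (0, v) =
          frechet_derivative (\<lambda>x. f (the_inv_into U c y, the_inv_into V d x)) (at (d q)) v" .
      qed
    qed
    ultimately show ?thesis by blast
  qed
  then show "smooth_fun_on A {p. (p, q) \<in> W} (\<lambda>p. frechet_derivative (\<lambda>x. f (p, the_inv_into V d x)) (at (d q)) v)"
    by (intro smooth_fun_onI) blast
  show "(p, q) \<in> W \<Longrightarrow> (\<lambda>x. f (p, the_inv_into V d x)) differentiable (at (d q))"
    using * smooth_atlas_cover[OF A, of p] by metis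
qed


section \<open>Symmetry of second derivatives\<close>

lemma Cinf_on_has_real_derivative_line:
  fixes f :: "'a::real_normed_vector \<Rightarrow> real"
  assumes "Cinf_on S f" "y + s *\<^sub>R u \<in> S"
  shows "((\<lambda>s. f (y + s *\<^sub>R u)) has_real_derivative frechet_derivative f (at (y + s *\<^sub>R u)) u) (at s)"
proof -
  note d = Cinf_on_has_derivative[OF assms]
  have "((\<lambda>s. y + s *\<^sub>R u) has_derivative (\<lambda>h. h *\<^sub>R u)) (at s)"
    by (auto intro!: derivative_eq_intros)
  from has_derivative_compose[OF this d]
  have "((\<lambda>s. f (y + s *\<^sub>R u)) has_derivative (\<lambda>h. h * frechet_derivative f (at (y + s *\<^sub>R u)) u)) (at s)"
    by (simp add: linear_scale[OF has_derivative_linear[OF d]])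
  then show ?thesis
    by (rule has_derivative_imp_has_field_derivative) simp
qed

text \<open>The mean value theorem is applied first to the increment of \<open>f\<close> by
  \<open>h\<close> along \<open>v\<close>, as a function of the step along \<open>u\<close>, and
  then to the derivative in the direction \<open>u\<close>, along \<open>v\<close>.\<close>

lemma second_difference_eq:
  fixes f :: "'a::real_normed_vector \<Rightarrow> real"
  assumes S: "open S" "Cinf_on S f" and h: "0 < h"
    and box: "\<And>s t. s \<in> {0..h} \<Longrightarrow> t \<in> {0..h} \<Longrightarrow> x + s *\<^sub>R u + t *\<^sub>R v \<in> S"
  shows "\<exists>s\<in>{0..h}. \<exists>t\<in>{0..h}. f (x + h *\<^sub>R u + h *\<^sub>R v) - f (x + h *\<^sub>R u) - f (x + h *\<^sub>R v) + f x
     = h\<^sup>2 * frechet_derivative (\<lambda>y. frechet_derivative f (at y) u) (at (x + s *\<^sub>R u + t *\<^sub>R v)) v"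
proof -
  let ?d = "\<lambda>y. frechet_derivative f (at y) u"
  have d: "Cinf_on S ?d" by (rule Cinf_on_frechet[OF S])
  have "\<exists>s. 0 < s \<and> s < h \<and> 
      (f (x + h *\<^sub>R v + h *\<^sub>R u) - f (x + h *\<^sub>R u)) - (f (x + h *\<^sub>R v + 0 *\<^sub>R u) - f (x + 0 *\<^sub>R u))
      = (h - 0) * (?d (x + h *\<^sub>R v + s *\<^sub>R u) - ?d (x + s *\<^sub>R u))"
  proof (rule MVT2[OF h])
    fix s assume s: "0 \<le> s" "s \<le> h"
    have "x + h *\<^sub>R v + s *\<^sub>R u \<in> S" using box[of s h] s h by (simp add: add_ac)
    moreover have "x + s *\<^sub>R u \<in> S" using box[of s 0] s h by simp
    ultimately show "((\<lambda>s. f (x + h *\<^sub>R v + s *\<^sub>R u) - f (x + s *\<^sub>R u)) has_real_derivative 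
      ?d (x + h *\<^sub>R v + s *\<^sub>R u) - ?d (x + s *\<^sub>R u)) (at s)"
      by (intro DERIV_diff Cinf_on_has_real_derivative_line[OF S(2)])
  qed
  then obtain s where s: "0 < s" "s < h" "f (x + h *\<^sub>R v + h *\<^sub>R u) - f (x + h *\<^sub>R u) - (f (x + h *\<^sub>R v) - f x)
      = h * (?d (x + h *\<^sub>R v + s *\<^sub>R u) - ?d (x + s *\<^sub>R u))" by auto
  have "\<exists>t. 0 < t \<and> t < h \<and> ?d (x + s *\<^sub>R u + h *\<^sub>R v) - ?d (x + s *\<^sub>R u + 0 *\<^sub>R v)
     = (h - 0) * frechet_derivative ?d (at (x + s *\<^sub>R u + t *\<^sub>R v)) v"
    by (rule MVT2[OF h]) (use box s in \<open>auto intro!: Cinf_on_has_real_derivative_line[OF d]\<close>)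
  then obtain t where "0 < t" "t < h" "?d (x + s *\<^sub>R u + h *\<^sub>R v) - ?d (x + s *\<^sub>R u)
     = h * frechet_derivative ?d (at (x + s *\<^sub>R u + t *\<^sub>R v)) v" by auto
  with s show ?thesis
    by (intro bexI[of _ s] bexI[of _ t]) (auto simp: power2_eq_square algebra_simps)
qed

text \<open>The second difference is symmetric in \<open>u\<close> and \<open>v\<close>. Divided by
  \<open>h\<^sup>2\<close>, it is a value of either mixed derivative near \<open>x\<close>, and both
  are continuous at \<open>x\<close>.\<close>

lemma symmetric_second_frechet_derivative:
  fixes f :: "'a::real_normed_vector \<Rightarrow> real"
  assumes S: "open S" "Cinf_on S f" and x: "x \<in> S"
  shows "frechet_derivative (\<lambda>y. frechet_derivative f (at y) u) (at x) v =
         frechet_derivative (\<lambda>y. frechet_derivative f (at y) v) (at x) u" (is "?F u v x = ?F v u x")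
proof (rule ccontr)
  assume ne: "?F u v x \<noteq> ?F v u x"
  define \<epsilon> where "\<epsilon> = \<bar>?F u v x - ?F v u x\<bar> / 2"
  have e: "\<epsilon> > 0" using ne by (simp add: \<epsilon>_def)
  have cont: "isCont (?F a b) x" for a b
    using Cinf_on_continuous[OF Cinf_on_frechet[OF S(1) Cinf_on_frechet[OF S]]] S(1) x
      continuous_on_eq_continuous_at by blast
  obtain d1 where d1: "d1 > 0" "\<And>y. dist y x < d1 \<Longrightarrow> dist (?F u v y) (?F u v x) < \<epsilon>"
    using cont[of u v] e unfolding continuous_at_eps_delta by metis
  obtain d2 where d2: "d2 > 0" "\<And>y. dist y x < d2 \<Longrightarrow> dist (?F v u y) (?F v u x) < \<epsilon>"
    using cont[of v u] e unfolding continuous_at_eps_delta by metis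
  obtain d3 where d3: "d3 > 0" "\<And>y. dist y x < d3 \<Longrightarrow> y \<in> S"
    using S(1) x unfolding open_dist by metis
  define d where "d = min d1 (min d2 d3)"
  \<comment> \<open>Small enough to keep the parallelogram spanned by \<open>u\<close> and
    \<open>v\<close>, scaled by \<open>h\<close>, within distance \<open>d\<close> of
    \<open>x\<close>; the summand 1 keeps the denominator positive.\<close>
  define h where "h = d / (norm u + norm v + 1)"
  have d: "d > 0" using d1 d2 d3 by (simp add: d_def)
  have pos: "norm u + norm v + 1 > 0" by (smt (verit) norm_ge_zero)
  have h: "h > 0" using d pos by (simp add: h_def)
  have near: "dist (x + s *\<^sub>R a + t *\<^sub>R b) x < d" 
    if "s \<in> {0..h}" "t \<in> {0..h}" "norm a + norm b = norm u + norm v" for s t a b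
  proof -
    have "dist (x + s *\<^sub>R a + t *\<^sub>R b) x = norm (s *\<^sub>R a + t *\<^sub>R b)" by (simp add: dist_norm)
    also have "\<dots> \<le> s * norm a + t * norm b" using norm_triangle_ineq[of "s *\<^sub>R a" "t *\<^sub>R b"] that by simp
    also have "\<dots> \<le> h * norm a + h * norm b" using that by (intro add_mono mult_right_mono) auto
    also have "\<dots> = h * (norm u + norm v)" by (simp only: distrib_left[symmetric] that(3))
    also have "\<dots> < h * (norm u + norm v + 1)" using h by simp
    also have "\<dots> = d" using pos by (simp add: h_def)
    finally show ?thesis .
  qed
  obtain s t where st: "s \<in> {0..h}" "t \<in> {0..h}" 
    "f (x + h *\<^sub>R u + h *\<^sub>R v) - f (x + h *\<^sub>R u) - f (x + h *\<^sub>R v) + f x = h\<^sup>2 * ?F u v (x + s *\<^sub>R u + t *\<^sub>R v)"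
    using second_difference_eq[OF S h, of x u v] near d3 unfolding d_def by (metis min_less_iff_conj)
  obtain s' t' where st': "s' \<in> {0..h}" "t' \<in> {0..h}" 
    "f (x + h *\<^sub>R v + h *\<^sub>R u) - f (x + h *\<^sub>R v) - f (x + h *\<^sub>R u) + f x = h\<^sup>2 * ?F v u (x + s' *\<^sub>R v + t' *\<^sub>R u)"
    using second_difference_eq[OF S h, of x v u] near d3 unfolding d_def by (metis min_less_iff_conj add.commute)
  have "h\<^sup>2 * ?F u v (x + s *\<^sub>R u + t *\<^sub>R v) = h\<^sup>2 * ?F v u (x + s' *\<^sub>R v + t' *\<^sub>R u)"
  proof -
    have "x + h *\<^sub>R v + h *\<^sub>R u = x + h *\<^sub>R u + h *\<^sub>R v" by (simp add: add_ac)
    from st'(3)[unfolded this] show ?thesis using st(3) by linarith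
  qed
  then have eq: "?F u v (x + s *\<^sub>R u + t *\<^sub>R v) = ?F v u (x + s' *\<^sub>R v + t' *\<^sub>R u)" using h by simp
  have "dist (?F u v (x + s *\<^sub>R u + t *\<^sub>R v)) (?F u v x) < \<epsilon>"
    using d1(2) near[OF st(1,2)] by (simp add: d_def)
  moreover have "dist (?F v u (x + s' *\<^sub>R v + t' *\<^sub>R u)) (?F v u x) < \<epsilon>"
    using d2(2) near[OF st'(1,2)] by (simp add: d_def add.commute)
  ultimately show False
    unfolding eq \<epsilon>_def dist_real_def by (simp add: abs_if split: if_splits)
qed


section \<open>Left-invariant calculus on a Lie group\<close>

locale lie =
  fixes N :: "('m::{t2_space, second_countable_topology}, 'e::euclidean_space) lie_data" (structure)
  assumes lie: "lie_group N"
begin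

abbreviation A where "A \<equiv> atlas N"
abbreviation U0 where "U0 \<equiv> fst (unit_chart N)"
abbreviation K where "K \<equiv> coord N"
abbreviation L where "L \<equiv> uncoord N"
abbreviation x0 where "x0 \<equiv> coord N \<one>"

lemma group: "group N" and carrier: "carrier N = UNIV" and atlas: "smooth_atlas A"
  and unit_chart: "(U0, K) \<in> A" and one_U0: "\<one> \<in> U0"
  using lie by (auto simp: lie_group_def coord_def)

lemma assoc: "(x \<otimes> y) \<otimes> z = x \<otimes> (y \<otimes> z)"
  using monoid.m_assoc[OF group.is_monoid[OF group]] carrier by simp

lemma one_simps [simp]: "\<one> \<otimes> x = x" "x \<otimes> \<one> = x" "inv x \<otimes> x = \<one>" "x \<otimes> inv x = \<one>" "inv \<one> = \<one>" "inv (inv x) = x"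
  using group.l_inv[OF group] group.r_inv[OF group] monoid.l_one[OF group.is_monoid[OF group]]
    monoid.r_one[OF group.is_monoid[OF group]] group.inv_inv[OF group]
    monoid.inv_one[OF group.is_monoid[OF group]] carrier by auto

lemma cancel [simp]: "inv x \<otimes> (x \<otimes> y) = y" "x \<otimes> (inv x \<otimes> y) = y"
  by (simp_all flip: assoc)

lemma inv_mult: "inv (x \<otimes> y) = inv y \<otimes> inv x"
  using group.inv_mult_group[OF group] carrier by simp

lemmas unit_chartD = smooth_atlasD[OF atlas unit_chart]

lemma L_eq: "L = the_inv_into U0 K"
  by (simp add: uncoord_def)

lemma L_K: "p \<in> U0 \<Longrightarrow> L (K p) = p"
  unfolding L_eq by (rule unit_chartD(4))

lemma L_x0 [simp]: "L x0 = \<one>"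
  using L_K one_U0 by simp

lemma K_L: "x \<in> K ` U0 \<Longrightarrow> K (L x) = x"
  using L_K by auto

lemma atlas2: "smooth_atlas (prod_atlas A A)"
  by (rule smooth_atlas_prod[OF atlas atlas])

lemma smooth_mult:
  assumes "smooth_atlas B" "smooth_map B A F" "smooth_map B A G"
  shows "smooth_map B A (\<lambda>p. F p \<otimes> G p)"
proof -
  have "smooth_map (prod_atlas A A) A (\<lambda>(x, y). x \<otimes> y)" using lie by (simp add: lie_group_def)
  from smooth_map_comp[OF assms(1) atlas2 atlas smooth_map_Pair[OF assms(2,3)] this]
  show ?thesis by simp
qed

lemma smooth_inv:
  assumes "smooth_atlas B" "smooth_map B A F"
  shows "smooth_map B A (\<lambda>p. inv (F p))"
  using smooth_map_comp[OF assms(1) atlas atlas assms(2)] lie by (simp add: lie_group_def)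

lemma smooth_translate: "smooth_map A A (\<lambda>x. a \<otimes> x)"
  by (intro smooth_mult smooth_map_const smooth_map_id atlas)

lemma open_vimage_smooth:
  assumes "smooth_map B A F" "open W" shows "open {p. F p \<in> W}"
  using open_vimage[OF assms(2) smooth_map_continuous[OF assms(1)]] by (simp add: vimage_def)

lemma smooth_fun_comp:
  assumes "smooth_atlas B" "smooth_map B A F" "smooth_fun_on A W f" "open W" "\<And>p. p \<in> W' \<Longrightarrow> F p \<in> W"
  shows "smooth_fun_on B W' (\<lambda>p. f (F p))"
  by (rule smooth_fun_on_subset[OF smooth_fun_on_comp[OF assms(1) atlas assms(2,3,4)]]) (use assms(5) in auto)

text \<open>Derivatives at \<open>p\<close> are taken at \<open>x0\<close> in the translated chart
  \<open>x \<mapsto> p \<otimes> L x\<close>; these are the sets on which a function given on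
  \<open>W\<close> is read in that chart.\<close>

lemma open_coord_nbhd: "open W \<Longrightarrow> open {x \<in> K ` U0. p \<otimes> L x \<in> W}"
proof -
  assume "open W"
  then have "open (K ` (U0 \<inter> {x. p \<otimes> x \<in> W}))"
    using unit_chartD(5) open_vimage_smooth smooth_translate by blast
  moreover have "K ` (U0 \<inter> {x. p \<otimes> x \<in> W}) = {x \<in> K ` U0. p \<otimes> L x \<in> W}"
    by (auto simp: L_K)
  ultimately show ?thesis by simp
qed

lemma Cinf_translate:
  assumes "smooth_fun_on A W f" "open W"
  shows "Cinf_on {x \<in> K ` U0. p \<otimes> L x \<in> W} (\<lambda>x. f (p \<otimes> L x))"
proof -
  have "smooth_fun_on A {x. p \<otimes> x \<in> W} (\<lambda>x. f (p \<otimes> x))"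
    by (rule smooth_fun_comp[OF atlas smooth_translate assms]) auto
  from smooth_fun_onD[OF this unit_chart] show ?thesis unfolding L_eq[symmetric]
    by (rule Cinf_on_subset) (auto simp: L_K)
qed

lemma x0_nbhd: "p \<in> W \<Longrightarrow> x0 \<in> {x \<in> K ` U0. p \<otimes> L x \<in> W}"
  using one_U0 by simp

lemma eventually_nbhd: 
  assumes "open W" "p \<in> W" shows "eventually (\<lambda>x. x \<in> K ` U0 \<and> p \<otimes> L x \<in> W) (nhds x0)"
  using eventually_nhds_in_open[OF open_coord_nbhd[OF assms(1)] x0_nbhd[OF assms(2)]] by simp

section \<open>Derivatives along left-invariant fields\<close>

abbreviation D where "D \<equiv> dir_deriv N"

lemma has_derivative_D:
  assumes "smooth_fun_on A W f" "open W" "p \<in> W"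
  shows "((\<lambda>x. f (p \<otimes> L x)) has_derivative D f p) (at x0)"
  unfolding dir_deriv_def
  using Cinf_on_has_derivative[OF Cinf_translate[OF assms(1,2)] x0_nbhd[OF assms(3)]] .

lemma linear_D: "smooth_fun_on A W f \<Longrightarrow> open W \<Longrightarrow> p \<in> W \<Longrightarrow> linear (D f p)"
  by (rule has_derivative_linear[OF has_derivative_D])

lemma D_eqI: "((\<lambda>x. f (p \<otimes> L x)) has_derivative f') (at x0) \<Longrightarrow> D f p = f'"
  unfolding dir_deriv_def by (rule frechet_derivative_at[symmetric])

text \<open>\<open>D f p u\<close> is the partial derivative of \<open>f (p \<otimes> q)\<close> in
  \<open>q\<close> at the unit.\<close>

lemma smooth_D:
  assumes f: "smooth_fun_on A W f" and W: "open W"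
  shows "smooth_fun_on A W (\<lambda>p. D f p u)"
proof -
  let ?m = "\<lambda>z. fst z \<otimes> snd z"
  have m: "smooth_map (prod_atlas A A) A ?m"
    by (intro smooth_mult atlas2 smooth_map_fst smooth_map_snd atlas)
  have "smooth_fun_on (prod_atlas A A) {z. ?m z \<in> W} (\<lambda>z. f (?m z))"
    by (rule smooth_fun_comp[OF atlas2 m f W]) auto
  from smooth_partial_derivative(2)[OF atlas atlas open_vimage_smooth[OF m W] this unit_chart one_U0]
  show ?thesis by (simp add: dir_deriv_def L_eq)
qed

lemma D_cong:
  assumes "smooth_fun_on A W f" "open W" "p \<in> W" "\<And>q. q \<in> W \<Longrightarrow> f q = h q"
  shows "D h p = D f p"
proof (rule D_eqI)
  show "((\<lambda>x. h (p \<otimes> L x)) has_derivative D f p) (at x0)"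
    by (rule has_derivative_transform_within_open[OF has_derivative_D[OF assms(1-3)] 
       open_coord_nbhd[OF assms(2)] x0_nbhd[OF assms(3)]]) (use assms(4) in auto)
qed

lemma D_const: "D (\<lambda>_. k) p u = 0"
  by (simp add: dir_deriv_def)

lemma D_add:
  assumes "smooth_fun_on A W f" "smooth_fun_on A W h" "open W" "p \<in> W"
  shows "D (\<lambda>p. f p + h p) p u = D f p u + D h p u"
  by (rule fun_cong[OF D_eqI]) (intro has_derivative_add has_derivative_D[of W] assms)

lemma D_linear:
  assumes "bounded_linear l" "smooth_fun_on A W f" "open W" "p \<in> W"
  shows "D (\<lambda>p. l (f p)) p u = l (D f p u)"
  by (rule fun_cong[OF D_eqI]) (intro bounded_linear.has_derivative[OF assms(1)] has_derivative_D[of W] assms)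

lemma D_bilinear:
  assumes "bounded_bilinear B" "smooth_fun_on A W f" "smooth_fun_on A W h" "open W" "p \<in> W"
  shows "D (\<lambda>p. B (f p) (h p)) p u = B (f p) (D h p u) + B (D f p u) (h p)"
  using fun_cong[OF D_eqI[OF bounded_bilinear.FDERIV[OF assms(1) has_derivative_D[OF assms(2,4,5)] has_derivative_D[OF assms(3,4,5)]]], of u]
  by simp

lemma D_sum:
  assumes "\<And>i. i \<in> I \<Longrightarrow> smooth_fun_on A W (f i)" "open W" "p \<in> W"
  shows "D (\<lambda>p. \<Sum>i\<in>I. f i p) p u = (\<Sum>i\<in>I. D (f i) p u)"
  by (rule fun_cong[OF D_eqI]) (intro has_derivative_sum has_derivative_D[of W] assms)

text \<open>\<open>D\<close> is defined along \<open>x \<mapsto> p \<otimes> L x\<close>; this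
  extends it to any map \<gamma> through \<open>p\<close>, read in the chart translated to
  \<open>p\<close>. As \<open>L\<close> inverts \<open>K\<close> on \<open>U0\<close>, the values
  near \<open>y0\<close> have to stay in that chart.\<close>

lemma D_chain:
  assumes f: "smooth_fun_on A W f" "open W" "p \<in> W"
    and \<gamma>: "((\<lambda>y. K (inv p \<otimes> \<gamma> y)) has_derivative \<gamma>') (at y0)" "\<gamma> y0 = p"
      "eventually (\<lambda>y. inv p \<otimes> \<gamma> y \<in> U0) (nhds y0)"
  shows "((\<lambda>y. f (\<gamma> y)) has_derivative (\<lambda>v. D f p (\<gamma>' v))) (at y0)"
proof -
  have "((\<lambda>x. f (p \<otimes> L x)) has_derivative D f p) (at (K (inv p \<otimes> \<gamma> y0)))"
    using has_derivative_D[OF f] \<gamma>(2) by simp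
  from has_derivative_compose[OF \<gamma>(1) this]
  have *: "((\<lambda>y. f (p \<otimes> L (K (inv p \<otimes> \<gamma> y)))) has_derivative (\<lambda>v. D f p (\<gamma>' v))) (at y0)" .
  show ?thesis
  proof (rule has_derivative_transform_eventually[OF *])
    have "eventually (\<lambda>y. f (p \<otimes> L (K (inv p \<otimes> \<gamma> y))) = f (\<gamma> y)) (nhds y0)"
      by (rule eventually_mono[OF \<gamma>(3)]) (simp add: L_K)
    then show "eventually (\<lambda>y. f (p \<otimes> L (K (inv p \<otimes> \<gamma> y))) = f (\<gamma> y)) (at y0 within UNIV)"
      by (simp add: eventually_nhds_conv_at)
  qed (simp_all add: \<gamma>(2))
qed

text \<open>The unit chart translated to \<open>p\<close>. Its coordinate map has the identity as
  derivative at \<open>p\<close> (\<open>D_coord_at\<close>), which makes it the test function for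
  recovering tangent vectors.\<close>

definition chart_at :: "'m \<Rightarrow> 'm set" where "chart_at p = {q. inv p \<otimes> q \<in> U0}"

lemma open_chart_at: "open (chart_at p)"
  unfolding chart_at_def by (rule open_vimage_smooth[OF smooth_translate unit_chartD(1)])

lemma mem_chart_at: "p \<in> chart_at p"
  by (simp add: chart_at_def one_U0)

lemma smooth_coord_at: "smooth_fun_on A (chart_at p) (\<lambda>q. K (inv p \<otimes> q))"
  by (rule smooth_fun_comp[OF atlas smooth_translate unit_chartD(6,1)]) (simp add: chart_at_def)

lemma D_coord_at: "D (\<lambda>q. K (inv p \<otimes> q)) p u = u"
proof -
  have "D (\<lambda>q. K (inv p \<otimes> q)) p = (\<lambda>u. u)"
  proof (rule D_eqI)
    show "((\<lambda>x. K (inv p \<otimes> (p \<otimes> L x))) has_derivative (\<lambda>u. u)) (at x0)"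
      by (rule has_derivative_transform_within_open[OF has_derivative_ident open_coord_nbhd[OF open_UNIV] x0_nbhd[OF UNIV_I]])
        (simp add: K_L)
  qed
  then show ?thesis by simp
qed

lemma D_separates:
  assumes "\<And>W f. open W \<Longrightarrow> p \<in> W \<Longrightarrow> smooth_fun_on A W f \<Longrightarrow> D f p u = (D f p v :: real)"
  shows "u = v"
proof (rule euclidean_eqI)
  fix b :: 'e assume "b \<in> Basis"
  note * = bounded_linear_inner_left smooth_coord_at open_chart_at mem_chart_at
  have "D (\<lambda>q. K (inv p \<otimes> q) \<bullet> b) p u = D (\<lambda>q. K (inv p \<otimes> q) \<bullet> b) p v"
    by (rule assms[OF open_chart_at mem_chart_at]) (rule smooth_fun_on_linear[OF *(1,2)])
  then show "u \<bullet> b = v \<bullet> b"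
    by (simp add: D_linear[OF *] D_coord_at)
qed

lemma D_eq_0_imp_locally_const:
  assumes f: "smooth_fun_on A W f" "open W" "\<And>q u. q \<in> W \<Longrightarrow> D f q u = 0" and p: "p \<in> W"
  shows "\<exists>T. open T \<and> p \<in> T \<and> T \<subseteq> W \<and> (\<forall>q\<in>T. f q = f p)"
proof -
  let ?S = "{x \<in> K ` U0. p \<otimes> L x \<in> W}"
  obtain r where r: "r > 0" "ball x0 r \<subseteq> ?S"
    by (rule openE[OF open_coord_nbhd[OF f(2)] x0_nbhd[OF p]])
  \<comment> \<open>\<open>D\<close> at \<open>p\<close> concerns the base point \<open>x0\<close>
    of the chart only; at another point \<open>y\<close> the derivative is obtained from
    \<open>D\<close> at \<open>?q\<close>, through the chart translated to
    \<open>?q\<close>.\<close>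
  have der: "((\<lambda>x. f (p \<otimes> L x)) has_derivative (\<lambda>_. 0)) (at y)" if y: "y \<in> ?S" for y
  proof -
    let ?q = "p \<otimes> L y"
    have q: "?q \<in> W" using y by auto
    have S': "y \<in> {x \<in> K ` U0. p \<otimes> L x \<in> chart_at ?q}" using y mem_chart_at by auto
    have c: "((\<lambda>x. K (inv ?q \<otimes> (p \<otimes> L x))) has_derivative 
        frechet_derivative (\<lambda>x. K (inv ?q \<otimes> (p \<otimes> L x))) (at y)) (at y)"
      by (rule Cinf_on_has_derivative[OF Cinf_translate[OF smooth_coord_at open_chart_at] S'])
    have "eventually (\<lambda>x. inv ?q \<otimes> (p \<otimes> L x) \<in> U0) (nhds y)"
      using eventually_nhds_in_open[OF open_coord_nbhd[OF open_chart_at] S']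
      by (rule eventually_mono) (auto simp: chart_at_def)
    from D_chain[where \<gamma> = "\<lambda>x. p \<otimes> L x", OF f(1,2) q c refl this] show ?thesis by (simp only: f(3)[OF q])
  qed
  have "\<exists>c. \<forall>x\<in>ball x0 r. f (p \<otimes> L x) = c"
  proof (rule has_derivative_zero_constant[OF convex_ball])
    fix x assume "x \<in> ball x0 r"
    then have "x \<in> ?S" using r(2) by blast
    then show "((\<lambda>x. f (p \<otimes> L x)) has_derivative (\<lambda>_. 0)) (at x within ball x0 r)"
      by (rule has_derivative_at_withinI[OF der])
  qed
  then obtain c where c: "\<And>x. x \<in> ball x0 r \<Longrightarrow> f (p \<otimes> L x) = c" by blast
  define T where "T = {q. inv p \<otimes> q \<in> U0 \<inter> K -` ball x0 r}"
  have "open T" unfolding T_def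
  proof (rule open_vimage_smooth[OF smooth_translate])
    show "open (U0 \<inter> K -` ball x0 r)"
      using continuous_open_preimage[OF unit_chartD(3,1) open_ball] .
  qed
  moreover have "p \<in> T" using one_U0 r by (simp add: T_def)
  moreover have "q \<in> W \<and> f q = c" if "q \<in> T" for q
  proof -
    have "inv p \<otimes> q \<in> U0" "K (inv p \<otimes> q) \<in> ball x0 r" using that by (auto simp: T_def)
    moreover then have "p \<otimes> L (K (inv p \<otimes> q)) = q" by (simp add: L_K)
    ultimately show ?thesis using c[of "K (inv p \<otimes> q)"] r by auto
  qed
  ultimately show ?thesis by (metis subsetI)
qed

section \<open>The differential of a smooth map in the left trivialization\<close>

abbreviation dF where "dF \<equiv> differential N"

context
  fixes F assumes F: "smooth_map A A F"
begin

lemma has_derivative_differential: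
  "((\<lambda>x. K (inv (F p) \<otimes> F (p \<otimes> L x))) has_derivative dF F p) (at x0)"
  and smooth_differential: "smooth_fun_on A UNIV (\<lambda>p. dF F p u)"
proof -
  let ?m = "\<lambda>z. inv (F (fst z)) \<otimes> F (fst z \<otimes> snd z)"
  have m: "smooth_map (prod_atlas A A) A ?m"
    by (intro smooth_mult smooth_inv atlas2 smooth_map_comp[OF atlas2 atlas atlas _ F] smooth_map_fst smooth_map_snd atlas)
  have "smooth_fun_on (prod_atlas A A) {z. ?m z \<in> U0} (\<lambda>z. K (?m z))"
    by (rule smooth_fun_comp[OF atlas2 m unit_chartD(6,1)]) auto
  from smooth_partial_derivative[OF atlas atlas open_vimage_smooth[OF m unit_chartD(1)] this unit_chart one_U0]
  show "((\<lambda>x. K (inv (F p) \<otimes> F (p \<otimes> L x))) has_derivative dF F p) (at x0)"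
    and "smooth_fun_on A UNIV (\<lambda>p. dF F p u)"
    by (simp_all add: differential_def L_eq one_U0 frechet_derivative_works[symmetric])
qed

lemma linear_differential: "linear (dF F p)"
  by (rule has_derivative_linear[OF has_derivative_differential])

lemma smooth_fun_on_comp_map:
  assumes "smooth_fun_on A W f" "open W"
  shows "smooth_fun_on A {p. F p \<in> W} (\<lambda>p. f (F p))" "open {p. F p \<in> W}"
  by (rule smooth_fun_comp[OF atlas F assms], simp, rule open_vimage_smooth[OF F assms(2)])

lemma D_comp:
  assumes f: "smooth_fun_on A W f" "open W" "F p \<in> W"
  shows "D (\<lambda>p. f (F p)) p u = D f (F p) (dF F p u)"
proof (rule fun_cong[OF D_eqI])
  have "open {q. F q \<in> chart_at (F p)}" by (rule open_vimage_smooth[OF F open_chart_at])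
  moreover have "p \<in> {q. F q \<in> chart_at (F p)}" by (simp add: mem_chart_at)
  ultimately have "eventually (\<lambda>x. inv (F p) \<otimes> F (p \<otimes> L x) \<in> U0) (nhds x0)"
    by (rule eventually_mono[OF eventually_nbhd]) (simp add: chart_at_def)
  then show "((\<lambda>x. f (F (p \<otimes> L x))) has_derivative (\<lambda>u. D f (F p) (dF F p u))) (at x0)"
    by (intro D_chain[OF f has_derivative_differential]) auto
qed

end

end


section \<open>Brackets of vector fields\<close>

context lie
begin

abbreviation D2 where "D2 f p u v \<equiv> D (\<lambda>q. D f q v) p u"

lemma D_D_linear:
  assumes f: "smooth_fun_on A W f" "open W" "p \<in> W"
  shows "linear (\<lambda>v. D2 f p u v)"
proof (rule linearI)
  note sm = smooth_D[OF f(1,2)]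
  fix v v' c
  have "D2 f p u (v + v') = D (\<lambda>q. D f q v + D f q v') p u"
    by (rule fun_cong[OF D_cong[OF smooth_fun_on_add[OF sm sm] f(2,3)]])
      (simp add: linear_add[OF linear_D[OF f(1,2)]])
  then show "D2 f p u (v + v') = D2 f p u v + D2 f p u v'" by (simp add: D_add[OF sm sm f(2,3)])
  have "D2 f p u (c *\<^sub>R v) = D (\<lambda>q. c *\<^sub>R D f q v) p u"
    by (rule fun_cong[OF D_cong[OF smooth_fun_on_linear[OF bounded_linear_scaleR_right sm] f(2,3)]])
      (simp add: linear_scale[OF linear_D[OF f(1,2)]])
  then show "D2 f p u (c *\<^sub>R v) = c *\<^sub>R D2 f p u v" 
    by (simp add: D_linear[OF bounded_linear_scaleR_right sm f(2,3)])
qed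

lemma linear_expand:
  assumes "linear l" shows "l (w::'e) = (\<Sum>b\<in>Basis. (w \<bullet> b) *\<^sub>R l b)"
proof -
  have "l (\<Sum>b\<in>Basis. (w \<bullet> b) *\<^sub>R b) = (\<Sum>b\<in>Basis. (w \<bullet> b) *\<^sub>R l b)"
    using assms by (simp add: linear_sum linear_scale)
  then show ?thesis by (simp add: euclidean_representation)
qed

text \<open>The direction varies with the point, so it is expanded in the basis; the product rule
  then separates its variation from the second derivative of \<open>f\<close>.\<close>

lemma
  assumes f: "smooth_fun_on A W f" and w: "smooth_fun_on A W w" and W: "open W"
  shows smooth_D_field: "smooth_fun_on A W (\<lambda>q. D f q (w q))"
    and D_D_field: "p \<in> W \<Longrightarrow> D (\<lambda>q. D f q (w q)) p u = D2 f p u (w p) + D f p (D w p u)"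
proof -
  let ?r = "\<lambda>q. \<Sum>b\<in>Basis. (w q \<bullet> b) *\<^sub>R D f q b"
  have eq: "?r q = D f q (w q)" if "q \<in> W" for q
    by (rule linear_expand[OF linear_D[OF f W that], symmetric])
  note wb = smooth_fun_on_linear[OF bounded_linear_inner_left w]
  have sm: "smooth_fun_on A W (\<lambda>q. (w q \<bullet> b) *\<^sub>R D f q b)" for b
    by (rule smooth_fun_on_bilinear[OF bounded_bilinear_scaleR wb smooth_D[OF f W]])
  note smr = smooth_fun_on_sum[OF sm]
  show "smooth_fun_on A W (\<lambda>q. D f q (w q))"
    by (rule smooth_fun_on_cong[OF atlas W smr eq])
  assume p: "p \<in> W"
  have "D (\<lambda>q. D f q (w q)) p u = D ?r p u"
    by (rule fun_cong[OF D_cong[OF smr W p eq]])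
  also have "\<dots> = (\<Sum>b\<in>Basis. (w p \<bullet> b) *\<^sub>R D2 f p u b + (D w p u \<bullet> b) *\<^sub>R D f p b)"
    unfolding D_sum[OF sm W p] D_bilinear[OF bounded_bilinear_scaleR wb smooth_D[OF f W] W p]
      D_linear[OF bounded_linear_inner_left w W p] ..
  also have "\<dots> = D2 f p u (w p) + D f p (D w p u)"
    unfolding sum.distrib linear_expand[OF D_D_linear[OF f W p], symmetric] 
      linear_expand[OF linear_D[OF f W p], symmetric] ..
  finally show "D (\<lambda>q. D f q (w q)) p u = D2 f p u (w p) + D f p (D w p u)" .
qed

text \<open>The commutator of two left-invariant fields, evaluated on the coordinate map
  \<open>K\<close> at the unit, where the derivative of \<open>K\<close> is the identity. It is
  identified with \<open>lie_bracket\<close> in \<open>lie_bracket_eq\<close>.\<close>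

definition br :: "'e \<Rightarrow> 'e \<Rightarrow> 'e" where
  "br u v = D2 K \<one> u v - D2 K \<one> v u"

lemma D_K_one: "D K \<one> v = v"
  using D_coord_at[of "\<one>" v] by simp

text \<open>In the chart translated to \<open>p\<close>, a left-invariant field has the coefficient
  vector \<open>D K (L x) v\<close>, the same for every \<open>p\<close>: this is left
  invariance.\<close>

lemma D_in_coords:
  assumes f: "smooth_fun_on A W f" "open W" and x: "x \<in> K ` U0" "p \<otimes> L x \<in> W"
  shows "D f (p \<otimes> L x) v = frechet_derivative (\<lambda>x. f (p \<otimes> L x)) (at x) (D K (L x) v)"
proof (rule fun_cong[OF D_eqI])
  let ?\<phi> = "\<lambda>x. f (p \<otimes> L x)"
  have Lx: "L x \<in> U0" using x(1) L_K by auto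
  have 1: "((\<lambda>y. K (L x \<otimes> L y)) has_derivative D K (L x)) (at x0)"
    by (rule has_derivative_D[OF unit_chartD(6,1) Lx])
  have "(?\<phi> has_derivative frechet_derivative ?\<phi> (at x)) (at x)"
    using Cinf_on_has_derivative[OF Cinf_translate[OF f]] x by simp
  then have 2: "(?\<phi> has_derivative frechet_derivative ?\<phi> (at x)) (at (K (L x \<otimes> L x0)))"
    using K_L[OF x(1)] by simp
  have "((\<lambda>y. f (p \<otimes> L (K (L x \<otimes> L y)))) has_derivative (\<lambda>v. frechet_derivative ?\<phi> (at x) (D K (L x) v))) (at x0)"
    by (rule has_derivative_compose[OF 1 2])
  then show "((\<lambda>y. f (p \<otimes> L x \<otimes> L y)) has_derivative (\<lambda>v. frechet_derivative ?\<phi> (at x) (D K (L x) v))) (at x0)"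
    by (rule has_derivative_transform_within_open[OF _ open_coord_nbhd[OF unit_chartD(1)] x0_nbhd[OF Lx]])
      (simp add: L_K assoc)
qed

text \<open>The second-order part will cancel in commutators by symmetry of second derivatives. The
  first-order part comes from differentiating the coefficients of the field, and its vector
  \<open>D2 K \<one> u v\<close> depends neither on \<open>f\<close> nor on
  \<open>p\<close>.\<close>

lemma D_D_in_coords:
  assumes f: "smooth_fun_on A W f" "open W" and p: "p \<in> W"
  shows "D2 f p u v = (\<Sum>b\<in>Basis. (v \<bullet> b) *\<^sub>R 
      frechet_derivative (\<lambda>y. frechet_derivative (\<lambda>x. f (p \<otimes> L x)) (at y) b) (at x0) u)
    + D f p (D2 K \<one> u v)"
proof (rule fun_cong[OF D_eqI])
  let ?T = "{x \<in> K ` U0. p \<otimes> L x \<in> W}"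
  let ?d = "\<lambda>y b. frechet_derivative (\<lambda>x. f (p \<otimes> L x)) (at y) b"
  let ?r = "\<lambda>x. \<Sum>b\<in>Basis. (D K (L x) v \<bullet> b) *\<^sub>R ?d x b"
  have \<phi>: "Cinf_on ?T (\<lambda>x. f (p \<otimes> L x))" by (rule Cinf_translate[OF f])
  note oT = open_coord_nbhd[OF f(2), of p] and xT = x0_nbhd[OF p]
  have eq: "?r x = D f (p \<otimes> L x) v" if "x \<in> ?T" for x
  proof -
    have "x \<in> K ` U0" "p \<otimes> L x \<in> W" using that by auto
    from D_in_coords[OF f this] show ?thesis
      using linear_expand[OF has_derivative_linear[OF Cinf_on_has_derivative[OF \<phi> that]], of "D K (L x) v"] by simp
  qed
  have "((\<lambda>x. D K (\<one> \<otimes> L x) v) has_derivative (\<lambda>u. D2 K \<one> u v)) (at x0)"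
    by (rule has_derivative_D[OF smooth_D[OF unit_chartD(6,1)] unit_chartD(1) one_U0])
  then have E: "((\<lambda>x. D K (L x) v) has_derivative (\<lambda>u. D2 K \<one> u v)) (at x0)" by simp
  have d: "((\<lambda>x. ?d x b) has_derivative frechet_derivative (\<lambda>x. ?d x b) (at x0)) (at x0)" for b
    by (rule Cinf_on_has_derivative[OF Cinf_on_frechet[OF oT \<phi>] xT])
  have d0: "?d x0 b = D f p b" for b
    using frechet_derivative_at[OF has_derivative_D[OF f p]] by metis
  have "(?r has_derivative (\<lambda>u. \<Sum>b\<in>Basis. (D K (L x0) v \<bullet> b) *\<^sub>R frechet_derivative (\<lambda>x. ?d x b) (at x0) u 
      + (D2 K \<one> u v \<bullet> b) *\<^sub>R ?d x0 b)) (at x0)"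
    by (intro has_derivative_sum bounded_bilinear.FDERIV[OF bounded_bilinear_scaleR] d 
        bounded_linear.has_derivative[OF bounded_linear_inner_left E])
  moreover have "(\<Sum>b\<in>Basis. (D K (L x0) v \<bullet> b) *\<^sub>R frechet_derivative (\<lambda>x. ?d x b) (at x0) u 
      + (D2 K \<one> u v \<bullet> b) *\<^sub>R ?d x0 b) = (\<Sum>b\<in>Basis. (v \<bullet> b) *\<^sub>R frechet_derivative (\<lambda>x. ?d x b) (at x0) u)
      + D f p (D2 K \<one> u v)" for u
    unfolding d0 sum.distrib linear_expand[OF linear_D[OF f p], symmetric] by (simp add: D_K_one)
  ultimately have "(?r has_derivative (\<lambda>u. (\<Sum>b\<in>Basis. (v \<bullet> b) *\<^sub>R frechet_derivative (\<lambda>x. ?d x b) (at x0) u)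
      + D f p (D2 K \<one> u v))) (at x0)" by (simp only:)
  then show "((\<lambda>x. D f (p \<otimes> L x) v) has_derivative (\<lambda>u. (\<Sum>b\<in>Basis. (v \<bullet> b) *\<^sub>R frechet_derivative (\<lambda>x. ?d x b) (at x0) u)
      + D f p (D2 K \<one> u v))) (at x0)"
    by (rule has_derivative_transform_within_open[OF _ oT xT eq])
qed

lemma commutator_real:
  fixes f :: "'m \<Rightarrow> real"
  assumes f: "smooth_fun_on A W f" "open W" and p: "p \<in> W"
  shows "D2 f p u v - D2 f p v u = D f p (br u v)"
proof -
  let ?T = "{x \<in> K ` U0. p \<otimes> L x \<in> W}"
  let ?d = "\<lambda>y b. frechet_derivative (\<lambda>x. f (p \<otimes> L x)) (at y) b"
  let ?F = "\<lambda>b u. frechet_derivative (\<lambda>x. ?d x b) (at x0) u"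
  have \<phi>: "Cinf_on ?T (\<lambda>x. f (p \<otimes> L x))" by (rule Cinf_translate[OF f])
  note oT = open_coord_nbhd[OF f(2), of p] and xT = x0_nbhd[OF p]
  have lin: "linear (?F b)" for b
    by (rule has_derivative_linear[OF Cinf_on_has_derivative[OF Cinf_on_frechet[OF oT \<phi>] xT]])
  have sym: "?F b c = ?F c b" for b c
    by (rule symmetric_second_frechet_derivative[OF oT \<phi> xT])
  have "(\<Sum>b\<in>Basis. (v \<bullet> b) *\<^sub>R ?F b u) = (\<Sum>b\<in>Basis. (v \<bullet> b) *\<^sub>R (\<Sum>c\<in>Basis. (u \<bullet> c) *\<^sub>R ?F b c))"
    by (simp only: linear_expand[OF lin, of _ u])
  also have "\<dots> = (\<Sum>c\<in>Basis. (u \<bullet> c) *\<^sub>R (\<Sum>b\<in>Basis. (v \<bullet> b) *\<^sub>R ?F c b))"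
    unfolding scaleR_sum_right by (subst sum.swap) (simp add: sym mult_ac)
  also have "\<dots> = (\<Sum>c\<in>Basis. (u \<bullet> c) *\<^sub>R ?F c v)"
    by (simp only: linear_expand[OF lin, of _ v])
  finally show ?thesis
    unfolding D_D_in_coords[OF assms, of u v] D_D_in_coords[OF assms, of v u] br_def 
    by (simp add: linear_diff[OF linear_D[OF assms]])
qed

lemma commutator:
  fixes f :: "'m \<Rightarrow> 'b::euclidean_space"
  assumes f: "smooth_fun_on A W f" "open W" and p: "p \<in> W"
  shows "D2 f p u v - D2 f p v u = D f p (br u v)"
proof (rule euclidean_eqI)
  fix b :: 'b
  note bl = bounded_linear_inner_left
  have D: "D (\<lambda>q. f q \<bullet> b) q w = D f q w \<bullet> b" if "q \<in> W" for q w
    by (rule D_linear[OF bl f that])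
  have D2: "D2 (\<lambda>q. f q \<bullet> b) p u v = D2 f p u v \<bullet> b" for u v
  proof -
    have "D2 (\<lambda>q. f q \<bullet> b) p u v = D (\<lambda>q. D f q v \<bullet> b) p u"
      by (rule fun_cong[OF D_cong[OF smooth_fun_on_linear[OF bl smooth_D[OF f]] f(2) p]]) (simp add: D)
    then show ?thesis by (simp add: D_linear[OF bl smooth_D[OF f] f(2) p])
  qed
  show "(D2 f p u v - D2 f p v u) \<bullet> b = D f p (br u v) \<bullet> b"
    using commutator_real[OF smooth_fun_on_linear[OF bl f(1)] f(2) p, of b v u]
    by (simp add: D2 D[OF p] inner_diff_left)
qed

lemma bilinear_br: "bilinear br"
proof -
  have 1: "linear (D2 K \<one> u)" for u by (rule D_D_linear[OF unit_chartD(6,1) one_U0])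
  have 2: "linear (\<lambda>u. D2 K \<one> u v)" for v
    by (rule linear_D[OF smooth_D[OF unit_chartD(6,1)] unit_chartD(1) one_U0])
  show ?thesis
    unfolding bilinear_def br_def by (intro conjI allI linear_compose_sub 1 2)
qed

lemma br_anti: "br u v = - br v u"
  by (simp add: br_def)

abbreviation "field X \<equiv> smooth_fun_on A UNIV X"

text \<open>The constant fields contribute \<open>br\<close>, and the other two terms differentiate
  the components. \<open>D_separates\<close> provides the uniqueness required by
  \<open>THE\<close>.\<close>

lemma vf_bracket_eq:
  fixes X Y :: "'m \<Rightarrow> 'e"
  assumes "field X" "field Y"
  shows "vf_bracket N X Y p = D Y p (X p) - D X p (Y p) + br (X p) (Y p)" (is "_ = ?w")
proof -
  have *: "D f p ?w = vf_apply N X (vf_apply N Y f) p - vf_apply N Y (vf_apply N X f) p"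
    if f: "open W" "p \<in> W" "smooth_fun_on A W f" for W and f :: "'m \<Rightarrow> real"
  proof -
    note XW = smooth_fun_on_subset[OF assms(1) subset_UNIV] and YW = smooth_fun_on_subset[OF assms(2) subset_UNIV]
    note lin = linear_D[OF f(3,1,2)]
    show ?thesis
      unfolding vf_apply_def D_D_field[OF f(3) XW f(1,2)] D_D_field[OF f(3) YW f(1,2)]
        linear_add[OF lin] linear_diff[OF lin] commutator_real[OF f(3,1,2), symmetric] by simp
  qed
  show ?thesis unfolding vf_bracket_def
  proof (rule the_equality)
    show "w = ?w" if "\<forall>W f. open W \<and> p \<in> W \<and> smooth_fun_on A W f \<longrightarrow> 
        D f p w = vf_apply N X (vf_apply N Y f) p - vf_apply N Y (vf_apply N X f) p" for w
      by (rule D_separates[of p]) (use that * in auto)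
  qed (use * in blast)
qed

lemma lie_bracket_eq: "lie_bracket N = br"
  by (intro ext) (simp add: lie_bracket_def vf_bracket_eq smooth_fun_on_const D_const)

end


section \<open>The Levi-Civita connection of a pseudo-H-type group\<close>

locale H_group =
  fixes N :: "('m::{t2_space, second_countable_topology}, 'e::euclidean_space) lie_data" (structure)
    and g :: "'m \<Rightarrow> 'e \<Rightarrow> 'e \<Rightarrow> real"
  assumes pH: "pseudo_H_type N g"

sublocale H_group \<subseteq> lie N
  by unfold_locales (use pH in \<open>simp add: pseudo_H_type_def\<close>)

context H_group
begin

text \<open>Not an abbreviation, since \<open>g p = g \<one>\<close> would loop as a rewrite rule.\<close>

definition s where "s = g \<one>"

text \<open>The trivialization is made by left translations, which is why they appear as the
  identity; a left-invariant metric is therefore constant (\<open>g_const\<close>).\<close>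

lemma differential_translate: "dF (\<lambda>x. a \<otimes> x) p u = u"
proof -
  have "((\<lambda>x. K (inv (a \<otimes> p) \<otimes> (a \<otimes> (p \<otimes> L x)))) has_derivative (\<lambda>u. u)) (at x0)"
    by (rule has_derivative_transform_within_open[OF has_derivative_ident open_coord_nbhd[OF open_UNIV] x0_nbhd[OF UNIV_I]])
      (simp add: K_L inv_mult assoc)
  then show ?thesis
    unfolding differential_def using frechet_derivative_at by metis
qed

lemma g_const: "g p = s"
proof (intro ext)
  fix u v
  have "(\<lambda>x. p \<otimes> x) \<in> Isom N g" using pH by (simp add: pseudo_H_type_def left_invariant_def)
  then have "g (p \<otimes> \<one>) (dF (\<lambda>x. p \<otimes> x) \<one> u) (dF (\<lambda>x. p \<otimes> x) \<one> v) = g \<one> u v"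
    unfolding Isom_def by blast
  then show "g p u v = s u v" by (simp add: differential_translate s_def)
qed

end

text \<open>The interpretation proceeds in two stages: the H-type hypothesis is phrased by
  \<open>jmap\<close>, which is rewritten in terms of \<open>J\<close> before the second stage can
  use it.\<close>

sublocale H_group \<subseteq> pre: two_step_algebra "H_group.s N g" "lie.br N"
proof unfold_locales
  show "bilinear s" "s u v = s v u" for u v
    using pH by (auto simp: pseudo_H_type_def pseudo_riemannian_def s_def)
  show "u = 0" if "\<And>v. s u v = 0" for u
  proof -
    have "(\<forall>v. s u v = 0) \<longrightarrow> u = 0"
      using pH unfolding pseudo_H_type_def pseudo_riemannian_def s_def by blast
    then show ?thesis using that by blast
  qed
  show "bilinear br" by (rule bilinear_br)
  show "br u v = - br v u" for u v by (rule br_anti)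
  show "br u (br v w) = 0" for u v w
    using pH by (simp add: pseudo_H_type_def two_step_nilpotent_def lie_bracket_eq)
  show "\<exists>u v. br u v \<noteq> 0"
    using pH by (simp add: pseudo_H_type_def two_step_nilpotent_def lie_bracket_eq)
qed

context H_group
begin

lemma center_alg_eq: "center_alg N = pre.Z"
  by (simp add: center_alg_def pre.Z_def lie_bracket_eq)

lemma center_perp_eq: "center_perp N g = pre.V"
  by (simp add: center_perp_def pre.V_def center_alg_eq g_const)

lemma nondegenerate_Z: "z \<in> pre.Z \<Longrightarrow> (\<And>w. w \<in> pre.Z \<Longrightarrow> s z w = 0) \<Longrightarrow> z = 0"
  using pH by (auto simp: pseudo_H_type_def nondegenerate_center_def center_alg_eq g_const)

text \<open>\<open>jmap\<close> is tested on \<open>V\<close> and \<open>J\<close> on the whole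
  algebra. Both values lie in \<open>V\<close> and are thus orthogonal to the center, so pairings
  with \<open>V\<close> determine them.\<close>

lemma jmap_eq:
  assumes "v \<in> pre.V" shows "jmap N g z v = pre.J z v"
  unfolding jmap_def center_perp_eq lie_bracket_eq s_def[symmetric]
proof (rule the_equality)
  show "pre.J z v \<in> pre.V \<and> (\<forall>u'\<in>pre.V. s (pre.J z v) u' = s z (br v u'))"
    using pre.J_in_V pre.s_J by blast
  fix x assume x: "x \<in> pre.V \<and> (\<forall>u'\<in>pre.V. s x u' = s z (br v u'))"
  obtain Q where Q: "linear Q" "\<And>x. Q x \<in> pre.Z" "\<And>x z. z \<in> pre.Z \<Longrightarrow> s (x - Q x) z = 0"
    using pre.nondegenerate_splitting[OF pre.subspace_Z nondegenerate_Z] by metis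
  show "x = pre.J z v"
  proof (rule pre.eqI)
    fix y
    have "y - Q y \<in> pre.V" using Q(3) by (simp add: pre.V_def)
    then have "s x (y - Q y) = s (pre.J z v) (y - Q y)" using x pre.s_J by simp
    moreover have "s x (Q y) = 0" "s (pre.J z v) (Q y) = 0"
      using x pre.J_in_V Q(2) by (auto simp: pre.V_def)
    ultimately show "s x y = s (pre.J z v) y" by (simp add: pre.s_simps)
  qed
qed

end

sublocale H_group \<subseteq> alg: H_type_algebra "H_group.s N g" "lie.br N"
proof unfold_locales
  show "z = 0" if "z \<in> pre.Z" "\<And>w. w \<in> pre.Z \<Longrightarrow> s z w = 0" for z
    using nondegenerate_Z that by blast
  fix z v assume z: "z \<in> pre.Z" and v: "v \<in> pre.V"
  have "jmap N g z (jmap N g z v) = - s z z *\<^sub>R v"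
    using pH z v by (simp add: pseudo_H_type_def center_alg_eq center_perp_eq g_const)
  then show "pre.J z (pre.J z v) = - s z z *\<^sub>R v"
    by (simp add: jmap_eq v pre.J_in_V)
qed

context H_group
begin

section \<open>The explicit Levi-Civita connection and its curvature\<close>

abbreviation Gam where "Gam \<equiv> pre.Gam"

text \<open>\<open>Gam\<close> is the connection on constant fields, and the Leibniz rule adds the
  derivative of the components. The value 0 at non-smooth fields matches the normalization in
  \<open>is_levi_civita\<close>.\<close>

definition D0 :: "('m \<Rightarrow> 'e) \<Rightarrow> ('m \<Rightarrow> 'e) \<Rightarrow> 'm \<Rightarrow> 'e" where
  "D0 X Y = (if field X \<and> field Y then (\<lambda>p. D Y p (X p) + Gam (X p) (Y p)) else (\<lambda>_. 0))"

lemma bounded_Gam: "bounded_bilinear Gam"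
  using pre.Gam_bilin by (simp add: bilinear_conv_bounded_bilinear)

lemma bounded_s: "bounded_bilinear s"
  using pre.bilin by (simp add: bilinear_conv_bounded_bilinear)

lemma D0_eq: "field X \<Longrightarrow> field Y \<Longrightarrow> D0 X Y p = D Y p (X p) + Gam (X p) (Y p)"
  by (simp add: D0_def)

lemma field_D0:
  assumes "field X" "field Y" shows "field (D0 X Y)"
proof -
  have "field (\<lambda>p. D Y p (X p) + Gam (X p) (Y p))"
    by (intro smooth_fun_on_add smooth_D_field smooth_fun_on_bilinear[OF bounded_Gam] assms open_UNIV)
  then show ?thesis using assms by (simp add: D0_def)
qed

lemma affine_connection_D0: "affine_connection N D0"
  unfolding affine_connection_def Let_def
proof (intro conjI ballI ext; unfold mem_Collect_eq)
  fix X Y :: "'m \<Rightarrow> 'e" assume XY: "field X" "field Y"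
  note lin = linear_D[OF XY(2) open_UNIV UNIV_I]
  show "field (D0 X Y)" by (rule field_D0[OF XY])
  fix p
  show "D0 (\<lambda>p. X p + X' p) Y p = D0 X Y p + D0 X' Y p" if "field X'" for X'
    by (simp add: D0_eq XY that smooth_fun_on_add linear_add[OF lin] pre.Gam_simps)
  show "D0 X (\<lambda>p. Y p + Y' p) p = D0 X Y p + D0 X Y' p" if "field Y'" for Y'
    by (simp add: D0_eq XY that smooth_fun_on_add D_add[OF XY(2) that open_UNIV UNIV_I] pre.Gam_simps)
  fix f :: "'m \<Rightarrow> real" assume f: "smooth_fun_on A UNIV f"
  note fX = smooth_fun_on_bilinear[OF bounded_bilinear_scaleR f XY(1)]
  note fY = smooth_fun_on_bilinear[OF bounded_bilinear_scaleR f XY(2)]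
  show "D0 (\<lambda>p. f p *\<^sub>R X p) Y p = f p *\<^sub>R D0 X Y p"
    by (simp add: D0_eq XY fX linear_scale[OF lin] pre.Gam_simps scaleR_add_right)
  show "D0 X (\<lambda>p. f p *\<^sub>R Y p) p = vf_apply N X f p *\<^sub>R Y p + f p *\<^sub>R D0 X Y p"
    by (simp add: D0_eq XY fY D_bilinear[OF bounded_bilinear_scaleR f XY(2) open_UNIV UNIV_I] pre.Gam_simps scaleR_add_right vf_apply_def)
qed

lemma is_levi_civita_D0: "is_levi_civita N g D0"
  unfolding is_levi_civita_def Let_def
proof (intro conjI affine_connection_D0 ballI ext; unfold mem_Collect_eq)
  fix X Y :: "'m \<Rightarrow> 'e" and p assume XY: "field X" "field Y"
  show "D0 X Y p - D0 Y X p = vf_bracket N X Y p"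
    using pre.Gam_torsion[of "X p" "Y p"] by (simp add: D0_eq XY vf_bracket_eq algebra_simps)
  show "vf_apply N X (\<lambda>p. g p (Y p) (Z p)) p = g p (D0 X Y p) (Z p) + g p (Y p) (D0 X Z p)"
    if Z: "field Z" for Z
    using pre.Gam_metric[of "X p" "Y p" "Z p"]
    by (simp add: vf_apply_def g_const D0_eq XY Z pre.s_simps D_bilinear[OF bounded_s XY(2) Z open_UNIV UNIV_I])
next
  show "\<forall>X Y. \<not> field X \<or> \<not> field Y \<longrightarrow> D0 X Y = (\<lambda>_. 0)"
    by (auto simp: D0_def)
qed

lemma is_levi_civitaD:
  assumes "is_levi_civita N g C"
  shows "field X \<Longrightarrow> field Y \<Longrightarrow> C X Y p - C Y X p = vf_bracket N X Y p"
    and "field X \<Longrightarrow> field Y \<Longrightarrow> field W \<Longrightarrow>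
      vf_apply N X (\<lambda>p. s (Y p) (W p)) p = s (C X Y p) (W p) + s (Y p) (C X W p)"
    and "\<not> (field X \<and> field Y) \<Longrightarrow> C X Y = (\<lambda>_. 0)"
proof -
  have 1: "\<forall>X\<in>Collect field. \<forall>Y\<in>Collect field. (\<lambda>p. C X Y p - C Y X p) = vf_bracket N X Y"
    and 2: "\<forall>X\<in>Collect field. \<forall>Y\<in>Collect field. \<forall>Z\<in>Collect field.
         vf_apply N X (\<lambda>p. s (Y p) (Z p)) = (\<lambda>p. s (C X Y p) (Z p) + s (Y p) (C X Z p))"
    and 3: "\<forall>X Y. X \<notin> Collect field \<or> Y \<notin> Collect field \<longrightarrow> C X Y = (\<lambda>_. 0)"
    using assms by (simp_all only: is_levi_civita_def Let_def g_const) blast+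
  show "C X Y p - C Y X p = vf_bracket N X Y p" if "field X" "field Y"
    using fun_cong[OF bspec[OF bspec[OF 1]]] that by simp
  show "vf_apply N X (\<lambda>p. s (Y p) (W p)) p = s (C X Y p) (W p) + s (Y p) (C X W p)"
    if "field X" "field Y" "field W"
    using fun_cong[OF bspec[OF bspec[OF bspec[OF 2]]]] that by simp
  show "\<not> (field X \<and> field Y) \<Longrightarrow> C X Y = (\<lambda>_. 0)" using 3 by simp
qed

lemma is_levi_civita_unique:
  assumes C: "is_levi_civita N g C" shows "C = D0"
proof (intro ext)
  fix X Y :: "'m \<Rightarrow> 'e" and p
  note c = is_levi_civitaD[OF C] and d = is_levi_civitaD[OF is_levi_civita_D0]
  show "C X Y p = D0 X Y p"
  proof (cases "field X \<and> field Y")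
    case False
    then have "C X Y = (\<lambda>_. 0)" using c(3) by blast
    then show ?thesis using False by (auto simp: D0_def)
  next
    case True
    \<comment> \<open>\<open>T\<close> takes fields rather than vectors, so the cyclic argument of
      \<open>symmetric_skew_eq_0\<close> is repeated for fields evaluated at \<open>p\<close>, with
      the test vector \<open>w\<close> extended to a constant field.\<close>
    define T where "T X Y = C X Y p - D0 X Y p" for X Y
    have Tsym: "T X Y = T Y X" if "field X" "field Y" for X Y
      using c(1)[OF that, of p] d(1)[OF that, of p] by (simp add: T_def algebra_simps)
    have Tskew: "s (T X Y) (Z p) = - s (Y p) (T X Z)" if "field X" "field Y" "field Z" for X Y Z
      using c(2)[OF that, of p] d(2)[OF that, of p] by (simp add: T_def pre.s_simps)
    have "s (T X Y) w = 0" for w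
    proof -
      let ?Z = "\<lambda>_::'m. w"
      have Z: "field ?Z" by (rule smooth_fun_on_const)
      have "s (T X Y) w = - s (T X ?Z) (Y p)"
        using Tskew[of X Y ?Z] True Z pre.sym by simp
      also have "\<dots> = - s (T ?Z X) (Y p)" using Tsym True Z by simp
      also have "\<dots> = s (T ?Z Y) (X p)"
        using Tskew[of ?Z X Y] True Z pre.sym by simp
      also have "\<dots> = s (T Y ?Z) (X p)" using Tsym True Z by simp
      also have "\<dots> = - s (T Y X) w"
        using Tskew[of Y ?Z X] True Z pre.sym by simp
      also have "\<dots> = - s (T X Y) w" using Tsym True by simp
      finally show ?thesis by simp
    qed
    then have "T X Y = 0" by (rule pre.nondeg)
    then show ?thesis by (simp add: T_def)
  qed
qed

lemma levi_civita_eq: "levi_civita N g = D0"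
  unfolding levi_civita_def
  by (rule the_equality) (rule is_levi_civita_D0, rule is_levi_civita_unique)

lemma curvature_eq: "curvature N g p u v w = pre.Riem u v w"
proof -
  have D0_const: "D0 (\<lambda>_. a) (\<lambda>_. b) = (\<lambda>_. Gam a b)" for a b
    by (intro ext) (simp add: D0_eq smooth_fun_on_const D_const)
  have "vf_bracket N (\<lambda>_. u) (\<lambda>_. v) = (\<lambda>_. br u v)"
    by (intro ext) (simp add: vf_bracket_eq smooth_fun_on_const D_const)
  then show ?thesis
    by (simp add: curvature_def curvature_vf_def levi_civita_eq D0_const pre.Riem_def)
qed

lemma ricci_eq: "ricci N g p u w = pre.Ric u w"
  by (simp add: ricci_def curvature_eq pre.Ric_def)

lemma scalar_curvature_neg: "scalar_curvature N g p < 0"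
proof -
  have "ricci_op N g p = alg.Rc"
    by (intro ext) (simp add: ricci_op_def g_const ricci_eq alg.Rc_def)
  then show ?thesis by (simp add: scalar_curvature_def alg.trace_Rc_neg)
qed

end


section \<open>Isometries\<close>

text \<open>\<open>simply_connected\<close> makes any two loops homotopic, in particular the
  constant loops at two given points; the track of the base point joins these points.\<close>

lemma simply_connected_imp_connected_UNIV:
  assumes "simply_connected (UNIV :: 'm::topological_space set)"
  shows "connected (UNIV :: 'm set)"
proof -
  have "path_component UNIV a b" for a b :: 'm
  proof -
    have "path (\<lambda>_. a)" "path (\<lambda>_. b)" by (simp_all add: path_def)
    then have "homotopic_loops UNIV (\<lambda>_. a) (\<lambda>_. b)"
      using assms by (simp add: simply_connected_def pathstart_def pathfinish_def)
    then show ?thesis using homotopic_loops_imp_path_component_value[of UNIV "\<lambda>_. a" "\<lambda>_. b" 0] by simp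
  qed
  then show ?thesis
    by (intro path_connected_imp_connected) (simp add: path_connected_component)
qed

section \<open>The Maurer-Cartan equation and maps with equal differentials\<close>

context lie
begin

text \<open>One term for the motion of the base point \<open>F q\<close>, one for the change of
  \<open>w\<close>. It serves to differentiate \<open>D f (F q) (dF F q v)\<close> in
  \<open>structure_equation\<close>.\<close>

lemma D_D_pullback:
  assumes F: "smooth_map A A F" and f: "smooth_fun_on A W f" "open W"
    and w: "field w" and p: "F p \<in> W"
  shows "D (\<lambda>q. D f (F q) (w q)) p u = D2 f (F p) (dF F p u) (w p) + D f (F p) (D w p u)"
proof -
  let ?W = "{q. F q \<in> W}"
  let ?r = "\<lambda>q. \<Sum>b\<in>Basis. (w q \<bullet> b) *\<^sub>R D f (F q) b"
  have W: "open ?W" and pW: "p \<in> ?W" using smooth_fun_on_comp_map(2)[OF F f] p by auto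
  have eq: "?r q = D f (F q) (w q)" if "q \<in> ?W" for q
    using linear_expand[OF linear_D[OF f], of "F q" "w q"] that by simp
  note wW = smooth_fun_on_subset[OF w subset_UNIV]
  note wb = smooth_fun_on_linear[OF bounded_linear_inner_left wW]
  note df = smooth_fun_on_comp_map(1)[OF F smooth_D[OF f] f(2)]
  have sm: "smooth_fun_on A ?W (\<lambda>q. (w q \<bullet> b) *\<^sub>R D f (F q) b)" for b
    by (rule smooth_fun_on_bilinear[OF bounded_bilinear_scaleR wb df])
  have "D (\<lambda>q. D f (F q) (w q)) p u = D ?r p u"
    by (rule fun_cong[OF D_cong[OF smooth_fun_on_sum[OF sm] W pW eq]])
  also have "\<dots> = (\<Sum>b\<in>Basis. (w p \<bullet> b) *\<^sub>R D2 f (F p) (dF F p u) b + (D w p u \<bullet> b) *\<^sub>R D f (F p) b)"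
    unfolding D_sum[OF sm W pW] D_bilinear[OF bounded_bilinear_scaleR wb df W pW]
      D_linear[OF bounded_linear_inner_left wW W pW] D_comp[OF F smooth_D[OF f] f(2) p] ..
  also have "\<dots> = D2 f (F p) (dF F p u) (w p) + D f (F p) (D w p u)"
    unfolding sum.distrib linear_expand[OF D_D_linear[OF f p], symmetric] 
      linear_expand[OF linear_D[OF f p], symmetric] ..
  finally show ?thesis .
qed

text \<open>The Maurer--Cartan equation, pulled back by \<open>F\<close>.\<close>

lemma structure_equation:
  assumes F: "smooth_map A A F"
  shows "D (\<lambda>q. dF F q v) p u - D (\<lambda>q. dF F q u) p v = dF F p (br u v) - br (dF F p u) (dF F p v)"
proof -
  \<comment> \<open>\<open>?f\<close> has the identity as derivative at \<open>F p\<close>, so the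
    equation can be read off by comparing the commutator of \<open>?f\<close> at \<open>F p\<close>
    with that of its pullback \<open>?h\<close> at \<open>p\<close>.\<close>
  let ?f = "\<lambda>q. K (inv (F p) \<otimes> q)" and ?W = "chart_at (F p)"
  let ?h = "\<lambda>q. ?f (F q)" and ?W' = "{q. F q \<in> chart_at (F p)}"
  note f = smooth_coord_at[of "F p"] open_chart_at[of "F p"]
  note h = smooth_fun_on_comp_map[OF F f]
  have p: "F p \<in> ?W" "p \<in> ?W'" by (simp_all add: mem_chart_at)
  have Dh: "D ?h q v = D ?f (F q) (dF F q v)" if "q \<in> ?W'" for q v
    using D_comp[OF F f] that by simp
  have D2h: "D2 ?h p u v = D2 ?f (F p) (dF F p u) (dF F p v) + D (\<lambda>q. dF F q v) p u" for u v
  proof -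
    have "D2 ?h p u v = D (\<lambda>q. D ?f (F q) (dF F q v)) p u"
      by (rule fun_cong[OF D_cong[OF smooth_D[OF h] h(2) p(2) Dh], symmetric])
    then show ?thesis
      by (simp add: D_D_pullback[OF F f smooth_differential[OF F] p(1)] D_coord_at)
  qed
  show ?thesis
    using commutator[OF h p(2), of v u] commutator[OF f p(1), of "dF F p v" "dF F p u"]
    by (simp add: D2h Dh[OF p(2)] D_coord_at algebra_simps)
qed

lemma D_eq_0_imp_const:
  assumes "connected (UNIV :: 'm set)" "field f" "\<And>p u. D f p u = 0"
  shows "f p = f q"
proof -
  have "f constant_on UNIV"
    by (rule locally_constant_imp_constant[OF assms(1)])
      (use D_eq_0_imp_locally_const[OF assms(2) open_UNIV assms(3)] in auto)
  then show ?thesis by (auto simp: constant_on_def)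
qed

text \<open>To first order at \<open>p\<close>, the two factors move by
  \<open>H p \<otimes> x\<close> and \<open>G p \<otimes> y\<close> with equal velocities of
  \<open>x\<close> and \<open>y\<close>, and
  \<open>H p \<otimes> x \<otimes> inv y \<otimes> inv (G p)\<close> is constant for
  \<open>x = y\<close>.\<close>

lemma equal_differential_imp_D_quotient_0:
  assumes H: "smooth_map A A H" and G: "smooth_map A A G" and eq: "\<And>u. dF H p u = dF G p u"
    and f: "smooth_fun_on A W f" "open W" "H p \<otimes> inv (G p) \<in> W"
  shows "D (\<lambda>q. f (H q \<otimes> inv (G q))) p u = 0"
proof -
  let ?m = "\<lambda>z. H p \<otimes> (fst z \<otimes> (inv (snd z) \<otimes> inv (G p)))"
  let ?S = "map_prod K K ` ((U0 \<times> U0) \<inter> {z. ?m z \<in> W})"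
  let ?\<Phi> = "\<lambda>z. f (H p \<otimes> (L (fst z) \<otimes> (inv (L (snd z)) \<otimes> inv (G p))))"
  have m: "smooth_map (prod_atlas A A) A ?m"
    by (intro smooth_mult smooth_inv atlas2 smooth_map_fst smooth_map_snd atlas smooth_map_const)
  have sm: "smooth_fun_on (prod_atlas A A) {z. ?m z \<in> W} (\<lambda>z. f (?m z))"
    by (rule smooth_fun_comp[OF atlas2 m f(1,2)]) auto
  have ch: "(U0 \<times> U0, map_prod K K) \<in> prod_atlas A A"
    using unit_chart by (auto simp: prod_atlas_def)
  have oS: "open ?S" by (rule smooth_atlasD(5)[OF atlas2 ch open_vimage_smooth[OF m f(2)]])
  have "Cinf_on ?S ?\<Phi>"
    by (rule Cinf_on_cong_open[OF oS _ smooth_fun_onD[OF sm ch]])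
      (auto simp: the_inv_into_map_prod unit_chartD(2) L_K)
  moreover have mem: "(x0, x0) \<in> ?S"
    using f(3) one_U0 by (intro image_eqI[of _ _ "(\<one>, \<one>)"]) auto
  ultimately have \<Phi>: "(?\<Phi> has_derivative frechet_derivative ?\<Phi> (at (x0, x0))) (at (x0, x0))" 
    (is "(_ has_derivative ?\<Phi>') _") by (rule Cinf_on_has_derivative)
  \<comment> \<open>On the diagonal the two middle factors of \<open>?\<Phi>\<close> cancel, so it
    is constant there.\<close>
  have diag: "?\<Phi>' (w, w) = 0" for w
  proof -
    have "((\<lambda>x. (x, x)) has_derivative (\<lambda>w. (w, w))) (at x0)"
      by (intro has_derivative_Pair has_derivative_ident)
    from has_derivative_compose[OF this \<Phi>]
    have "((\<lambda>x. f (H p \<otimes> inv (G p))) has_derivative (\<lambda>w. ?\<Phi>' (w, w))) (at x0)" by simp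
    from has_derivative_unique[OF this has_derivative_const] show ?thesis by metis
  qed
  let ?h = "\<lambda>y. K (inv (H p) \<otimes> H (p \<otimes> L y))" and ?g = "\<lambda>y. K (inv (G p) \<otimes> G (p \<otimes> L y))"
  have "((\<lambda>y. (?h y, ?g y)) has_derivative (\<lambda>u. (dF H p u, dF G p u))) (at x0)"
    by (intro has_derivative_Pair has_derivative_differential H G)
  moreover have "(?\<Phi> has_derivative ?\<Phi>') (at (?h x0, ?g x0))" using \<Phi> by simp
  ultimately have "((\<lambda>y. ?\<Phi> (?h y, ?g y)) has_derivative (\<lambda>u. ?\<Phi>' (dF H p u, dF G p u))) (at x0)"
    by (rule has_derivative_compose)
  then have d: "((\<lambda>y. ?\<Phi> (?h y, ?g y)) has_derivative (\<lambda>u. 0)) (at x0)" by (simp only: eq diag)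
  let ?T = "{x. H x \<in> chart_at (H p)} \<inter> {x. G x \<in> chart_at (G p)}"
  have T: "open ?T" using open_vimage_smooth[OF H open_chart_at] open_vimage_smooth[OF G open_chart_at] by (rule open_Int)
  have pT: "p \<in> ?T" by (simp add: mem_chart_at)
  have "((\<lambda>y. f (H (p \<otimes> L y) \<otimes> inv (G (p \<otimes> L y)))) has_derivative (\<lambda>u. 0)) (at x0)"
    by (rule has_derivative_transform_within_open[OF d open_coord_nbhd[OF T] x0_nbhd[OF pT]])
      (simp add: chart_at_def L_K inv_mult assoc)
  from fun_cong[OF D_eqI[OF this]] show ?thesis .
qed

text \<open>Left translates \<open>n \<otimes> G x\<close> have the same left-trivialized
  differential as \<open>G\<close>, so the quotient to be shown constant is
  \<open>H q \<otimes> inv (G q)\<close>; locally this is tested in a chart around its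
  value.\<close>

lemma equal_differential_imp_equal:
  assumes conn: "connected (UNIV :: 'm set)"
    and H: "smooth_map A A H" and G: "smooth_map A A G" 
    and eq: "\<And>p u. dF H p u = dF G p u" and one: "H \<one> = G \<one>"
  shows "H x = G x"
proof -
  let ?M = "\<lambda>q. H q \<otimes> inv (G q)"
  have M: "smooth_map A A ?M" by (intro smooth_mult smooth_inv atlas H G)
  have "?M constant_on UNIV"
  proof (rule locally_constant_imp_constant[OF conn])
    fix p
    let ?f = "\<lambda>q. K (inv (?M p) \<otimes> q)" and ?W = "{q. ?M q \<in> chart_at (?M p)}"
    note f = smooth_coord_at[of "?M p"] open_chart_at[of "?M p"]
    note fM = smooth_fun_on_comp_map[OF M f]
    have "D (\<lambda>q. ?f (?M q)) q u = 0" if "q \<in> ?W" for q u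
      by (rule equal_differential_imp_D_quotient_0[OF H G eq f]) (use that in simp)
    moreover have "p \<in> ?W" by (simp add: mem_chart_at)
    ultimately obtain T where T: "open T" "p \<in> T" "T \<subseteq> ?W" "\<And>q. q \<in> T \<Longrightarrow> ?f (?M q) = ?f (?M p)"
      using D_eq_0_imp_locally_const[OF fM] by meson
    have "?M q = ?M p" if "q \<in> T" for q
    proof -
      have "inv (?M p) \<otimes> ?M q \<in> U0" "inv (?M p) \<otimes> ?M p \<in> U0"
        using T(3) that one_U0 by (auto simp: chart_at_def)
      then have "inv (?M p) \<otimes> ?M q = inv (?M p) \<otimes> ?M p"
        using T(4)[OF that] unit_chartD(2) by (auto dest: inj_onD)
      then have "?M p \<otimes> (inv (?M p) \<otimes> ?M q) = ?M p \<otimes> (inv (?M p) \<otimes> ?M p)" by (rule arg_cong)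
      then show ?thesis by (simp only: cancel)
    qed
    then show "\<exists>T. openin (top_of_set UNIV) T \<and> p \<in> T \<and> (\<forall>q\<in>T. ?M q = ?M p)"
      by (intro exI[of _ T] conjI ballI T(2)) (simp_all only: subtopology_UNIV open_openin[symmetric] T(1))
  qed
  then have "?M x = ?M \<one>" by (auto simp: constant_on_def)
  then have "?M x = \<one>" using one by simp
  then have "?M x \<otimes> G x = G x" by simp
  then show ?thesis by (simp add: assoc)
qed

lemma differential_translate_left: "dF (\<lambda>x. n \<otimes> F (a \<otimes> x)) p = dF F (a \<otimes> p)"
  by (simp add: differential_def inv_mult assoc)

end

context H_group
begin

lemma connected: "connected (UNIV :: 'm set)"
  by (rule simply_connected_imp_connected_UNIV) (use pH in \<open>simp add: pseudo_H_type_def\<close>)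

lemma IsomD:
  assumes "F \<in> Isom N g"
  shows "bij F" "smooth_map A A F" "smooth_map A A (inv_into UNIV F)" "s (dF F p u) (dF F p v) = s u v"
  using assms by (auto simp: Isom_def diffeomorphism_def g_const)

lemma Isom_translate:
  assumes F: "F \<in> Isom N g" shows "(\<lambda>x. n \<otimes> F x) \<in> Isom N g"
proof -
  note F = IsomD[OF F]
  have comp: "(\<lambda>y. inv_into UNIV F (inv n \<otimes> y)) \<circ> (\<lambda>x. n \<otimes> F x) = id"
    "(\<lambda>x. n \<otimes> F x) \<circ> (\<lambda>y. inv_into UNIV F (inv n \<otimes> y)) = id"
    using F(1) by (auto simp: bij_def surj_f_inv_f)
  have bij: "bij (\<lambda>x. n \<otimes> F x)" by (rule o_bij[OF comp])
  have inverse: "inv_into UNIV (\<lambda>x. n \<otimes> F x) = (\<lambda>y. inv_into UNIV F (inv n \<otimes> y))"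
    by (rule inv_unique_comp[OF comp(2,1)])
  have "smooth_map A A (\<lambda>x. n \<otimes> F x)" by (intro smooth_mult atlas smooth_map_const F)
  moreover have "smooth_map A A (\<lambda>y. inv_into UNIV F (inv n \<otimes> y))"
    by (rule smooth_map_comp[OF atlas atlas atlas smooth_translate F(3)])
  ultimately show ?thesis
    using F(4) differential_translate_left[of n F \<one>] bij
    by (simp add: Isom_def diffeomorphism_def g_const inverse)
qed

section \<open>Rigidity of the differential of an isometry\<close>

context
  fixes F assumes F: "F \<in> Isom N g"
begin

lemma linear_dF: "linear (dF F p)"
  by (rule linear_differential[OF IsomD(2)[OF F]])

lemma dF_bij: "bij (dF F p)"
proof -
  have "inj (dF F p)"
    unfolding linear_injective_0[OF linear_dF]
  proof (intro allI impI)
    fix u assume "dF F p u = 0"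
    then have "s u v = 0" for v using IsomD(4)[OF F, of p u v] by (simp add: pre.s_simps)
    then show "u = 0" by (rule pre.nondeg)
  qed
  then show ?thesis using linear_injective_imp_surjective[OF linear_dF] by (simp add: bij_def)
qed

lemma field_dF: "field (\<lambda>q. dF F q v)"
  by (rule smooth_differential[OF IsomD(2)[OF F]])

lemma D_differential: "D (\<lambda>q. dF F q v) p u = dF F p (Gam u v) - Gam (dF F p u) (dF F p v)"
proof -
  let ?a = "dF F p"
  note a_simps = linear_0[OF linear_dF] linear_add[OF linear_dF] linear_diff[OF linear_dF]
  define E where "E u v = D (\<lambda>q. dF F q v) p u - (?a (Gam u v) - Gam (?a u) (?a v))" for u v
  \<comment> \<open>Pulling the defect \<open>E\<close> back by \<open>?a\<close> gives values in
    the same Lie algebra as its arguments, where \<open>symmetric_skew_eq_0\<close> applies.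
    Symmetry comes from the structure equation and the torsion, skewness from differentiating the
    constant product of \<open>dF F q v\<close> and \<open>dF F q w\<close>.\<close>
  define T where "T u v = inv_into UNIV ?a (E u v)" for u v
  have aT: "?a (T u v) = E u v" for u v
    unfolding T_def using dF_bij by (simp add: bij_def surj_f_inv_f)
  have "T u v = 0" for u v
  proof (rule pre.symmetric_skew_eq_0[where T = T])
    fix u v w
    have "E u v = E v u"
    proof -
      have "?a (Gam u v) - ?a (Gam v u) = ?a (br u v)" 
        by (simp only: pre.Gam_torsion flip: linear_diff[OF linear_dF])
      then show ?thesis
        using structure_equation[OF IsomD(2)[OF F], of v p u] pre.Gam_torsion[of "?a u" "?a v"]
        by (simp add: E_def algebra_simps)
    qed
    then show "T u v = T v u" by (simp add: T_def)
    have "D (\<lambda>q. s (dF F q v) (dF F q w)) p u = 0"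
      by (simp add: IsomD(4)[OF F] D_const)
    then have "s (?a v) (D (\<lambda>q. dF F q w) p u) + s (D (\<lambda>q. dF F q v) p u) (?a w) = 0"
      by (simp add: D_bilinear[OF bounded_s field_dF field_dF open_UNIV UNIV_I])
    moreover have "s (?a (Gam u v)) (?a w) + s (?a v) (?a (Gam u w)) = 0"
      using pre.Gam_metric by (simp add: IsomD(4)[OF F])
    ultimately have "s (E u v) (?a w) + s (?a v) (E u w) = 0"
      using pre.Gam_metric[of "?a u" "?a v" "?a w"] by (simp add: E_def pre.s_simps)
    then show "s (T u v) w = - s v (T u w)"
      using IsomD(4)[OF F, of p "T u v" w] IsomD(4)[OF F, of p v "T u w"] by (simp add: aT)
  qed
  then have "E u v = 0" using aT[of u v] by (simp add: a_simps)
  then show ?thesis by (simp add: E_def)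
qed

text \<open>The second derivatives of \<open>dF F q w\<close> are computed from
  \<open>D_differential\<close> and commuted. The terms with one \<open>Gam\<close> inside
  \<open>?a\<close> and one outside acting on the result are together symmetric in \<open>u\<close>
  and \<open>v\<close> and cancel; the others assemble into the two curvatures.\<close>

lemma Riem_dF: "dF F p (pre.Riem u v w) = pre.Riem (dF F p u) (dF F p v) (dF F p w)"
proof -
  let ?a = "dF F p"
  note a_simps = linear_0[OF linear_dF] linear_add[OF linear_dF] linear_diff[OF linear_dF]
  have D2: "D2 (\<lambda>q. dF F q w) p u v = ?a (Gam u (Gam v w)) - Gam (?a u) (?a (Gam v w))
     - Gam (?a v) (?a (Gam u w)) + Gam (?a v) (Gam (?a u) (?a w))
     - Gam (?a (Gam u v)) (?a w) + Gam (Gam (?a u) (?a v)) (?a w)" for u v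
  proof -
    have neg: "field (\<lambda>q. - Gam (dF F q v) (dF F q w))"
      by (intro smooth_fun_on_linear[OF bounded_linear_minus[OF bounded_linear_ident]] 
          smooth_fun_on_bilinear[OF bounded_Gam] field_dF)
    have "D2 (\<lambda>q. dF F q w) p u v = D (\<lambda>q. dF F q (Gam v w) + - Gam (dF F q v) (dF F q w)) p u"
      by (simp add: D_differential)
    also have "\<dots> = D (\<lambda>q. dF F q (Gam v w)) p u + D (\<lambda>q. - Gam (dF F q v) (dF F q w)) p u"
      by (rule D_add[OF field_dF neg open_UNIV UNIV_I])
    also have "D (\<lambda>q. - Gam (dF F q v) (dF F q w)) p u = - D (\<lambda>q. Gam (dF F q v) (dF F q w)) p u"
      by (rule D_linear[OF bounded_linear_minus[OF bounded_linear_ident] _ open_UNIV UNIV_I]) 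
        (intro smooth_fun_on_bilinear[OF bounded_Gam] field_dF)
    finally show ?thesis
      by (simp add: D_bilinear[OF bounded_Gam field_dF field_dF open_UNIV UNIV_I] D_differential pre.Gam_simps)
  qed
  have "D2 (\<lambda>q. dF F q w) p u v - D2 (\<lambda>q. dF F q w) p v u = ?a (Gam (br u v) w) - Gam (?a (br u v)) (?a w)"
    using commutator[OF field_dF open_UNIV UNIV_I] by (simp add: D_differential)
  moreover have "Gam (?a (Gam u v)) (?a w) - Gam (?a (Gam v u)) (?a w) = Gam (?a (br u v)) (?a w)"
    by (simp only: pre.Gam_torsion flip: linear_diff[OF linear_dF] bilinear_lsub[OF pre.Gam_bilin])
  moreover have "Gam (Gam (?a u) (?a v)) (?a w) - Gam (Gam (?a v) (?a u)) (?a w) = Gam (br (?a u) (?a v)) (?a w)"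
    by (simp only: pre.Gam_torsion flip: bilinear_lsub[OF pre.Gam_bilin])
  ultimately show ?thesis
    unfolding pre.Riem_def a_simps D2 by (simp add: algebra_simps)
qed

lemma dF_splits: "dF F p ` pre.Z = pre.Z" "dF F p ` pre.V = pre.V"
  using alg.Ric_isometry_splits[OF dF_bij IsomD(4)[OF F] pre.Ric_invariant[OF linear_dF dF_bij Riem_dF]] by auto

lemma dF_const: "dF F p = dF F q"
proof (rule ext)
  fix w
  have split: "dF F q w \<in> pre.Z" if "w \<in> pre.Z" for q w using dF_splits(1) that by blast
  have split': "dF F q w \<in> pre.V" if "w \<in> pre.V" for q w using dF_splits(2) that by blast
  have "D (\<lambda>q. dF F q w) p u = 0" for p u w
  proof (rule alg.splitting_rigid[where a = "dF F p" and d = "\<lambda>u w. D (\<lambda>q. dF F q w) p u"])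
    fix u w
    show "D (\<lambda>q. dF F q w) p u \<in> pre.Z" if "w \<in> pre.Z"
    proof -
      \<comment> \<open>The projection \<open>P\<close> does not vary with \<open>q\<close> and
        annihilates \<open>dF F q w\<close>, hence also its derivative, which therefore stays in
        \<open>Z\<close>.\<close>
      have "D (\<lambda>q. alg.P (dF F q w)) p u = 0" by (simp add: alg.P_Z split[OF that] D_const)
      then have "alg.P (D (\<lambda>q. dF F q w) p u) = 0"
        using D_linear[OF linear_conv_bounded_linear[THEN iffD1, OF alg.linear_P] field_dF open_UNIV UNIV_I] by simp
      then show ?thesis using alg.P_plus_Q[of "D (\<lambda>q. dF F q w) p u"] alg.Q_props(2) by (metis add_0)
    qed
    show "D (\<lambda>q. dF F q w) p u \<in> pre.V" if "w \<in> pre.V"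
    proof -
      have "D (\<lambda>q. alg.Q (dF F q w)) p u = 0" by (simp add: alg.Q_V split'[OF that] D_const)
      then have "alg.Q (D (\<lambda>q. dF F q w) p u) = 0"
        using D_linear[OF linear_conv_bounded_linear[THEN iffD1, OF alg.Q_props(1)] field_dF open_UNIV UNIV_I] by simp
      then show ?thesis using alg.P_plus_Q[of "D (\<lambda>q. dF F q w) p u"] alg.P_in_V by (metis add.right_neutral)
    qed
  qed (use linear_dF dF_splits D_differential in auto)
  from D_eq_0_imp_const[OF connected field_dF this] show "dF F p w = dF F q w" .
qed

lemma Isom_fixing_one_hom:
  assumes "F \<one> = \<one>" shows "F (a \<otimes> x) = F a \<otimes> F x"
proof -
  have "inv (F a) \<otimes> F (a \<otimes> x) = F x"
  proof (rule equal_differential_imp_equal[where H = "\<lambda>x. inv (F a) \<otimes> F (a \<otimes> x)", OF connected])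
    show "smooth_map A A (\<lambda>x. inv (F a) \<otimes> F (a \<otimes> x))"
      by (intro smooth_mult atlas smooth_map_const smooth_map_comp[OF atlas atlas atlas smooth_translate IsomD(2)[OF F]])
    show "smooth_map A A F" by (rule IsomD(2)[OF F])
    show "dF (\<lambda>x. inv (F a) \<otimes> F (a \<otimes> x)) p u = dF F p u" for p u
      unfolding differential_translate_left using dF_const by metis
  qed (simp add: assms)
  then have "F a \<otimes> (inv (F a) \<otimes> F (a \<otimes> x)) = F a \<otimes> F x" by simp
  then show ?thesis by simp
qed

end

lemma Isom_spl_eq: "Isom_spl N g = Isom N g"
  unfolding Isom_spl_def center_alg_eq center_perp_eq by (simp add: dF_splits cong: conj_cong)

lemma Isom_aut_eq: "Isom_aut N g = Isom N g"
proof
  show "Isom_aut N g \<subseteq> Isom N g"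
    unfolding Isom_aut_def using Isom_translate by auto
  show "Isom N g \<subseteq> Isom_aut N g"
  proof
    fix F assume F: "F \<in> Isom N g"
    \<comment> \<open>Normalized to fix the unit, so that \<open>Isom_fixing_one_hom\<close>
      applies; the translation split off here becomes the factor \<open>n\<close> in
      \<open>Isom_aut\<close>.\<close>
    define G where "G x = inv (F \<one>) \<otimes> F x" for x
    have G: "G \<in> Isom N g" unfolding G_def[abs_def] by (rule Isom_translate[OF F])
    have hom: "G (a \<otimes> x) = G a \<otimes> G x" for a x
      by (rule Isom_fixing_one_hom[OF G]) (simp add: G_def)
    have "G \<in> Lie_Aut N"
      using G hom IsomD(1)[OF G] by (auto simp: Lie_Aut_def iso_def hom_def carrier Isom_def)
    moreover have "F = (\<lambda>x. F \<one> \<otimes> G x)" by (simp add: G_def)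
    ultimately show "F \<in> Isom_aut N g" unfolding Isom_aut_def using G by blast
  qed
qed

end

theorem theorem4p4:
  fixes N :: "('m::{t2_space, second_countable_topology}, 'e::euclidean_space) lie_data"
    and g :: "'m \<Rightarrow> 'e \<Rightarrow> 'e \<Rightarrow> real"
  assumes "pseudo_H_type N g"
  shows "(Isom_aut N g = Isom_spl N g \<and> Isom_spl N g = Isom N g) \<and>
         (\<forall>p. scalar_curvature N g p < 0)"
proof -
  interpret H_group N g by unfold_locales (rule assms)
  show ?thesis using Isom_spl_eq Isom_aut_eq scalar_curvature_neg by simp
qed

end
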